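(* Let $M$ be a $4$-manifold and let $(\eta^0(t),\eta^1(t),\eta^2(t),\eta^3(t))$, $t\in(t_-,t_+)$, be a one-parameter family of $\{\mathrm{Id}\}$-structures on $M$ such that \[d\eta^0=-2\eta^{23},\qquad d\eta^{31}=3\eta^{012},\qquad d\eta^{12}=-3\eta^{031}\qquad( * )\] holds for $t=t_0$, for some $t_0\in(t_-,t_+)$. Then the induced $\mathrm{SU}(2)$-structure on $\mathbf{M}=M\times(t_-,t_+)$, \[\alpha=\eta^0(t),\quad \omega_1=\eta^{23}(t)+\eta^1(t)\wedge dt,\quad \omega_2=\eta^{31}(t)+\eta^2(t)\wedge dt,\quad \omega_3=\eta^{12}(t)+\eta^3(t)\wedge dt,\] is Einstein-Sasaki if and only if \[\partial_t\eta^0=2\eta^1,\qquad \partial_t\eta^{23}=-d\eta^1,\qquad \partial_t\eta^{31}=3\eta^{03}-d\eta^2,\qquad \partial_t\eta^{12}=-3\eta^{02}-d\eta^3 .\] In this case, $( * )$ holds for all $t$.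
   Context: An $\{\mathrm{Id}\}$-structure on a $4$-manifold is a global coframe $(\eta^0,\dots,\eta^3)$; $\eta^{ij}=\eta^i\wedge\eta^j$ and $\eta^{ijk}=\eta^i\wedge\eta^j\wedge\eta^k$. In $( * )$ and in the evolution equations $d$ is the exterior derivative on $M$. An $\mathrm{SU}(2)$-structure on a $5$-manifold is given by differential forms $(\alpha,\omega_1,\omega_2,\omega_3)$ such that locally there is a coframe $e^1,\dots,e^5$ with $\alpha=e^5$, $\omega_1=e^{12}+e^{34}$, $\omega_2=e^{13}+e^{42}$, $\omega_3=e^{14}+e^{23}$. The $\mathrm{SU}(2)$-structure is Einstein-Sasaki if $d\alpha=-2\omega_1$, $d\omega_2=3\alpha\wedge\omega_3$, $d\omega_3=-3\alpha\wedge\omega_2$. *)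

theory Defs
  imports "HOL-Analysis.Analysis" "HOL-Library.Function_Algebras"
begin

text \<open>Only used on open subsets of finite-dimensional spaces, where continuity of all directional
  derivatives is the same as continuity of the derivative.\<close>

primrec Ck_on :: "nat \<Rightarrow> 'a::real_normed_vector set \<Rightarrow> ('a \<Rightarrow> 'b::real_normed_vector) \<Rightarrow> bool" where
  "Ck_on 0 S f = continuous_on S f"
| "Ck_on (Suc k) S f =
    ((\<forall>x\<in>S. f differentiable (at x)) \<and> (\<forall>v. Ck_on k S (\<lambda>x. frechet_derivative f (at x) v)))"

definition smooth_on :: "'a::real_normed_vector set \<Rightarrow> ('a \<Rightarrow> 'b::real_normed_vector) \<Rightarrow> bool" where
  "smooth_on S f \<longleftrightarrow> (\<forall>k. Ck_on k S f)"

text \<open>A topological space with an atlas \<open>(chart_dom i, chart_map i)\<close>, \<open>i \<in> idx\<close>, modelled on a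
  Euclidean space.\<close>

record ('m, 'e, 'i) mfd =
  pts :: "'m topology"
  idx :: "'i set"
  chart_dom :: "'i \<Rightarrow> 'm set"
  chart_map :: "'i \<Rightarrow> 'm \<Rightarrow> 'e"

definition chart_img :: "('m, 'e, 'i) mfd \<Rightarrow> 'i \<Rightarrow> 'e set" where
  "chart_img X i = chart_map X i ` chart_dom X i"

definition transition :: "('m, 'e, 'i) mfd \<Rightarrow> 'i \<Rightarrow> 'i \<Rightarrow> 'e \<Rightarrow> 'e" where
  "transition X i j = chart_map X j \<circ> inv_into (chart_dom X i) (chart_map X i)"

definition smooth_manifold :: "('m, 'e::euclidean_space, 'i) mfd \<Rightarrow> bool" where
  "smooth_manifold X \<longleftrightarrow>
     Hausdorff_space (pts X) \<and> second_countable (pts X) \<and>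
     topspace (pts X) = (\<Union>i\<in>idx X. chart_dom X i) \<and>
     (\<forall>i\<in>idx X. openin (pts X) (chart_dom X i) \<and> open (chart_img X i) \<and>
        homeomorphic_map (subtopology (pts X) (chart_dom X i))
          (top_of_set (chart_img X i)) (chart_map X i)) \<and>
     (\<forall>i\<in>idx X. \<forall>j\<in>idx X.
        smooth_on (chart_map X i ` (chart_dom X i \<inter> chart_dom X j)) (transition X i j))"

definition restrict_mfd :: "('m, 'e, 'i) mfd \<Rightarrow> 'm set \<Rightarrow> ('m, 'e, 'i) mfd" where
  "restrict_mfd X W = X\<lparr>pts := subtopology (pts X) W, chart_dom := \<lambda>i. chart_dom X i \<inter> W\<rparr>"

text \<open>The product of a manifold with an open set of reals, with the product charts.\<close>

definition cylinder ::
  "('m, 'e, 'i) mfd \<Rightarrow> real set \<Rightarrow> ('m \<times> real, 'e \<times> real, 'i) mfd" where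
  "cylinder X T = \<lparr>pts = prod_topology (pts X) (top_of_set T), idx = idx X,
     chart_dom = \<lambda>i. chart_dom X i \<times> T, chart_map = \<lambda>i. map_prod (chart_map X i) id\<rparr>"

text \<open>A differential form is the family of its expressions in the charts of the atlas: \<open>\<omega> i x v\<close> is
  the value, at the point with coordinates \<open>x\<close> in the chart \<open>i\<close>, on the tangent vectors with
  coordinates \<open>v 0, v 1, \<dots>\<close>. Only \<open>x\<close> in the image of the chart \<open>i\<close> and, for a \<open>k\<close>-form, only
  the first \<open>k\<close> vectors matter.\<close>

type_synonym ('i, 'e) form = "'i \<Rightarrow> 'e \<Rightarrow> (nat \<Rightarrow> 'e) \<Rightarrow> real"

definition alternating :: "nat \<Rightarrow> ((nat \<Rightarrow> 'e::real_vector) \<Rightarrow> real) \<Rightarrow> bool" where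
  "alternating k f \<longleftrightarrow>
     (\<forall>v w. (\<forall>i<k. v i = w i) \<longrightarrow> f v = f w) \<and>
     (\<forall>v. \<forall>i<k. linear (\<lambda>u. f (v(i := u)))) \<and>
     (\<forall>v. \<forall>i<k. \<forall>j<k. i \<noteq> j \<and> v i = v j \<longrightarrow> f v = 0)"

text \<open>The last conjunct says that the expressions in two charts are related by pullback along the
  transition map.\<close>

definition kform :: "('m, 'e::euclidean_space, 'i) mfd \<Rightarrow> nat \<Rightarrow> ('i, 'e) form \<Rightarrow> bool" where
  "kform X k \<omega> \<longleftrightarrow>
     (\<forall>i\<in>idx X. \<forall>x\<in>chart_img X i. alternating k (\<omega> i x)) \<and>
     (\<forall>i\<in>idx X. \<forall>v. smooth_on (chart_img X i) (\<lambda>x. \<omega> i x v)) \<and>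
     (\<forall>i\<in>idx X. \<forall>j\<in>idx X. \<forall>p\<in>chart_dom X i \<inter> chart_dom X j. \<forall>v.
        \<omega> i (chart_map X i p) v =
        \<omega> j (chart_map X j p)
          (\<lambda>n. frechet_derivative (transition X i j) (at (chart_map X i p)) (v n)))"

definition form_eq ::
  "('i, 'e) form \<Rightarrow> ('m, 'e, 'i) mfd \<Rightarrow> ('i, 'e) form \<Rightarrow> bool"
  (\<open>(_ \<doteq>\<^bsub>_\<^esub> _)\<close> [51, 0, 51] 50) where
  "\<alpha> \<doteq>\<^bsub>X\<^esub> \<beta> \<longleftrightarrow> (\<forall>i\<in>idx X. \<forall>x\<in>chart_img X i. \<forall>v. \<alpha> i x v = \<beta> i x v)"

definition scale_form :: "real \<Rightarrow> ('i, 'e) form \<Rightarrow> ('i, 'e) form" (infixr \<open>*\<^sub>F\<close> 75) where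
  "c *\<^sub>F \<omega> = (\<lambda>i x v. c * \<omega> i x v)"

text \<open>Normalised so that \<open>(\<alpha> \<and> \<beta>)(v, w) = \<alpha> v * \<beta> w - \<alpha> w * \<beta> v\<close> for 1-forms.\<close>

definition wedge :: "nat \<Rightarrow> nat \<Rightarrow> ('i, 'e) form \<Rightarrow> ('i, 'e) form \<Rightarrow> ('i, 'e) form" where
  "wedge k l \<alpha> \<beta> = (\<lambda>i x v.
     (\<Sum>\<sigma> | \<sigma> permutes {..<k + l}.
        of_int (sign \<sigma>) * \<alpha> i x (\<lambda>n. v (\<sigma> n)) * \<beta> i x (\<lambda>n. v (\<sigma> (k + n))))
     / (fact k * fact l))"

abbreviation wedge2 :: "(nat \<Rightarrow> ('i, 'e) form) \<Rightarrow> nat \<Rightarrow> nat \<Rightarrow> ('i, 'e) form" where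
  "wedge2 e a b \<equiv> wedge 1 1 (e a) (e b)"

abbreviation wedge3 :: "(nat \<Rightarrow> ('i, 'e) form) \<Rightarrow> nat \<Rightarrow> nat \<Rightarrow> nat \<Rightarrow> ('i, 'e) form" where
  "wedge3 e a b c \<equiv> wedge 2 1 (wedge2 e a b) (e c)"

text \<open>The exterior derivative of a \<open>k\<close>-form, in coordinates: the alternating sum over \<open>j\<close> of the
  derivative in the direction \<open>v j\<close> of the form evaluated on the remaining vectors.\<close>

definition ext_d :: "nat \<Rightarrow> ('i, 'e::real_normed_vector) form \<Rightarrow> ('i, 'e) form" where
  "ext_d k \<omega> = (\<lambda>i x v. \<Sum>j\<le>k. (-1) ^ j *
     frechet_derivative (\<lambda>y. \<omega> i y (\<lambda>n. v (if n < j then n else Suc n))) (at x) (v j))"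

definition coframe ::
  "('m, 'e::euclidean_space, 'i) mfd \<Rightarrow> nat set \<Rightarrow> (nat \<Rightarrow> ('i, 'e) form) \<Rightarrow> bool" where
  "coframe X A e \<longleftrightarrow>
     (\<forall>a\<in>A. kform X 1 (e a)) \<and>
     (\<forall>i\<in>idx X. \<forall>x\<in>chart_img X i.
        (\<forall>c. (\<forall>v. (\<Sum>a\<in>A. c a * e a i x v) = 0) \<longrightarrow> (\<forall>a\<in>A. c a = 0)) \<and>
        (\<forall>f. alternating 1 f \<longrightarrow> (\<exists>c. \<forall>v. f v = (\<Sum>a\<in>A. c a * e a i x v))))"

definition su2_structure ::
  "('m, 'e::euclidean_space, 'i) mfd \<Rightarrow> ('i, 'e) form \<Rightarrow> ('i, 'e) form \<Rightarrow> ('i, 'e) form \<Rightarrow>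
   ('i, 'e) form \<Rightarrow> bool" where
  "su2_structure X \<alpha> \<omega>\<^sub>1 \<omega>\<^sub>2 \<omega>\<^sub>3 \<longleftrightarrow>
     smooth_manifold X \<and> DIM('e) = 5 \<and>
     kform X 1 \<alpha> \<and> kform X 2 \<omega>\<^sub>1 \<and> kform X 2 \<omega>\<^sub>2 \<and> kform X 2 \<omega>\<^sub>3 \<and>
     (\<forall>p\<in>topspace (pts X). \<exists>W e. openin (pts X) W \<and> p \<in> W \<and>
        coframe (restrict_mfd X W) {1..5} e \<and>
        \<alpha> \<doteq>\<^bsub>restrict_mfd X W\<^esub> e 5 \<and>
        \<omega>\<^sub>1 \<doteq>\<^bsub>restrict_mfd X W\<^esub> wedge2 e 1 2 + wedge2 e 3 4 \<and>
        \<omega>\<^sub>2 \<doteq>\<^bsub>restrict_mfd X W\<^esub> wedge2 e 1 3 + wedge2 e 4 2 \<and>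
        \<omega>\<^sub>3 \<doteq>\<^bsub>restrict_mfd X W\<^esub> wedge2 e 1 4 + wedge2 e 2 3)"

definition einstein_sasaki ::
  "('m, 'e::euclidean_space, 'i) mfd \<Rightarrow> ('i, 'e) form \<Rightarrow> ('i, 'e) form \<Rightarrow> ('i, 'e) form \<Rightarrow>
   ('i, 'e) form \<Rightarrow> bool" where
  "einstein_sasaki X \<alpha> \<omega>\<^sub>1 \<omega>\<^sub>2 \<omega>\<^sub>3 \<longleftrightarrow>
     su2_structure X \<alpha> \<omega>\<^sub>1 \<omega>\<^sub>2 \<omega>\<^sub>3 \<and>
     ext_d 1 \<alpha> \<doteq>\<^bsub>X\<^esub> (-2) *\<^sub>F \<omega>\<^sub>1 \<and>
     ext_d 2 \<omega>\<^sub>2 \<doteq>\<^bsub>X\<^esub> 3 *\<^sub>F wedge 1 2 \<alpha> \<omega>\<^sub>3 \<and>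
     ext_d 2 \<omega>\<^sub>3 \<doteq>\<^bsub>X\<^esub> (-3) *\<^sub>F wedge 1 2 \<alpha> \<omega>\<^sub>2"

text \<open>Families are smooth jointly in the point and the parameter.\<close>

definition id_structure_family ::
  "('m, 'e::euclidean_space, 'i) mfd \<Rightarrow> real set \<Rightarrow> (real \<Rightarrow> nat \<Rightarrow> ('i, 'e) form) \<Rightarrow> bool" where
  "id_structure_family X T \<eta> \<longleftrightarrow>
     (\<forall>t\<in>T. coframe X {0..3} (\<eta> t)) \<and>
     (\<forall>a\<in>{0..3}. \<forall>i\<in>idx X. \<forall>v. smooth_on (chart_img X i \<times> T) (\<lambda>(x, t). \<eta> t a i x v))"

definition time_deriv :: "(real \<Rightarrow> ('i, 'e) form) \<Rightarrow> real \<Rightarrow> ('i, 'e) form" where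
  "time_deriv \<xi> t = (\<lambda>i x v. deriv (\<lambda>s. \<xi> s i x v) t)"

text \<open>A family of forms on \<open>X\<close> as a form on the cylinder over \<open>X\<close> (at the parameter value \<open>t\<close>, the
  pullback along the projection of the form at time \<open>t\<close>), and the form \<open>dt\<close>.\<close>

definition cyl_form :: "(real \<Rightarrow> ('i, 'e) form) \<Rightarrow> ('i, 'e \<times> real) form" where
  "cyl_form \<xi> = (\<lambda>i (x, t) v. \<xi> t i x (\<lambda>n. fst (v n)))"

definition cyl_dt :: "('i, 'e \<times> real) form" where
  "cyl_dt = (\<lambda>i z v. snd (v 0))"

definition hypo_star :: "('m, 'e::euclidean_space, 'i) mfd \<Rightarrow> (nat \<Rightarrow> ('i, 'e) form) \<Rightarrow> bool" where
  "hypo_star X \<eta> \<longleftrightarrow>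
     ext_d 1 (\<eta> 0) \<doteq>\<^bsub>X\<^esub> (-2) *\<^sub>F wedge2 \<eta> 2 3 \<and>
     ext_d 2 (wedge2 \<eta> 3 1) \<doteq>\<^bsub>X\<^esub> 3 *\<^sub>F wedge3 \<eta> 0 1 2 \<and>
     ext_d 2 (wedge2 \<eta> 1 2) \<doteq>\<^bsub>X\<^esub> (-3) *\<^sub>F wedge3 \<eta> 0 3 1"

definition evolution_eqs ::
  "('m, 'e::euclidean_space, 'i) mfd \<Rightarrow> (real \<Rightarrow> nat \<Rightarrow> ('i, 'e) form) \<Rightarrow> real \<Rightarrow> bool" where
  "evolution_eqs X \<eta> t \<longleftrightarrow>
     time_deriv (\<lambda>s. \<eta> s 0) t \<doteq>\<^bsub>X\<^esub> 2 *\<^sub>F \<eta> t 1 \<and>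
     time_deriv (\<lambda>s. wedge2 (\<eta> s) 2 3) t \<doteq>\<^bsub>X\<^esub> - ext_d 1 (\<eta> t 1) \<and>
     time_deriv (\<lambda>s. wedge2 (\<eta> s) 3 1) t
       \<doteq>\<^bsub>X\<^esub> 3 *\<^sub>F wedge2 (\<eta> t) 0 3 - ext_d 1 (\<eta> t 2) \<and>
     time_deriv (\<lambda>s. wedge2 (\<eta> s) 1 2) t
       \<doteq>\<^bsub>X\<^esub> (-3) *\<^sub>F wedge2 (\<eta> t) 0 2 - ext_d 1 (\<eta> t 3)"

end

theory Submission
  imports Defs
begin

text \<open>
  Write \<open>d\<close> for the exterior derivative on \<open>M\<close> and a dot for the time derivative. On the cylinder a family
  \<open>\<xi>\<close> of \<open>k\<close>-forms has exterior derivative \<open>d \<xi> + (-1)\<^sup>k \<xi>\<^sup>\<bullet> \<and> dt\<close> (\<open>ext_d_cyl_form_1\<close>,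
  \<open>ext_d_cyl_form_2\<close>), and a form on the cylinder determines the parts \<open>A\<close> and \<open>B\<close> of its decomposition
  \<open>A + B \<and> dt\<close> (\<open>cyl_form_decomposition_unique\<close>). Each Einstein-Sasaki equation therefore splits into one
  equation without \<open>dt\<close> and one that is the coefficient of \<open>dt\<close>. The former are the three equations
  of \<open>hypo_star\<close> at every time, the latter are the evolution equations except the one for \<open>\<eta>\<^sup>2\<^sup>3\<close>; this
  is \<open>einstein_sasaki_cylinder_iff\<close>. The induced forms always are an \<open>SU(2)\<close>-structure, with adapted coframe
  \<open>\<eta>\<^sup>1, dt, - \<eta>\<^sup>3, \<eta>\<^sup>2, \<eta>\<^sup>0\<close> (\<open>su2_structure_cylinder\<close>).

  If the cylinder is Einstein-Sasaki, the missing equation for \<open>\<eta>\<^sup>2\<^sup>3\<close> follows by differentiating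
  \<open>d \<eta>\<^sup>0 = - 2 \<eta>\<^sup>2\<^sup>3\<close> in time, because \<open>d\<close> commutes with the time derivative and that of \<open>\<eta>\<^sup>0\<close>
  is \<open>2 \<eta>\<^sup>1\<close> (\<open>evolution_23\<close>).

  If the evolution equations hold, what must be shown is that \<open>hypo_star\<close>, known at one time,
  holds at all times (\<open>hypo_star_preserved\<close>). Both sides of each equation have the same time derivative.
  For \<open>d \<eta>\<^sup>0 = - 2 \<eta>\<^sup>2\<^sup>3\<close> both derivatives are \<open>2 d \<eta>\<^sup>1\<close>. For \<open>d \<eta>\<^sup>3\<^sup>1 = 3 \<eta>\<^sup>0\<^sup>1\<^sup>2\<close> the left derivative is
  \<open>d (3 \<eta>\<^sup>0\<^sup>3 - d \<eta>\<^sup>2) = 3 d \<eta>\<^sup>0 \<and> \<eta>\<^sup>3 - 3 \<eta>\<^sup>0 \<and> d \<eta>\<^sup>3\<close>, whose first term vanishes by the equation already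
  established for \<open>d \<eta>\<^sup>0\<close>, and the right derivative is \<open>6 \<eta>\<^sup>1 \<and> \<eta>\<^sup>1\<^sup>2 + 3 \<eta>\<^sup>0 \<and> (- 3 \<eta>\<^sup>0\<^sup>2 - d \<eta>\<^sup>3)\<close>, which
  leaves the same term \<open>- 3 \<eta>\<^sup>0 \<and> d \<eta>\<^sup>3\<close>. The equation for \<open>d \<eta>\<^sup>1\<^sup>2\<close> is the same computation with \<open>- 3\<close>
  for \<open>3\<close> and the indices \<open>2\<close> and \<open>3\<close> exchanged (\<open>structure_equation_propagates\<close>).

  Beneath this lie the symmetry of second derivatives, which gives both \<open>d d = 0\<close> and the exchange of
  \<open>d\<close> with the time derivative, and explicit expansions of the wedge products of forms of
  degree 1 and 2, from which all algebraic identities follow by expanding.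
\<close>

section \<open>Smooth functions\<close>

lemma frechet_derivative_cong_open:
  assumes "open S" "x \<in> S" "\<And>y. y \<in> S \<Longrightarrow> f y = g y"
  shows "frechet_derivative f (at x) = frechet_derivative g (at x)"
proof -
  have "(f has_derivative d) (at x) \<longleftrightarrow> (g has_derivative d) (at x)" for d
    using assms by (metis has_derivative_transform_within_open)
  then show ?thesis by (simp add: frechet_derivative_def)
qed

lemma differentiable_cong_open:
  assumes "open S" "x \<in> S" "\<And>y. y \<in> S \<Longrightarrow> f y = g y" "f differentiable (at x)"
  shows "g differentiable (at x)"
  using assms by (metis differentiable_def has_derivative_transform_within_open)

lemma Ck_on_cong:
  assumes "open S" "\<And>x. x \<in> S \<Longrightarrow> f x = g x" "Ck_on k S f"
  shows "Ck_on k S g"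
  using assms(2,3)
proof (induction k arbitrary: f g)
  case 0
  show ?case
    using continuous_on_eq[OF 0(2)[unfolded Ck_on.simps] 0(1)] by simp
next
  case (Suc k)
  have "Ck_on k S (\<lambda>x. frechet_derivative g (at x) v)" for v
  proof (rule Suc.IH)
    show "frechet_derivative f (at x) v = frechet_derivative g (at x) v" if "x \<in> S" for x
      by (simp only: frechet_derivative_cong_open[OF assms(1) that Suc.prems(1)])
    show "Ck_on k S (\<lambda>x. frechet_derivative f (at x) v)"
      using Suc.prems(2) by simp
  qed
  moreover have "g differentiable (at x)" if "x \<in> S" for x
    using differentiable_cong_open[OF assms(1) that Suc.prems(1)] Suc.prems(2) that by simp
  ultimately show ?case
    by simp
qed

lemma Ck_on_Suc_imp:
  assumes "Ck_on (Suc k) S f"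
  shows "Ck_on k S f"
  using assms
proof (induction k arbitrary: f)
  case 0
  then show ?case
    by (simp add: continuous_at_imp_continuous_on differentiable_imp_continuous_within)
next
  case (Suc k)
  then show ?case by auto
qed

text \<open>Any explicit formula for the derivative, valid only on \<open>S\<close>, can replace the
  Frechet derivative in the recursion; the closure under sums, products, pairs and
  projections is proved by induction along this rule.\<close>

lemma Ck_on_SucI:
  assumes "open S" "\<And>x. x \<in> S \<Longrightarrow> (f has_derivative D x) (at x)" "\<And>v. Ck_on k S (\<lambda>x. D x v)"
  shows "Ck_on (Suc k) S f"
proof -
  have "D x v = frechet_derivative f (at x) v" if "x \<in> S" for x v
    by (simp only: frechet_derivative_at[OF assms(2)[OF that]])
  then have "Ck_on k S (\<lambda>x. frechet_derivative f (at x) v)" for v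
    using Ck_on_cong[OF assms(1) _ assms(3)[of v], of "\<lambda>x. frechet_derivative f (at x) v"] by blast
  moreover have "f differentiable (at x)" if "x \<in> S" for x
    using assms(2)[OF that] by (rule differentiableI)
  ultimately show ?thesis
    by simp
qed

lemma Ck_on_Suc_has_derivative:
  "Ck_on (Suc k) S f \<Longrightarrow> x \<in> S \<Longrightarrow> (f has_derivative frechet_derivative f (at x)) (at x)"
  by (simp add: frechet_derivative_works)

lemma Ck_on_const: "Ck_on k S (\<lambda>x. c)"
  by (induction k arbitrary: c) auto

lemma Ck_on_bounded_linear:
  assumes "bounded_linear f"
  shows "Ck_on k S f"
proof (cases k)
  case 0
  then show ?thesis by (simp add: assms linear_continuous_on)
next
  case (Suc n)
  have "frechet_derivative f (at x) = f" for x
    using assms bounded_linear_imp_has_derivative frechet_derivative_at by metis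
  then show ?thesis
    using Suc assms bounded_linear_imp_differentiable Ck_on_const by auto
qed

lemma Ck_on_add:
  assumes "open S" "Ck_on k S f" "Ck_on k S g"
  shows "Ck_on k S (\<lambda>x. f x + g x)"
  using assms(2,3)
proof (induction k arbitrary: f g)
  case 0
  then show ?case by (simp add: continuous_on_add)
next
  case (Suc k)
  show ?case
  proof (rule Ck_on_SucI[OF assms(1)])
    show "((\<lambda>x. f x + g x) has_derivative
        (\<lambda>v. frechet_derivative f (at x) v + frechet_derivative g (at x) v)) (at x)" if "x \<in> S" for x
      by (intro has_derivative_add Ck_on_Suc_has_derivative[OF Suc.prems(1) that] Ck_on_Suc_has_derivative[OF Suc.prems(2) that])
    show "Ck_on k S (\<lambda>x. frechet_derivative f (at x) v + frechet_derivative g (at x) v)" for v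
      using Suc.prems by (intro Suc.IH) simp_all
  qed
qed

lemma Ck_on_mult:
  fixes f g :: "'a::real_normed_vector \<Rightarrow> real"
  assumes "open S" "Ck_on k S f" "Ck_on k S g"
  shows "Ck_on k S (\<lambda>x. f x * g x)"
  using assms(2,3)
proof (induction k arbitrary: f g)
  case 0
  then show ?case by (simp add: continuous_on_mult)
next
  case (Suc k)
  show ?case
  proof (rule Ck_on_SucI[OF assms(1)])
    show "((\<lambda>x. f x * g x) has_derivative
        (\<lambda>v. f x * frechet_derivative g (at x) v + frechet_derivative f (at x) v * g x)) (at x)"
      if "x \<in> S" for x
      by (intro has_derivative_mult Ck_on_Suc_has_derivative[OF Suc.prems(1) that] Ck_on_Suc_has_derivative[OF Suc.prems(2) that])
    have "Ck_on k S f" "Ck_on k S g"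
      using Suc.prems by (simp_all only: Ck_on_Suc_imp)
    then show "Ck_on k S (\<lambda>x. f x * frechet_derivative g (at x) v + frechet_derivative f (at x) v * g x)"
      for v
      using Suc.prems by (intro Ck_on_add[OF assms(1)] Suc.IH) simp_all
  qed
qed

lemma Ck_on_Pair:
  assumes "open S" "Ck_on k S f" "Ck_on k S g"
  shows "Ck_on k S (\<lambda>x. (f x, g x))"
  using assms(2,3)
proof (induction k arbitrary: f g)
  case 0
  then show ?case by (simp add: continuous_on_Pair)
next
  case (Suc k)
  show ?case
  proof (rule Ck_on_SucI[OF assms(1)])
    show "((\<lambda>x. (f x, g x)) has_derivative
        (\<lambda>v. (frechet_derivative f (at x) v, frechet_derivative g (at x) v))) (at x)" if "x \<in> S" for x
      by (intro has_derivative_Pair Ck_on_Suc_has_derivative[OF Suc.prems(1) that] Ck_on_Suc_has_derivative[OF Suc.prems(2) that])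
    show "Ck_on k S (\<lambda>x. (frechet_derivative f (at x) v, frechet_derivative g (at x) v))" for v
      using Suc.prems by (intro Suc.IH) simp_all
  qed
qed

lemma Ck_on_fst:
  assumes "open S" "open T" "Ck_on k S f"
  shows "Ck_on k (S \<times> T) (\<lambda>z. f (fst z))"
  using assms(3)
proof (induction k arbitrary: f)
  case 0
  then show ?case
    by (auto intro!: continuous_on_compose2[of S f _ fst] continuous_on_fst continuous_on_id)
next
  case (Suc k)
  show ?case
  proof (rule Ck_on_SucI[OF open_Times[OF assms(1,2)]])
    show "((\<lambda>z. f (fst z)) has_derivative (\<lambda>v. frechet_derivative f (at (fst z)) (fst v))) (at z)"
      if "z \<in> S \<times> T" for z
      using has_derivative_compose[OF has_derivative_fst[OF has_derivative_ident]
          Ck_on_Suc_has_derivative[OF Suc.prems, of "fst z"]] that by auto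
    show "Ck_on k (S \<times> T) (\<lambda>z. frechet_derivative f (at (fst z)) (fst v))" for v
      using Suc.prems by (intro Suc.IH[of "\<lambda>x. frechet_derivative f (at x) (fst v)"]) simp
  qed
qed

lemma smooth_on_differentiable: "smooth_on S f \<Longrightarrow> x \<in> S \<Longrightarrow> f differentiable (at x)"
  unfolding smooth_on_def by (metis Ck_on.simps(2))

lemma smooth_on_has_derivative:
  "smooth_on S f \<Longrightarrow> x \<in> S \<Longrightarrow> (f has_derivative frechet_derivative f (at x)) (at x)"
  by (simp add: frechet_derivative_works[THEN iffD1] smooth_on_differentiable)

lemma smooth_on_derivative: "smooth_on S f \<Longrightarrow> smooth_on S (\<lambda>x. frechet_derivative f (at x) v)"
  unfolding smooth_on_def by (metis Ck_on.simps(2))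

lemma smooth_on_continuous: "smooth_on S f \<Longrightarrow> continuous_on S f"
  unfolding smooth_on_def by (metis Ck_on.simps(1))

lemma smooth_on_cong:
  "open S \<Longrightarrow> (\<And>x. x \<in> S \<Longrightarrow> f x = g x) \<Longrightarrow> smooth_on S f \<Longrightarrow> smooth_on S g"
  unfolding smooth_on_def using Ck_on_cong by blast

lemma smooth_on_const: "smooth_on S (\<lambda>x. c)"
  by (simp add: smooth_on_def Ck_on_const)

lemma smooth_on_bounded_linear: "bounded_linear f \<Longrightarrow> smooth_on S f"
  by (simp add: smooth_on_def Ck_on_bounded_linear)

lemma smooth_on_add: "open S \<Longrightarrow> smooth_on S f \<Longrightarrow> smooth_on S g \<Longrightarrow> smooth_on S (\<lambda>x. f x + g x)"
  by (simp add: smooth_on_def Ck_on_add)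

lemma smooth_on_mult:
  fixes f g :: "'a::real_normed_vector \<Rightarrow> real"
  shows "open S \<Longrightarrow> smooth_on S f \<Longrightarrow> smooth_on S g \<Longrightarrow> smooth_on S (\<lambda>x. f x * g x)"
  by (simp add: smooth_on_def Ck_on_mult)

lemma smooth_on_sum:
  assumes "open S" "\<And>a. a \<in> A \<Longrightarrow> smooth_on S (f a)"
  shows "smooth_on S (\<lambda>x. \<Sum>a\<in>A. f a x)"
  using assms(2)
  by (induction A rule: infinite_finite_induct) (auto intro: smooth_on_const smooth_on_add[OF assms(1)])

lemma smooth_on_Pair: "open S \<Longrightarrow> smooth_on S f \<Longrightarrow> smooth_on S g \<Longrightarrow> smooth_on S (\<lambda>x. (f x, g x))"
  by (simp add: smooth_on_def Ck_on_Pair)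

lemma smooth_on_fst: "open S \<Longrightarrow> open T \<Longrightarrow> smooth_on S f \<Longrightarrow> smooth_on (S \<times> T) (\<lambda>z. f (fst z))"
  by (simp add: smooth_on_def Ck_on_fst)

section \<open>Symmetry of second derivatives\<close>

lemma has_real_derivative_along_line:
  fixes f :: "'a::real_normed_vector \<Rightarrow> real"
  assumes "f differentiable (at (p + r *\<^sub>R w))"
  shows "((\<lambda>r. f (p + r *\<^sub>R w)) has_real_derivative frechet_derivative f (at (p + r *\<^sub>R w)) w) (at r)"
proof -
  have "((\<lambda>r. p + r *\<^sub>R w) has_derivative (\<lambda>h. h *\<^sub>R w)) (at r)"
    by (auto intro!: derivative_eq_intros)
  moreover have "(f has_derivative frechet_derivative f (at (p + r *\<^sub>R w))) (at (p + r *\<^sub>R w))"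
    using assms by (simp add: frechet_derivative_works)
  ultimately have "((\<lambda>r. f (p + r *\<^sub>R w)) has_derivative
      (\<lambda>h. frechet_derivative f (at (p + r *\<^sub>R w)) (h *\<^sub>R w))) (at r)"
    by (rule has_derivative_compose[where f = "\<lambda>r. p + r *\<^sub>R w" and x = r and g = f])
  moreover have "(\<lambda>h. frechet_derivative f (at (p + r *\<^sub>R w)) (h *\<^sub>R w))
      = (*) (frechet_derivative f (at (p + r *\<^sub>R w)) w)"
    by (rule ext) (simp add: linear_scale[OF linear_frechet_derivative[OF assms]])
  ultimately show ?thesis
    unfolding has_field_derivative_def by (rule back_subst)
qed

text \<open>The mean value theorem is applied twice, first along \<open>w\<close> to the increment of \<open>f\<close> along \<open>u\<close>, then
  along \<open>u\<close> to the derivative in direction \<open>w\<close>. The second difference on the left is symmetric in \<open>u\<close> and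
  \<open>w\<close> although the right-hand side is not.\<close>

lemma second_difference_mvt:
  fixes f :: "'a::real_normed_vector \<Rightarrow> real"
  assumes f: "smooth_on S f" and s: "s > 0"
    and S: "\<And>a b. a \<in> {0..s} \<Longrightarrow> b \<in> {0..s} \<Longrightarrow> z + a *\<^sub>R u + b *\<^sub>R w \<in> S"
  shows "\<exists>a\<in>{0<..<s}. \<exists>b\<in>{0<..<s}.
    f (z + s *\<^sub>R u + s *\<^sub>R w) - f (z + s *\<^sub>R u) - f (z + s *\<^sub>R w) + f z
      = s * s * frechet_derivative (\<lambda>y. frechet_derivative f (at y) w) (at (z + a *\<^sub>R u + b *\<^sub>R w)) u"
proof -
  define g where "g = (\<lambda>y. frechet_derivative f (at y) w)"
  have g: "smooth_on S g"
    unfolding g_def using f by (rule smooth_on_derivative)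
  have fd: "((\<lambda>b. f (z + a *\<^sub>R u + b *\<^sub>R w)) has_real_derivative g (z + a *\<^sub>R u + b *\<^sub>R w)) (at b)"
    if "a \<in> {0..s}" "b \<in> {0..s}" for a b
    unfolding g_def by (intro has_real_derivative_along_line smooth_on_differentiable[OF f S[OF that]])
  have gd: "((\<lambda>a. g (z + a *\<^sub>R u + b *\<^sub>R w)) has_real_derivative
      frechet_derivative g (at (z + a *\<^sub>R u + b *\<^sub>R w)) u) (at a)"
    if "a \<in> {0..s}" "b \<in> {0..s}" for a b
  proof -
    have eq: "z + b *\<^sub>R w + a *\<^sub>R u = z + a *\<^sub>R u + b *\<^sub>R w" for a
      by (simp add: algebra_simps)
    have "g differentiable (at (z + b *\<^sub>R w + a *\<^sub>R u))"
      unfolding eq using g S[OF that] by (rule smooth_on_differentiable)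
    from has_real_derivative_along_line[OF this] show ?thesis
      unfolding eq .
  qed
  define p where "p = (\<lambda>b. f (z + s *\<^sub>R u + b *\<^sub>R w) - f (z + 0 *\<^sub>R u + b *\<^sub>R w))"
  have "(p has_real_derivative g (z + s *\<^sub>R u + b *\<^sub>R w) - g (z + 0 *\<^sub>R u + b *\<^sub>R w)) (at b)"
    if "b \<in> {0..s}" for b
    unfolding p_def using that s by (intro DERIV_diff fd) auto
  then have "\<exists>b. 0 < b \<and> b < s \<and>
      p s - p 0 = (s - 0) * (g (z + s *\<^sub>R u + b *\<^sub>R w) - g (z + 0 *\<^sub>R u + b *\<^sub>R w))"
    by (intro MVT2 s) simp
  then obtain b where b: "0 < b" "b < s"
    "p s - p 0 = s * (g (z + s *\<^sub>R u + b *\<^sub>R w) - g (z + 0 *\<^sub>R u + b *\<^sub>R w))"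
    by auto
  have "\<exists>a. 0 < a \<and> a < s \<and> g (z + s *\<^sub>R u + b *\<^sub>R w) - g (z + 0 *\<^sub>R u + b *\<^sub>R w)
      = (s - 0) * frechet_derivative g (at (z + a *\<^sub>R u + b *\<^sub>R w)) u"
    using b(1,2) by (intro MVT2 s gd) simp_all
  then obtain a where a: "0 < a" "a < s" "g (z + s *\<^sub>R u + b *\<^sub>R w) - g (z + 0 *\<^sub>R u + b *\<^sub>R w)
      = s * frechet_derivative g (at (z + a *\<^sub>R u + b *\<^sub>R w)) u"
    by auto
  have "p s - p 0 = s * s * frechet_derivative g (at (z + a *\<^sub>R u + b *\<^sub>R w)) u"
    using a(3) b(3) by simp
  then show ?thesis
    unfolding g_def[symmetric] p_def using a(1,2) b(1,2)
    by (intro bexI[of _ a] bexI[of _ b]) simp_all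
qed

text \<open>The same second difference over a small parallelogram is a value of either mixed derivative at some
  nearby point, and both mixed derivatives are continuous.\<close>

lemma second_derivative_symmetric:
  fixes f :: "'a::real_normed_vector \<Rightarrow> real"
  assumes S: "open S" and f: "smooth_on S f" and z: "z \<in> S"
  shows "frechet_derivative (\<lambda>y. frechet_derivative f (at y) w) (at z) u
       = frechet_derivative (\<lambda>y. frechet_derivative f (at y) u) (at z) w"
proof -
  define G where "G = (\<lambda>w u y. frechet_derivative (\<lambda>y. frechet_derivative f (at y) w) (at y) u)"
  have G: "continuous_on S (G w u)" for w u
    unfolding G_def by (intro smooth_on_continuous smooth_on_derivative f)
  have "\<bar>G w u z - G u w z\<bar> < e" if e: "e > 0" for e
  proof -
    have "\<exists>d>0. \<forall>y. dist y z < d \<longrightarrow> y \<in> S \<and> dist (G w u y) (G w u z) < e/2" for w u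
    proof -
      have "isCont (G w u) z"
        using G S z continuous_on_eq_continuous_at by blast
      then obtain d1 where "d1 > 0" "\<forall>y. dist y z < d1 \<longrightarrow> dist (G w u y) (G w u z) < e/2"
        using e by (metis continuous_at_eps_delta half_gt_zero)
      moreover obtain d2 where "d2 > 0" "\<forall>y. dist y z < d2 \<longrightarrow> y \<in> S"
        using S z open_dist by metis
      ultimately show ?thesis by (intro exI[of _ "min d1 d2"]) auto
    qed
    then obtain d1 d2 where d: "d1 > 0" "d2 > 0"
      "\<And>y. dist y z < d1 \<Longrightarrow> y \<in> S \<and> dist (G w u y) (G w u z) < e/2"
      "\<And>y. dist y z < d2 \<Longrightarrow> y \<in> S \<and> dist (G u w y) (G u w z) < e/2"
      by metis
    define c where "c = norm u + norm w + 1"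
    define s where "s = min d1 d2 / (2 * c)"
    have pos: "c > 0"
      unfolding c_def by (smt (verit) norm_ge_zero)
    then have s: "s > 0"
      using d by (simp add: s_def)
    have near: "dist (z + a *\<^sub>R u + b *\<^sub>R w) z < min d1 d2" if "a \<in> {0..s}" "b \<in> {0..s}" for a b
    proof -
      have "dist (z + a *\<^sub>R u + b *\<^sub>R w) z \<le> a * norm u + b * norm w"
        using that norm_triangle_ineq[of "a *\<^sub>R u" "b *\<^sub>R w"] by (simp add: dist_norm add.assoc)
      also have "\<dots> \<le> s * norm u + s * norm w"
        using that by (intro add_mono mult_right_mono) auto
      also have "\<dots> \<le> s * c"
        using s by (simp add: c_def algebra_simps)
      also have "\<dots> = min d1 d2 / 2"
        using pos by (simp add: s_def)
      also have "\<dots> < min d1 d2"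
        using d by auto
      finally show ?thesis .
    qed
    obtain a b where ab: "a \<in> {0<..<s}" "b \<in> {0<..<s}"
      "f (z + s *\<^sub>R u + s *\<^sub>R w) - f (z + s *\<^sub>R u) - f (z + s *\<^sub>R w) + f z
        = s * s * G w u (z + a *\<^sub>R u + b *\<^sub>R w)"
      using second_difference_mvt[OF f s, of z u w] near d(3) unfolding G_def by force
    obtain a' b' where ab': "a' \<in> {0<..<s}" "b' \<in> {0<..<s}"
      "f (z + s *\<^sub>R w + s *\<^sub>R u) - f (z + s *\<^sub>R w) - f (z + s *\<^sub>R u) + f z
        = s * s * G u w (z + a' *\<^sub>R w + b' *\<^sub>R u)"
    proof -
      have "z + a *\<^sub>R w + b *\<^sub>R u \<in> S" if "a \<in> {0..s}" "b \<in> {0..s}" for a b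
        using near[OF that(2,1)] d(3) by (simp add: add.assoc add.commute[of "b *\<^sub>R u"])
      then show ?thesis
        using second_difference_mvt[OF f s, of z w u] that unfolding G_def by blast
    qed
    have "s * s * G w u (z + a *\<^sub>R u + b *\<^sub>R w) = s * s * G u w (z + a' *\<^sub>R w + b' *\<^sub>R u)"
      using ab(3) ab'(3) by (simp add: algebra_simps)
    then have "G w u (z + a *\<^sub>R u + b *\<^sub>R w) = G u w (z + b' *\<^sub>R u + a' *\<^sub>R w)"
      using s by (simp add: add.assoc add.commute[of "b' *\<^sub>R u"])
    moreover have "dist (G w u (z + a *\<^sub>R u + b *\<^sub>R w)) (G w u z) < e/2"
      using near[of a b] ab d(3) by auto
    moreover have "dist (G u w (z + b' *\<^sub>R u + a' *\<^sub>R w)) (G u w z) < e/2"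
      using near[of b' a'] ab' d(4) by auto
    ultimately show ?thesis
      unfolding dist_real_def by linarith
  qed
  then have "G w u z = G u w z"
    by (metis less_irrefl zero_less_abs_iff right_minus_eq)
  then show ?thesis by (simp add: G_def)
qed

section \<open>Partial derivatives of functions of a point and a time\<close>

lemma slice_has_derivative:
  assumes "smooth_on (S \<times> T) F" "x \<in> S" "t \<in> T"
  shows "((\<lambda>y. F (y, t)) has_derivative (\<lambda>u. frechet_derivative F (at (x, t)) (u, 0))) (at x)"
proof -
  have "((\<lambda>y. (y, t)) has_derivative (\<lambda>u. (u, 0))) (at x)"
    by (intro has_derivative_Pair has_derivative_ident has_derivative_const)
  moreover have "(F has_derivative frechet_derivative F (at (x, t))) (at (x, t))"
    using assms by (intro smooth_on_has_derivative[OF assms(1)]) simp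
  ultimately show ?thesis
    by (rule has_derivative_compose[where g = F and f = "\<lambda>y. (y, t)"])
qed

lemma time_slice_has_derivative:
  fixes F :: "_ \<times> real \<Rightarrow> real"
  assumes "smooth_on (S \<times> T) F" "x \<in> S" "t \<in> T"
  shows "((\<lambda>s. F (x, s)) has_real_derivative frechet_derivative F (at (x, t)) (0, 1)) (at t)"
proof -
  have xt: "(x, t) \<in> S \<times> T" using assms by simp
  have "((\<lambda>s. (x, s)) has_derivative (\<lambda>h. (0, h))) (at t)"
    by (intro has_derivative_Pair has_derivative_ident has_derivative_const)
  then have "((\<lambda>s. F (x, s)) has_derivative (\<lambda>h. frechet_derivative F (at (x, t)) (0, h))) (at t)"
    by (rule has_derivative_compose[where g = F and f = "\<lambda>s. (x, s)", OF _ smooth_on_has_derivative[OF assms(1) xt]])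
  moreover have "(\<lambda>h. frechet_derivative F (at (x, t)) (0, h)) = (*) (frechet_derivative F (at (x, t)) (0, 1))"
  proof
    show "frechet_derivative F (at (x, t)) (0, h) = frechet_derivative F (at (x, t)) (0, 1) * h" for h
      using linear_scale[OF linear_frechet_derivative[OF smooth_on_differentiable[OF assms(1) xt]], of h "(0, 1)"]
      by simp
  qed
  ultimately show ?thesis
    unfolding has_field_derivative_def by (rule back_subst)
qed

lemma frechet_derivative_slice:
  assumes "smooth_on (S \<times> T) F" "x \<in> S" "t \<in> T"
  shows "frechet_derivative (\<lambda>y. F (y, t)) (at x) u = frechet_derivative F (at (x, t)) (u, 0)"
  using frechet_derivative_at[OF slice_has_derivative[OF assms]] by metis

lemma deriv_time_slice:
  fixes F :: "_ \<times> real \<Rightarrow> real"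
  assumes "smooth_on (S \<times> T) F" "x \<in> S" "t \<in> T"
  shows "deriv (\<lambda>s. F (x, s)) t = frechet_derivative F (at (x, t)) (0, 1)"
  using DERIV_imp_deriv[OF time_slice_has_derivative[OF assms]] .

lemma frechet_derivative_split:
  fixes F :: "_ \<times> real \<Rightarrow> real"
  assumes "smooth_on (S \<times> T) F" "x \<in> S" "t \<in> T"
  shows "frechet_derivative F (at (x, t)) w
    = frechet_derivative (\<lambda>y. F (y, t)) (at x) (fst w) + snd w * deriv (\<lambda>s. F (x, s)) t"
proof -
  have xt: "(x, t) \<in> S \<times> T" using assms by simp
  note l = linear_frechet_derivative[OF smooth_on_differentiable[OF assms(1) xt]]
  have "w = (fst w, 0) + snd w *\<^sub>R (0, 1)" by (simp add: prod_eq_iff)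
  then have "frechet_derivative F (at (x, t)) w
     = frechet_derivative F (at (x, t)) (fst w, 0) + snd w * frechet_derivative F (at (x, t)) (0, 1)"
    using linear_add[OF l] linear_scale[OF l] by (metis real_scaleR_def)
  then show ?thesis
    by (simp add: frechet_derivative_slice[OF assms] deriv_time_slice[OF assms])
qed

lemma deriv_frechet_derivative_commute:
  fixes F :: "_ \<times> real \<Rightarrow> real"
  assumes "open S" "open T" "smooth_on (S \<times> T) F" "x \<in> S" "t \<in> T"
  shows "deriv (\<lambda>s. frechet_derivative (\<lambda>y. F (y, s)) (at x) u) t
       = frechet_derivative (\<lambda>y. deriv (\<lambda>s. F (y, s)) t) (at x) u"
proof -
  let ?D = "\<lambda>w z. frechet_derivative F (at z) w"
  have sm: "smooth_on (S \<times> T) (?D w)" for w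
    using assms(3) by (rule smooth_on_derivative)
  have "((\<lambda>s. frechet_derivative F (at (x, s)) (u, 0)) has_real_derivative
      frechet_derivative (?D (u, 0)) (at (x, t)) (0, 1)) (at t)"
    using time_slice_has_derivative[OF sm assms(4,5)] .
  then have "((\<lambda>s. frechet_derivative (\<lambda>y. F (y, s)) (at x) u) has_real_derivative
      frechet_derivative (?D (u, 0)) (at (x, t)) (0, 1)) (at t)"
    by (rule has_field_derivative_transform_within_open[OF _ assms(2,5)])
      (simp only: frechet_derivative_slice[OF assms(3,4)])
  then have "deriv (\<lambda>s. frechet_derivative (\<lambda>y. F (y, s)) (at x) u) t
      = frechet_derivative (?D (u, 0)) (at (x, t)) (0, 1)"
    by (rule DERIV_imp_deriv)
  also have "\<dots> = frechet_derivative (?D (0, 1)) (at (x, t)) (u, 0)"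
    using assms by (intro second_derivative_symmetric[of "S \<times> T"] open_Times) auto
  also have "\<dots> = frechet_derivative (\<lambda>y. ?D (0, 1) (y, t)) (at x) u"
    by (rule frechet_derivative_slice[OF sm assms(4,5), symmetric])
  also have "\<dots> = frechet_derivative (\<lambda>y. deriv (\<lambda>s. F (y, s)) t) (at x) u"
    by (simp only: frechet_derivative_cong_open[OF assms(1,4) deriv_time_slice[OF assms(3) _ assms(5), symmetric]])
  finally show ?thesis .
qed

lemma smooth_on_deriv_time:
  fixes F :: "_ \<times> real \<Rightarrow> real"
  assumes "open S" "open T" "smooth_on (S \<times> T) F"
  shows "smooth_on (S \<times> T) (\<lambda>(x, t). deriv (\<lambda>s. F (x, s)) t)"
proof (rule smooth_on_cong[OF open_Times[OF assms(1,2)]])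
  show "smooth_on (S \<times> T) (\<lambda>z. frechet_derivative F (at z) (0, 1))"
    using assms(3) by (rule smooth_on_derivative)
qed (use deriv_time_slice[OF assms(3)] in auto)

lemma smooth_on_deriv_space:
  fixes F :: "_ \<times> real \<Rightarrow> real"
  assumes "open S" "open T" "smooth_on (S \<times> T) F"
  shows "smooth_on (S \<times> T) (\<lambda>(x, t). frechet_derivative (\<lambda>y. F (y, t)) (at x) u)"
proof (rule smooth_on_cong[OF open_Times[OF assms(1,2)]])
  show "smooth_on (S \<times> T) (\<lambda>z. frechet_derivative F (at z) (u, 0))"
    using assms(3) by (rule smooth_on_derivative)
qed (use frechet_derivative_slice[OF assms(3)] in auto)

lemma smooth_on_slice:
  assumes "open S" "open T" "smooth_on (S \<times> T) F" "t \<in> T"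
  shows "smooth_on S (\<lambda>x. F (x, t))"
proof -
  have "Ck_on k S (\<lambda>x. F (x, t))" if "smooth_on (S \<times> T) F" for k F
    using that
  proof (induction k arbitrary: F)
    case 0
    have "continuous_on ((\<lambda>x. (x, t)) ` S) F"
      using smooth_on_continuous[OF 0] by (rule continuous_on_subset) (use assms(4) in auto)
    from continuous_on_compose[OF _ this] show ?case
      by (simp add: o_def continuous_on_Pair)
  next
    case (Suc k)
    show ?case
      by (rule Ck_on_SucI[OF assms(1) slice_has_derivative[OF Suc.prems _ assms(4)]
            Suc.IH[OF smooth_on_derivative[OF Suc.prems]]])
  qed
  then show ?thesis
    using assms(3) unfolding smooth_on_def by blast
qed

section \<open>Alternating functions and wedge products in low degree\<close>

(* Degrees and argument positions are the numeral 1 in the rewrite rules below, and simp would turn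
   it into a successor before they can match. *)
declare One_nat_def [simp del]

text \<open>A pair of arguments as a sequence; only the first two entries matter to a 2-form, so
  repeating the second one beyond them is harmless.\<close>

definition vec2 :: "'a \<Rightarrow> 'a \<Rightarrow> nat \<Rightarrow> 'a" where
  "vec2 u w = (\<lambda>n. if n = 0 then u else w)"

lemma vec2_simps [simp]: "vec2 u w 0 = u" "vec2 u w 1 = w"
  by (simp_all add: vec2_def)

lemma alternating_agree: "alternating k f \<Longrightarrow> (\<And>n. n < k \<Longrightarrow> v n = w n) \<Longrightarrow> f v = f w"
  unfolding alternating_def by blast

lemma alternatingD:
  assumes "alternating k f"
  shows "i < k \<Longrightarrow> linear (\<lambda>u. f (v(i := u)))"
    and "i < k \<Longrightarrow> j < k \<Longrightarrow> i \<noteq> j \<Longrightarrow> v i = v j \<Longrightarrow> f v = 0"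
  using assms unfolding alternating_def by blast+

lemma alternating_1: "alternating 1 f \<Longrightarrow> f v = f (\<lambda>_. v 0)"
  by (rule alternating_agree[where k = 1]) auto

lemma alternating_2: "alternating 2 f \<Longrightarrow> f v = f (vec2 (v 0) (v 1))"
  by (rule alternating_agree[where k = 2]) (auto simp: vec2_def less_2_cases_iff One_nat_def)

lemma alternating_1_linear: 
  assumes "alternating 1 f"
  shows "linear (\<lambda>u. f (\<lambda>_. u))"
proof -
  have "linear (\<lambda>u. f ((\<lambda>_. 0)(0 := u)))"
    by (rule alternatingD(1)[OF assms]) simp
  moreover have "f ((\<lambda>_. 0)(0 := u)) = f (\<lambda>_. u)" for u
    using alternating_1[OF assms, of "(\<lambda>_. 0)(0 := u)"] by simp
  ultimately show ?thesis by simp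
qed

lemma alternating_1I:
  assumes "\<And>v. f v = g (v 0)" "linear g"
  shows "alternating 1 f"
  unfolding alternating_def using assms by auto

lemma alternating_2I:
  assumes "\<And>v. f v = g (v 0) (v 1)" "\<And>w. linear (\<lambda>u. g u w)" "\<And>u. linear (g u)" "\<And>u. g u u = 0"
  shows "alternating 2 f"
  unfolding alternating_def
proof (intro conjI allI impI)
  show "f v = f w" if "\<forall>i<2. v i = w i" for v w
    using that by (simp add: assms(1))
  show "linear (\<lambda>u. f (v(i := u)))" if "i < 2" for v and i :: nat
    using that assms(2,3) by (auto simp: less_2_cases_iff assms(1))
  show "f v = 0" if "i < 2" "j < 2" "i \<noteq> j \<and> v i = v j" for v and i j :: nat
    using that by (auto simp: less_2_cases_iff assms(1,4) One_nat_def)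
qed

lemma alternating_add:
  assumes "alternating k f" "alternating k g"
  shows "alternating k (\<lambda>v. f v + g v)"
  unfolding alternating_def
proof (intro conjI allI impI)
  show "f v + g v = f w + g w" if "\<forall>i<k. v i = w i" for v w
    using that by (intro arg_cong2[of _ _ _ _ "(+)"] alternating_agree[OF assms(1)] alternating_agree[OF assms(2)]) simp_all
  show "linear (\<lambda>u. f (v(i := u)) + g (v(i := u)))" if "i < k" for v i
    by (intro linear_compose_add alternatingD(1)[OF assms(1) that] alternatingD(1)[OF assms(2) that])
  show "f v + g v = 0" if "i < k" "j < k" "i \<noteq> j \<and> v i = v j" for v i j
    using alternatingD(2)[OF assms(1), of i j v] alternatingD(2)[OF assms(2), of i j v] that by simp
qed

lemma alternating_scale:
  assumes "alternating k f"
  shows "alternating k (\<lambda>v. c * f v)"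
  unfolding alternating_def
proof (intro conjI allI impI)
  show "c * f v = c * f w" if "\<forall>i<k. v i = w i" for v w
    using that by (intro arg_cong[of _ _ "(*) c"] alternating_agree[OF assms]) simp_all
  show "linear (\<lambda>u. c * f (v(i := u)))" if "i < k" for v i
    using linear_compose_scale_right[OF alternatingD(1)[OF assms that], of c v] by simp
  show "c * f v = 0" if "i < k" "j < k" "i \<noteq> j \<and> v i = v j" for v i j
    using alternatingD(2)[OF assms, of i j v] that by simp
qed

lemma alternating_2_swap:
  assumes "alternating 2 f"
  shows "f (vec2 u w) = - f (vec2 w u)"
proof -
  have l1: "linear (\<lambda>a. f (vec2 a b))" for b
  proof -
    have "linear (\<lambda>a. f ((\<lambda>_. b)(0 := a)))"
      by (rule alternatingD(1)[OF assms]) simp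
    moreover have "(\<lambda>_. b)(0 := a) = vec2 a b" for a by (auto simp: vec2_def)
    ultimately show ?thesis by simp
  qed
  have l2: "linear (\<lambda>b. f (vec2 a b))" for a
  proof -
    have "linear (\<lambda>b. f ((\<lambda>_. a)(1 := b)))"
      by (rule alternatingD(1)[OF assms]) simp
    moreover have "f ((\<lambda>_. a)(1 := b)) = f (vec2 a b)" for b 
      using alternating_2[OF assms, of "(\<lambda>_. a)(1 := b)"] by simp
    ultimately show ?thesis by simp
  qed
  have z: "f (vec2 a a) = 0" for a
    by (rule alternatingD(2)[OF assms, of 0 1]) (simp_all add: vec2_def)
  have "f (vec2 (u + w) (u + w)) = f (vec2 u u) + f (vec2 u w) + (f (vec2 w u) + f (vec2 w w))"
    by (simp add: linear_add[OF l1] linear_add[OF l2])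
  then show ?thesis by (simp add: z)
qed

text \<open>The laws of alternating functions are linear, so they pass to the derivative in a parameter on
  which the function depends. This makes the time derivative of a family of forms and the partial derivatives
  of the coefficients of a form alternating again.\<close>

lemma alternating_derivative:
  assumes "open S" "z \<in> S" "\<And>y. y \<in> S \<Longrightarrow> alternating k (F y)"
    and d: "\<And>v. (\<lambda>y. F y v) differentiable (at z)"
  shows "alternating k (\<lambda>v. frechet_derivative (\<lambda>y. F y v) (at z) w)"
  unfolding alternating_def
proof (intro conjI allI impI)
  fix v v' :: "nat \<Rightarrow> 'b" assume "\<forall>i<k. v i = v' i"
  then have "F y v = F y v'" if "y \<in> S" for y
    by (intro alternating_agree[OF assms(3)[OF that]]) simp
  then have "frechet_derivative (\<lambda>y. F y v) (at z) = frechet_derivative (\<lambda>y. F y v') (at z)"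
    by (rule frechet_derivative_cong_open[OF assms(1,2)])
  then show "frechet_derivative (\<lambda>y. F y v) (at z) w = frechet_derivative (\<lambda>y. F y v') (at z) w"
    by (rule fun_cong)
next
  fix v :: "nat \<Rightarrow> 'b" and i assume i: "i < k"
  have l: "linear (\<lambda>u. F y (v(i := u)))" if "y \<in> S" for y
    by (rule alternatingD(1)[OF assms(3)[OF that] i])
  have D: "((\<lambda>y. F y v) has_derivative frechet_derivative (\<lambda>y. F y v) (at z)) (at z)" for v
    using d by (simp add: frechet_derivative_works)
  show "linear (\<lambda>u. frechet_derivative (\<lambda>y. F y (v(i := u))) (at z) w)"
  proof (rule linearI)
    fix a b
    have "frechet_derivative (\<lambda>y. F y (v(i := a + b))) (at z)
        = frechet_derivative (\<lambda>y. F y (v(i := a)) + F y (v(i := b))) (at z)"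
      using assms(1,2) by (rule frechet_derivative_cong_open) (simp add: linear_add[OF l])
    also have "\<dots> = (\<lambda>w. frechet_derivative (\<lambda>y. F y (v(i := a))) (at z) w
        + frechet_derivative (\<lambda>y. F y (v(i := b))) (at z) w)"
      by (rule frechet_derivative_at[symmetric]) (intro has_derivative_add D)
    finally show "frechet_derivative (\<lambda>y. F y (v(i := a + b))) (at z) w
        = frechet_derivative (\<lambda>y. F y (v(i := a))) (at z) w
        + frechet_derivative (\<lambda>y. F y (v(i := b))) (at z) w" by simp
  next
    fix r b
    have "frechet_derivative (\<lambda>y. F y (v(i := r *\<^sub>R b))) (at z)
        = frechet_derivative (\<lambda>y. r *\<^sub>R F y (v(i := b))) (at z)"
      using assms(1,2) by (rule frechet_derivative_cong_open) (simp add: linear_scale[OF l])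
    also have "\<dots> = (\<lambda>w. r *\<^sub>R frechet_derivative (\<lambda>y. F y (v(i := b))) (at z) w)"
      by (rule frechet_derivative_at[symmetric]) (intro has_derivative_scaleR_right D)
    finally show "frechet_derivative (\<lambda>y. F y (v(i := r *\<^sub>R b))) (at z) w
        = r *\<^sub>R frechet_derivative (\<lambda>y. F y (v(i := b))) (at z) w" by simp
  qed
next
  fix v :: "nat \<Rightarrow> 'b" and i j assume ij: "i < k" "j < k" "i \<noteq> j \<and> v i = v j"
  have "F y v = 0" if "y \<in> S" for y
    using ij by (intro alternatingD(2)[OF assms(3)[OF that], of i j]) simp_all
  then have "frechet_derivative (\<lambda>y. F y v) (at z) = frechet_derivative (\<lambda>y. 0) (at z)"
    by (rule frechet_derivative_cong_open[OF assms(1,2)])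
  then show "frechet_derivative (\<lambda>y. F y v) (at z) w = 0" by simp
qed

lemma wedge_1_1:
  assumes "alternating 1 (\<alpha> i x)" "alternating 1 (\<beta> i x)"
  shows "wedge 1 1 \<alpha> \<beta> i x v
    = \<alpha> i x (\<lambda>_. v 0) * \<beta> i x (\<lambda>_. v 1) - \<alpha> i x (\<lambda>_. v 1) * \<beta> i x (\<lambda>_. v 0)"
proof -
  define a b where "a = (\<lambda>u. \<alpha> i x (\<lambda>_. u))" and "b = (\<lambda>u. \<beta> i x (\<lambda>_. u))"
  have ab: "\<alpha> i x w = a (w 0)" "\<beta> i x w = b (w 0)" for w
    unfolding a_def b_def by (rule alternating_1, rule assms)+
  have s: "{..<1 + 1} = {0, 1::nat}" by auto
  have f: "finite {1::nat}" "0 \<notin> {1::nat}" by auto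
  show ?thesis
    unfolding wedge_def ab s sum_over_permutations_insert[OF f] permutes_sing
    by (simp add: sign_swap_id sign_id)
qed

lemma wedge_2_1:
  assumes "alternating 2 (\<alpha> i x)" "alternating 1 (\<beta> i x)"
  shows "wedge 2 1 \<alpha> \<beta> i x v
    = \<alpha> i x (vec2 (v 0) (v 1)) * \<beta> i x (\<lambda>_. v 2) - \<alpha> i x (vec2 (v 0) (v 2)) * \<beta> i x (\<lambda>_. v 1)
    + \<alpha> i x (vec2 (v 1) (v 2)) * \<beta> i x (\<lambda>_. v 0)"
proof -
  define a b where "a = (\<lambda>u w. \<alpha> i x (vec2 u w))" and "b = (\<lambda>u. \<beta> i x (\<lambda>_. u))"
  have ab: "\<alpha> i x w = a (w 0) (w 1)" "\<beta> i x w = b (w 0)" for w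
    unfolding a_def b_def by (rule alternating_2 alternating_1, rule assms)+
  have sw: "a u w = - a w u" for u w
    unfolding a_def by (rule alternating_2_swap[OF assms(1)])
  have s: "{..<2 + 1} = {0, 1, 2::nat}" by auto
  have f: "finite {1, 2::nat}" "0 \<notin> {1, 2::nat}" "finite {2::nat}" "1 \<notin> {2::nat}" by auto
  show ?thesis
    unfolding wedge_def ab s sum_over_permutations_insert[OF f(1,2)] 
      sum_over_permutations_insert[OF f(3,4)] permutes_sing
    by (simp add: sign_swap_id permutation_swap_id sign_compose sign_id transpose_def fact_numeral
        sw[of "v 1" "v 0"] sw[of "v 2" "v 0"] sw[of "v 2" "v 1"])
qed

lemma wedge_1_2:
  assumes "alternating 1 (\<alpha> i x)" "alternating 2 (\<beta> i x)"
  shows "wedge 1 2 \<alpha> \<beta> i x v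
    = \<alpha> i x (\<lambda>_. v 0) * \<beta> i x (vec2 (v 1) (v 2)) - \<alpha> i x (\<lambda>_. v 1) * \<beta> i x (vec2 (v 0) (v 2))
    + \<alpha> i x (\<lambda>_. v 2) * \<beta> i x (vec2 (v 0) (v 1))"
proof -
  define a b where "a = (\<lambda>u. \<alpha> i x (\<lambda>_. u))" and "b = (\<lambda>u w. \<beta> i x (vec2 u w))"
  have ab: "\<alpha> i x w = a (w 0)" "\<beta> i x w = b (w 0) (w 1)" for w
    unfolding a_def b_def by (rule alternating_2 alternating_1, rule assms)+
  have sw: "b u w = - b w u" for u w
    unfolding b_def by (rule alternating_2_swap[OF assms(2)])
  have s: "{..<1 + 2} = {0, 1, 2::nat}" by auto
  have f: "finite {1, 2::nat}" "0 \<notin> {1, 2::nat}" "finite {2::nat}" "1 \<notin> {2::nat}" by auto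
  show ?thesis
    unfolding wedge_def ab s sum_over_permutations_insert[OF f(1,2)] 
      sum_over_permutations_insert[OF f(3,4)] permutes_sing
    by (simp add: sign_swap_id permutation_swap_id sign_compose sign_id transpose_def fact_numeral
        sw[of "v 1" "v 0"] sw[of "v 2" "v 0"] sw[of "v 2" "v 1"])
qed

lemma alternating_wedge_1_1:
  assumes "alternating 1 (\<alpha> i x)" "alternating 1 (\<beta> i x)"
  shows "alternating 2 (wedge 1 1 \<alpha> \<beta> i x)"
proof -
  define a b where "a = (\<lambda>u. \<alpha> i x (\<lambda>_. u))" and "b = (\<lambda>u. \<beta> i x (\<lambda>_. u))"
  have lin: "linear a" "linear b"
    unfolding a_def b_def by (rule alternating_1_linear, rule assms)+
  show ?thesis
  proof (rule alternating_2I)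
    show "wedge 1 1 \<alpha> \<beta> i x v = (\<lambda>u w. a u * b w - a w * b u) (v 0) (v 1)" for v
      by (simp only: wedge_1_1[of \<alpha> i x \<beta>, OF assms] a_def b_def)
    show "linear (\<lambda>u. a u * b w - a w * b u)" for w
      by (rule linearI) (simp_all add: linear_add[OF lin(1)] linear_add[OF lin(2)]
          linear_scale[OF lin(1)] linear_scale[OF lin(2)] algebra_simps)
    show "linear (\<lambda>w. a u * b w - a w * b u)" for u
      by (rule linearI) (simp_all add: linear_add[OF lin(1)] linear_add[OF lin(2)]
          linear_scale[OF lin(1)] linear_scale[OF lin(2)] algebra_simps)
  qed simp
qed

section \<open>Smooth forms and families of forms\<close>

text \<open>The local conditions in \<open>kform\<close>, without compatibility with the transition maps. The exterior
  calculus is pointwise in a chart and never compares two charts, so it can be done for these forms.\<close>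

definition smooth_form :: "('m, 'e::euclidean_space, 'i) mfd \<Rightarrow> nat \<Rightarrow> ('i, 'e) form \<Rightarrow> bool" where
  "smooth_form X k \<omega> \<longleftrightarrow>
     (\<forall>i\<in>idx X. open (chart_img X i) \<and> (\<forall>x\<in>chart_img X i. alternating k (\<omega> i x)) \<and>
        (\<forall>v. smooth_on (chart_img X i) (\<lambda>x. \<omega> i x v)))"

text \<open>Joint smoothness in the point and the time, separated from the alternating property because
  3-forms occur below only through their coefficients.\<close>

definition smooth_coeffs ::
  "('m, 'e::euclidean_space, 'i) mfd \<Rightarrow> real set \<Rightarrow> (real \<Rightarrow> ('i, 'e) form) \<Rightarrow> bool" where
  "smooth_coeffs X T \<xi> \<longleftrightarrow> open T \<and> (\<forall>i\<in>idx X. open (chart_img X i) \<and>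
     (\<forall>v. smooth_on (chart_img X i \<times> T) (\<lambda>(x, t). \<xi> t i x v)))"

definition smooth_family ::
  "('m, 'e::euclidean_space, 'i) mfd \<Rightarrow> nat \<Rightarrow> real set \<Rightarrow> (real \<Rightarrow> ('i, 'e) form) \<Rightarrow> bool" where
  "smooth_family X k T \<xi> \<longleftrightarrow> smooth_coeffs X T \<xi> \<and>
     (\<forall>t\<in>T. \<forall>i\<in>idx X. \<forall>x\<in>chart_img X i. alternating k (\<xi> t i x))"

lemma smooth_family_at:
  assumes "smooth_family X k T \<xi>" "t \<in> T"
  shows "smooth_form X k (\<xi> t)"
  unfolding smooth_form_def
proof (intro ballI conjI allI)
  fix i v assume i: "i \<in> idx X"
  show "open (chart_img X i)"
    using assms i by (simp add: smooth_family_def smooth_coeffs_def)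
  show "alternating k (\<xi> t i x)" if "x \<in> chart_img X i" for x
    using assms i that by (simp add: smooth_family_def)
  show "smooth_on (chart_img X i) (\<lambda>x. \<xi> t i x v)"
    using smooth_on_slice[of "chart_img X i" T "\<lambda>(x, t). \<xi> t i x v" t] assms i
    by (simp add: smooth_family_def smooth_coeffs_def)
qed

lemma form_eqD: "\<alpha> \<doteq>\<^bsub>X\<^esub> \<beta> \<Longrightarrow> i \<in> idx X \<Longrightarrow> x \<in> chart_img X i \<Longrightarrow> \<alpha> i x v = \<beta> i x v"
  by (simp add: form_eq_def)

lemma form_eqI: "(\<And>i x v. i \<in> idx X \<Longrightarrow> x \<in> chart_img X i \<Longrightarrow> \<alpha> i x v = \<beta> i x v) \<Longrightarrow> \<alpha> \<doteq>\<^bsub>X\<^esub> \<beta>"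
  by (simp add: form_eq_def)

context
  fixes X :: "('m, 'e::euclidean_space, 'i) mfd" and i x
  assumes i: "i \<in> idx X" and x: "x \<in> chart_img X i"
begin

lemma smooth_form_differentiable: "smooth_form X k \<omega> \<Longrightarrow> (\<lambda>y. \<omega> i y v) differentiable (at x)"
  by (rule smooth_on_differentiable[OF _ x]) (use i in \<open>simp add: smooth_form_def\<close>)

lemma smooth_form_has_derivative:
  "smooth_form X k \<omega> \<Longrightarrow> ((\<lambda>y. \<omega> i y v) has_derivative frechet_derivative (\<lambda>y. \<omega> i y v) (at x)) (at x)"
  by (simp only: frechet_derivative_works[symmetric] smooth_form_differentiable)

lemma smooth_form_alternating: "smooth_form X k \<omega> \<Longrightarrow> alternating k (\<omega> i x)"
  using i x by (simp add: smooth_form_def)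

lemma smooth_form_derivative_agree:
  assumes "smooth_form X k \<omega>" "\<And>n. n < k \<Longrightarrow> v n = w n"
  shows "frechet_derivative (\<lambda>y. \<omega> i y v) (at x) = frechet_derivative (\<lambda>y. \<omega> i y w) (at x)"
proof (rule frechet_derivative_cong_open)
  show "open (chart_img X i)"
    using assms(1) i by (simp add: smooth_form_def)
  show "x \<in> chart_img X i" by (rule x)
  have alt: "alternating k (\<omega> i y)" if "y \<in> chart_img X i" for y
    using assms(1) i that by (simp add: smooth_form_def)
  show "\<omega> i y v = \<omega> i y w" if "y \<in> chart_img X i" for y
    by (rule alternating_agree[OF alt[OF that]]) (rule assms(2))
qed

lemma ext_d_1:
  assumes "smooth_form X 1 \<omega>"
  shows "ext_d 1 \<omega> i x v = frechet_derivative (\<lambda>y. \<omega> i y (\<lambda>_. v 1)) (at x) (v 0)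
     - frechet_derivative (\<lambda>y. \<omega> i y (\<lambda>_. v 0)) (at x) (v 1)"
proof -
  let ?v = "\<lambda>j n. v (if n < j then n else Suc n)"
  have "frechet_derivative (\<lambda>y. \<omega> i y (?v 0)) (at x) = frechet_derivative (\<lambda>y. \<omega> i y (\<lambda>_. v 1)) (at x)"
    "frechet_derivative (\<lambda>y. \<omega> i y (?v 1)) (at x) = frechet_derivative (\<lambda>y. \<omega> i y (\<lambda>_. v 0)) (at x)"
    by (rule smooth_form_derivative_agree[OF assms]; simp add: One_nat_def)+
  moreover have "{..1::nat} = {0, 1}" by auto
  ultimately show ?thesis
    by (simp only: ext_d_def) simp
qed

lemma ext_d_2:
  assumes "smooth_form X 2 \<omega>"
  shows "ext_d 2 \<omega> i x v = frechet_derivative (\<lambda>y. \<omega> i y (vec2 (v 1) (v 2))) (at x) (v 0)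
     - frechet_derivative (\<lambda>y. \<omega> i y (vec2 (v 0) (v 2))) (at x) (v 1)
     + frechet_derivative (\<lambda>y. \<omega> i y (vec2 (v 0) (v 1))) (at x) (v 2)"
proof -
  let ?v = "\<lambda>j n. v (if n < j then n else Suc n)"
  have "frechet_derivative (\<lambda>y. \<omega> i y (?v 0)) (at x) = frechet_derivative (\<lambda>y. \<omega> i y (vec2 (v 1) (v 2))) (at x)"
    "frechet_derivative (\<lambda>y. \<omega> i y (?v 1)) (at x) = frechet_derivative (\<lambda>y. \<omega> i y (vec2 (v 0) (v 2))) (at x)"
    "frechet_derivative (\<lambda>y. \<omega> i y (?v 2)) (at x) = frechet_derivative (\<lambda>y. \<omega> i y (vec2 (v 0) (v 1))) (at x)"
    by (rule smooth_form_derivative_agree[OF assms], auto simp: less_2_cases_iff vec2_def One_nat_def numeral_2_eq_2 less_Suc_eq)+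
  moreover have "{..2::nat} = {0, 1, 2}" by auto
  ultimately show ?thesis
    by (simp only: ext_d_def) simp
qed

end

section \<open>Exterior calculus in charts\<close>

lemma smooth_formD:
  assumes "smooth_form X k \<omega>" "i \<in> idx X"
  shows "open (chart_img X i)" "x \<in> chart_img X i \<Longrightarrow> alternating k (\<omega> i x)"
    "smooth_on (chart_img X i) (\<lambda>x. \<omega> i x v)"
  using assms by (simp_all add: smooth_form_def)

lemma smooth_form_wedge_1_1:
  assumes "smooth_form X 1 \<alpha>" "smooth_form X 1 \<beta>"
  shows "smooth_form X 2 (wedge 1 1 \<alpha> \<beta>)"
  unfolding smooth_form_def
proof (intro ballI conjI allI)
  fix i v assume i: "i \<in> idx X"
  note a = smooth_formD[OF assms(1) i] and b = smooth_formD[OF assms(2) i]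
  show "open (chart_img X i)" by (rule a)
  show "alternating 2 (wedge 1 1 \<alpha> \<beta> i x)" if "x \<in> chart_img X i" for x
    by (intro alternating_wedge_1_1 a(2) b(2) that)
  show "smooth_on (chart_img X i) (\<lambda>x. wedge 1 1 \<alpha> \<beta> i x v)"
    unfolding wedge_def divide_inverse
    by (intro smooth_on_mult smooth_on_sum smooth_on_const a b)
qed

lemma smooth_form_add:
  assumes "smooth_form X k \<alpha>" "smooth_form X k \<beta>"
  shows "smooth_form X k (\<alpha> + \<beta>)"
  unfolding smooth_form_def
proof (intro ballI conjI allI)
  fix i v assume i: "i \<in> idx X"
  note a = smooth_formD[OF assms(1) i] and b = smooth_formD[OF assms(2) i]
  show "open (chart_img X i)" by (rule a)
  show "alternating k ((\<alpha> + \<beta>) i x)" if "x \<in> chart_img X i" for x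
    using alternating_add[OF a(2) b(2), OF that that] by (simp add: plus_fun_def)
  show "smooth_on (chart_img X i) (\<lambda>x. (\<alpha> + \<beta>) i x v)"
    using smooth_on_add[OF a(1) a(3) b(3)] by simp
qed

lemma smooth_form_scale:
  assumes "smooth_form X k \<alpha>"
  shows "smooth_form X k (c *\<^sub>F \<alpha>)"
  unfolding smooth_form_def
proof (intro ballI conjI allI)
  fix i v assume i: "i \<in> idx X"
  note a = smooth_formD[OF assms(1) i]
  show "open (chart_img X i)" by (rule a)
  show "alternating k ((c *\<^sub>F \<alpha>) i x)" if "x \<in> chart_img X i" for x
    using alternating_scale[OF a(2), OF that] by (simp add: scale_form_def)
  show "smooth_on (chart_img X i) (\<lambda>x. (c *\<^sub>F \<alpha>) i x v)"
    unfolding scale_form_def by (intro smooth_on_mult smooth_on_const a)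
qed

lemma alternating_2_ext_d_1:
  fixes X :: "('m, 'e::euclidean_space, 'i) mfd"
  assumes \<omega>: "smooth_form X 1 \<omega>" and i: "i \<in> idx X" and x: "x \<in> chart_img X i"
  shows "alternating 2 (ext_d 1 \<omega> i x)"
proof -
  let ?g = "\<lambda>u w. frechet_derivative (\<lambda>y. \<omega> i y (\<lambda>_. w)) (at x) u"
  have l1: "linear (\<lambda>u. ?g u w)" for w
    by (rule linear_frechet_derivative[OF smooth_form_differentiable[OF i x \<omega>]])
  have "alternating 1 (\<lambda>v. frechet_derivative (\<lambda>y. \<omega> i y v) (at x) u)" for u
    by (rule alternating_derivative[OF smooth_formD(1)[OF \<omega> i] x])
      (rule smooth_formD(2)[OF \<omega> i] smooth_form_differentiable[OF i x \<omega>]; assumption)+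
  then have l2: "linear (\<lambda>w. ?g u w)" for u
    by (rule alternating_1_linear)
  show ?thesis
  proof (rule alternating_2I[where g = "\<lambda>u w. ?g u w - ?g w u"])
    show "ext_d 1 \<omega> i x v = ?g (v 0) (v 1) - ?g (v 1) (v 0)" for v
      by (rule ext_d_1[OF i x \<omega>])
    show "linear (\<lambda>u. ?g u w - ?g w u)" for w
      by (intro linear_compose_sub l1 l2)
    show "linear (\<lambda>w. ?g u w - ?g w u)" for u
      by (intro linear_compose_sub l1 l2)
  qed simp
qed

lemma smooth_form_ext_d_1:
  assumes "smooth_form X 1 \<omega>"
  shows "smooth_form X 2 (ext_d 1 \<omega>)"
  unfolding smooth_form_def
proof (intro ballI conjI allI)
  fix i v assume i: "i \<in> idx X"
  note a = smooth_formD[OF assms i]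
  show "open (chart_img X i)" by (rule a)
  show "alternating 2 (ext_d 1 \<omega> i x)" if "x \<in> chart_img X i" for x
    by (rule alternating_2_ext_d_1[OF assms i that])
  show "smooth_on (chart_img X i) (\<lambda>x. ext_d 1 \<omega> i x v)"
    unfolding ext_d_def
    by (intro smooth_on_mult smooth_on_sum smooth_on_const smooth_on_derivative a)
qed

lemma ext_d_cong:
  assumes "smooth_form X k \<omega>" "\<omega> \<doteq>\<^bsub>X\<^esub> \<omega>'"
  shows "ext_d l \<omega> \<doteq>\<^bsub>X\<^esub> ext_d l \<omega>'"
proof (rule form_eqI)
  fix i x v assume i: "i \<in> idx X" and x: "x \<in> chart_img X i"
  have "frechet_derivative (\<lambda>y. \<omega> i y u) (at x) = frechet_derivative (\<lambda>y. \<omega>' i y u) (at x)" for u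
    by (rule frechet_derivative_cong_open[OF smooth_formD(1)[OF assms(1) i] x form_eqD[OF assms(2) i]])
  then show "ext_d l \<omega> i x v = ext_d l \<omega>' i x v"
    by (simp only: ext_d_def)
qed

lemma ext_d_add:
  fixes X :: "('m, 'e::euclidean_space, 'i) mfd"
  assumes "smooth_form X k \<alpha>" "smooth_form X l \<beta>"
  shows "ext_d n (\<alpha> + \<beta>) \<doteq>\<^bsub>X\<^esub> ext_d n \<alpha> + ext_d n \<beta>"
proof (rule form_eqI)
  fix i x v assume i: "i \<in> idx X" and x: "x \<in> chart_img X i"
  have "frechet_derivative (\<lambda>y. \<alpha> i y u + \<beta> i y u) (at x)
      = (\<lambda>w. frechet_derivative (\<lambda>y. \<alpha> i y u) (at x) w + frechet_derivative (\<lambda>y. \<beta> i y u) (at x) w)" for u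
    by (rule frechet_derivative_at[symmetric])
      (intro has_derivative_add smooth_form_has_derivative[OF i x assms(1)] smooth_form_has_derivative[OF i x assms(2)])
  then show "ext_d n (\<alpha> + \<beta>) i x v = (ext_d n \<alpha> + ext_d n \<beta>) i x v"
    by (simp add: ext_d_def sum.distrib distrib_left)
qed

lemma ext_d_scale:
  fixes X :: "('m, 'e::euclidean_space, 'i) mfd"
  assumes "smooth_form X k \<alpha>"
  shows "ext_d n (c *\<^sub>F \<alpha>) \<doteq>\<^bsub>X\<^esub> c *\<^sub>F ext_d n \<alpha>"
proof (rule form_eqI)
  fix i x v assume i: "i \<in> idx X" and x: "x \<in> chart_img X i"
  have "frechet_derivative (\<lambda>y. c * \<alpha> i y u) (at x)
      = (\<lambda>w. c * frechet_derivative (\<lambda>y. \<alpha> i y u) (at x) w)" for u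
    by (rule frechet_derivative_at[symmetric])
      (intro has_derivative_mult_right smooth_form_has_derivative[OF i x assms])
  then show "ext_d n (c *\<^sub>F \<alpha>) i x v = (c *\<^sub>F ext_d n \<alpha>) i x v"
    by (simp add: ext_d_def scale_form_def sum_distrib_left mult.left_commute)
qed

text \<open>The six second derivatives cancel in pairs by symmetry.\<close>

lemma ext_d_ext_d:
  fixes X :: "('m, 'e::euclidean_space, 'i) mfd"
  assumes "smooth_form X 1 \<omega>" "i \<in> idx X" "x \<in> chart_img X i"
  shows "ext_d 2 (ext_d 1 \<omega>) i x v = 0"
proof -
  note sm = smooth_formD(3)[OF assms(1,2)] and op = smooth_formD(1)[OF assms(1,2)]
  define D where "D = (\<lambda>a u b. frechet_derivative (\<lambda>y. frechet_derivative (\<lambda>y. \<omega> i y (\<lambda>_. u)) (at y) b) (at x) a)"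
  have sym: "D a u b = D b u a" for a u b
    unfolding D_def by (rule second_derivative_symmetric[OF op sm assms(3)])
  have "frechet_derivative (\<lambda>y. ext_d 1 \<omega> i y (vec2 a b)) (at x) w = D w b a - D w a b" for a b w
  proof -
    have d: "((\<lambda>y. frechet_derivative (\<lambda>y. \<omega> i y (\<lambda>_. u)) (at y) b) has_derivative (\<lambda>w. D w u b)) (at x)" for u b
      unfolding D_def by (rule smooth_on_has_derivative[OF smooth_on_derivative[OF sm] assms(3)])
    have "frechet_derivative (\<lambda>y. ext_d 1 \<omega> i y (vec2 a b)) (at x)
        = frechet_derivative (\<lambda>y. frechet_derivative (\<lambda>y. \<omega> i y (\<lambda>_. b)) (at y) a
            - frechet_derivative (\<lambda>y. \<omega> i y (\<lambda>_. a)) (at y) b) (at x)"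
      by (rule frechet_derivative_cong_open[OF op assms(3)])
        (simp only: ext_d_1[OF assms(2) _ assms(1)] vec2_simps)
    also have "\<dots> = (\<lambda>w. D w b a - D w a b)"
      by (rule frechet_derivative_at[symmetric]) (intro has_derivative_diff d)
    finally show ?thesis by (rule fun_cong)
  qed
  then have "ext_d 2 (ext_d 1 \<omega>) i x v
    = D (v 0) (v 2) (v 1) - D (v 0) (v 1) (v 2) - (D (v 1) (v 2) (v 0) - D (v 1) (v 0) (v 2))
      + (D (v 2) (v 1) (v 0) - D (v 2) (v 0) (v 1))"
    by (simp only: ext_d_2[OF assms(2,3) smooth_form_ext_d_1[OF assms(1)]])
  then show ?thesis
    using sym[of "v 0" "v 2" "v 1"] sym[of "v 0" "v 1" "v 2"] sym[of "v 1" "v 0" "v 2"] by linarith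
qed

text \<open>The Leibniz rule, by comparing the expansions of both sides on three vectors.\<close>

lemma ext_d_wedge_1_1:
  fixes X :: "('m, 'e::euclidean_space, 'i) mfd"
  assumes \<alpha>: "smooth_form X 1 \<alpha>" and \<beta>: "smooth_form X 1 \<beta>"
  shows "ext_d 2 (wedge 1 1 \<alpha> \<beta>) \<doteq>\<^bsub>X\<^esub> wedge 2 1 (ext_d 1 \<alpha>) \<beta> - wedge 1 2 \<alpha> (ext_d 1 \<beta>)"
proof (rule form_eqI)
  fix i x v assume i: "i \<in> idx X" and x: "x \<in> chart_img X i"
  define a b where "a = (\<lambda>u. \<alpha> i x (\<lambda>_. u))" and "b = (\<lambda>u. \<beta> i x (\<lambda>_. u))"
  define da db where "da = (\<lambda>w u. frechet_derivative (\<lambda>y. \<alpha> i y (\<lambda>_. u)) (at x) w)"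
    and "db = (\<lambda>w u. frechet_derivative (\<lambda>y. \<beta> i y (\<lambda>_. u)) (at x) w)"
  have alt: "alternating 1 (\<alpha> i y)" "alternating 1 (\<beta> i y)" if "y \<in> chart_img X i" for y
    using smooth_formD(2)[OF \<alpha> i that] smooth_formD(2)[OF \<beta> i that] .
  have alt2: "alternating 2 (ext_d 1 \<alpha> i x)" "alternating 2 (ext_d 1 \<beta> i x)"
    by (intro alternating_2_ext_d_1[OF _ i x] \<alpha> \<beta>)+
  have d: "((\<lambda>y. \<alpha> i y (\<lambda>_. u)) has_derivative (\<lambda>w. da w u)) (at x)"
    "((\<lambda>y. \<beta> i y (\<lambda>_. u)) has_derivative (\<lambda>w. db w u)) (at x)" for u
    unfolding da_def db_def by (rule smooth_form_has_derivative[OF i x \<alpha>] smooth_form_has_derivative[OF i x \<beta>])+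
  have "frechet_derivative (\<lambda>y. wedge 1 1 \<alpha> \<beta> i y (vec2 p q)) (at x) w
    = (a p * db w q + da w p * b q) - (a q * db w p + da w q * b p)" for p q w
  proof -
    have "frechet_derivative (\<lambda>y. wedge 1 1 \<alpha> \<beta> i y (vec2 p q)) (at x)
        = frechet_derivative (\<lambda>y. \<alpha> i y (\<lambda>_. p) * \<beta> i y (\<lambda>_. q) - \<alpha> i y (\<lambda>_. q) * \<beta> i y (\<lambda>_. p)) (at x)"
      by (rule frechet_derivative_cong_open[OF smooth_formD(1)[OF \<alpha> i] x])
        (simp only: wedge_1_1[of \<alpha> i _ \<beta>, OF alt] vec2_simps)
    also have "\<dots> = (\<lambda>w. (a p * db w q + da w p * b q) - (a q * db w p + da w q * b p))"
      unfolding a_def b_def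
      by (rule frechet_derivative_at[symmetric]) (intro has_derivative_diff has_derivative_mult d)
    finally show ?thesis by (rule fun_cong)
  qed
  then have "ext_d 2 (wedge 1 1 \<alpha> \<beta>) i x v
    = (a (v 1) * db (v 0) (v 2) + da (v 0) (v 1) * b (v 2)) - (a (v 2) * db (v 0) (v 1) + da (v 0) (v 2) * b (v 1))
    - ((a (v 0) * db (v 1) (v 2) + da (v 1) (v 0) * b (v 2)) - (a (v 2) * db (v 1) (v 0) + da (v 1) (v 2) * b (v 0)))
    + ((a (v 0) * db (v 2) (v 1) + da (v 2) (v 0) * b (v 1)) - (a (v 1) * db (v 2) (v 0) + da (v 2) (v 1) * b (v 0)))"
    by (simp only: ext_d_2[OF i x smooth_form_wedge_1_1[OF \<alpha> \<beta>]])
  moreover have "ext_d 1 \<alpha> i x (vec2 p q) = da p q - da q p" "ext_d 1 \<beta> i x (vec2 p q) = db p q - db q p" for p q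
    by (simp_all only: ext_d_1[OF i x \<alpha>] ext_d_1[OF i x \<beta>] vec2_simps da_def db_def)
  then have "wedge 2 1 (ext_d 1 \<alpha>) \<beta> i x v
     = (da (v 0) (v 1) - da (v 1) (v 0)) * b (v 2) - (da (v 0) (v 2) - da (v 2) (v 0)) * b (v 1)
     + (da (v 1) (v 2) - da (v 2) (v 1)) * b (v 0)"
    "wedge 1 2 \<alpha> (ext_d 1 \<beta>) i x v
     = a (v 0) * (db (v 1) (v 2) - db (v 2) (v 1)) - a (v 1) * (db (v 0) (v 2) - db (v 2) (v 0))
     + a (v 2) * (db (v 0) (v 1) - db (v 1) (v 0))"
    by (simp_all only: wedge_2_1[of "ext_d 1 \<alpha>" i x \<beta>, OF alt2(1) alt(2)[OF x]]
        wedge_1_2[of \<alpha> i x "ext_d 1 \<beta>", OF alt(1)[OF x] alt2(2)] a_def b_def)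
  ultimately show "ext_d 2 (wedge 1 1 \<alpha> \<beta>) i x v = (wedge 2 1 (ext_d 1 \<alpha>) \<beta> - wedge 1 2 \<alpha> (ext_d 1 \<beta>)) i x v"
    by (simp add: algebra_simps)
qed

lemma wedge_scale_left: "wedge k l (c *\<^sub>F \<alpha>) \<beta> = c *\<^sub>F wedge k l \<alpha> \<beta>"
  by (simp add: wedge_def scale_form_def sum_distrib_left mult_ac)

lemma wedge_add_left: "wedge k l (\<alpha> + \<alpha>') \<beta> = wedge k l \<alpha> \<beta> + wedge k l \<alpha>' \<beta>"
  by (simp add: wedge_def fun_eq_iff sum.distrib[symmetric] add_divide_distrib[symmetric] algebra_simps)

lemma wedge_add_right: "wedge k l \<alpha> (\<beta> + \<beta>') = wedge k l \<alpha> \<beta> + wedge k l \<alpha> \<beta>'"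
  by (simp add: wedge_def fun_eq_iff sum.distrib[symmetric] add_divide_distrib[symmetric] algebra_simps)

lemma wedge_assoc:
  assumes "alternating 1 (\<alpha> i x)" "alternating 1 (\<beta> i x)" "alternating 1 (\<gamma> i x)"
  shows "wedge 1 2 \<alpha> (wedge 1 1 \<beta> \<gamma>) i x v = wedge 2 1 (wedge 1 1 \<alpha> \<beta>) \<gamma> i x v"
  unfolding wedge_1_2[of \<alpha> i x "wedge 1 1 \<beta> \<gamma>", OF assms(1) alternating_wedge_1_1[of \<beta> i x \<gamma>, OF assms(2,3)]]
    wedge_2_1[of "wedge 1 1 \<alpha> \<beta>" i x \<gamma>, OF alternating_wedge_1_1[of \<alpha> i x \<beta>, OF assms(1,2)] assms(3)]
    wedge_1_1[of \<alpha> i x \<beta>, OF assms(1,2)] wedge_1_1[of \<beta> i x \<gamma>, OF assms(2,3)] vec2_simps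
  by (simp add: algebra_simps)

section \<open>Time derivatives of families of forms\<close>

lemma smooth_coeffsD:
  assumes "smooth_coeffs X T \<xi>" "i \<in> idx X"
  shows "open T" "open (chart_img X i)" "smooth_on (chart_img X i \<times> T) (\<lambda>(x, t). \<xi> t i x v)"
  using assms by (simp_all add: smooth_coeffs_def)

lemma smooth_familyD: 
  "smooth_family X k T \<xi> \<Longrightarrow> smooth_coeffs X T \<xi>"
  "smooth_family X k T \<xi> \<Longrightarrow> t \<in> T \<Longrightarrow> i \<in> idx X \<Longrightarrow> x \<in> chart_img X i \<Longrightarrow> alternating k (\<xi> t i x)"
  by (simp_all add: smooth_family_def)

lemma smooth_coeffs_wedge:
  assumes "smooth_coeffs X T \<xi>" "smooth_coeffs X T \<zeta>"
  shows "smooth_coeffs X T (\<lambda>t. wedge k l (\<xi> t) (\<zeta> t))"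
  unfolding smooth_coeffs_def
proof (intro conjI ballI allI)
  show "open T" using assms(1) by (simp add: smooth_coeffs_def)
  fix i v assume i: "i \<in> idx X"
  note a = smooth_coeffsD[OF assms(1) i] and b = smooth_coeffsD[OF assms(2) i]
  show "open (chart_img X i)" by (rule a)
  show "smooth_on (chart_img X i \<times> T) (\<lambda>(x, t). wedge k l (\<xi> t) (\<zeta> t) i x v)"
    using a b unfolding wedge_def divide_inverse case_prod_unfold
    by (intro smooth_on_mult smooth_on_sum smooth_on_const open_Times) simp_all
qed

lemma smooth_coeffs_scale:
  assumes "smooth_coeffs X T \<xi>"
  shows "smooth_coeffs X T (\<lambda>t. c *\<^sub>F \<xi> t)"
  unfolding smooth_coeffs_def
proof (intro conjI ballI allI)
  show "open T" using assms(1) by (simp add: smooth_coeffs_def)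
  fix i v assume i: "i \<in> idx X"
  note a = smooth_coeffsD[OF assms(1) i]
  show "open (chart_img X i)" by (rule a)
  show "smooth_on (chart_img X i \<times> T) (\<lambda>(x, t). (c *\<^sub>F \<xi> t) i x v)"
    using a unfolding scale_form_def case_prod_unfold
    by (intro smooth_on_mult smooth_on_const open_Times) simp_all
qed

lemma smooth_coeffs_ext_d:
  assumes "smooth_coeffs X T \<xi>"
  shows "smooth_coeffs X T (\<lambda>t. ext_d k (\<xi> t))"
  unfolding smooth_coeffs_def
proof (intro conjI ballI allI)
  show "open T" using assms(1) by (simp add: smooth_coeffs_def)
  fix i v assume i: "i \<in> idx X"
  note a = smooth_coeffsD[OF assms(1) i]
  show "open (chart_img X i)" by (rule a)
  have "smooth_on (chart_img X i \<times> T) (\<lambda>z. frechet_derivative (\<lambda>y. \<xi> (snd z) i y u) (at (fst z)) w)" for u w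
    using smooth_on_deriv_space[OF a(2,1,3)] by (simp add: case_prod_unfold)
  then show "smooth_on (chart_img X i \<times> T) (\<lambda>(x, t). ext_d k (\<xi> t) i x v)"
    using a(1,2) unfolding ext_d_def case_prod_unfold
    by (intro smooth_on_mult smooth_on_sum smooth_on_const open_Times)
qed

lemma smooth_coeffs_time_deriv:
  assumes "smooth_coeffs X T \<xi>"
  shows "smooth_coeffs X T (time_deriv \<xi>)"
  unfolding smooth_coeffs_def
proof (intro conjI ballI allI)
  show "open T" using assms(1) by (simp add: smooth_coeffs_def)
  fix i v assume i: "i \<in> idx X"
  note a = smooth_coeffsD[OF assms(1) i]
  show "open (chart_img X i)" by (rule a)
  show "smooth_on (chart_img X i \<times> T) (\<lambda>(x, t). time_deriv \<xi> t i x v)"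
    using smooth_on_deriv_time[OF a(2,1,3)] by (simp add: case_prod_unfold time_deriv_def)
qed

lemma smooth_family_wedge_1_1:
  assumes "smooth_family X 1 T \<xi>" "smooth_family X 1 T \<zeta>"
  shows "smooth_family X 2 T (\<lambda>t. wedge 1 1 (\<xi> t) (\<zeta> t))"
  using assms unfolding smooth_family_def
  by (simp add: smooth_coeffs_wedge alternating_wedge_1_1)

lemma smooth_family_scale:
  assumes "smooth_family X k T \<xi>"
  shows "smooth_family X k T (\<lambda>t. c *\<^sub>F \<xi> t)"
  unfolding smooth_family_def
proof (intro conjI ballI)
  show "smooth_coeffs X T (\<lambda>t. c *\<^sub>F \<xi> t)"
    by (intro smooth_coeffs_scale smooth_familyD[OF assms])
  show "alternating k ((c *\<^sub>F \<xi> t) i x)" if "t \<in> T" "i \<in> idx X" "x \<in> chart_img X i" for t i x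
    using alternating_scale[OF smooth_familyD(2)[OF assms that]] by (simp add: scale_form_def)
qed

lemma smooth_family_time_deriv:
  fixes X :: "('m, 'e::euclidean_space, 'i) mfd"
  assumes "smooth_family X k T \<xi>"
  shows "smooth_family X k T (time_deriv \<xi>)"
  unfolding smooth_family_def
proof (intro conjI ballI)
  show "smooth_coeffs X T (time_deriv \<xi>)"
    by (intro smooth_coeffs_time_deriv smooth_familyD[OF assms])
  fix t i x assume t: "t \<in> T" and i: "i \<in> idx X" and x: "x \<in> chart_img X i"
  note a = smooth_coeffsD[OF smooth_familyD(1)[OF assms] i]
  have xt: "(x, t) \<in> chart_img X i \<times> T" using x t by simp
  have "alternating k (\<lambda>v. frechet_derivative (\<lambda>z. (\<lambda>(x, t) v. \<xi> t i x v) z v) (at (x, t)) (0, 1))"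
  proof (rule alternating_derivative[OF open_Times[OF a(2,1)] xt])
    show "alternating k ((\<lambda>(x, t) v. \<xi> t i x v) z)" if "z \<in> chart_img X i \<times> T" for z
      using smooth_familyD(2)[OF assms _ i] that by (auto simp: case_prod_unfold)
    show "(\<lambda>z. (\<lambda>(x, t) v. \<xi> t i x v) z v) differentiable (at (x, t))" for v
      using smooth_on_differentiable[OF a(3) xt] by (simp add: case_prod_unfold)
  qed
  moreover have "frechet_derivative (\<lambda>z. (\<lambda>(x, t) v. \<xi> t i x v) z v) (at (x, t)) (0, 1) = time_deriv \<xi> t i x v" for v
    using deriv_time_slice[OF a(3) x t] by (simp add: time_deriv_def case_prod_unfold)
  ultimately show "alternating k (time_deriv \<xi> t i x)"
    by simp
qed

lemma time_deriv_has_derivative: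
  fixes X :: "('m, 'e::euclidean_space, 'i) mfd"
  assumes "smooth_coeffs X T \<xi>" "t \<in> T" "i \<in> idx X" "x \<in> chart_img X i"
  shows "((\<lambda>s. \<xi> s i x v) has_real_derivative time_deriv \<xi> t i x v) (at t)"
  using time_slice_has_derivative[OF smooth_coeffsD(3)[OF assms(1,3)] assms(4,2)]
    deriv_time_slice[OF smooth_coeffsD(3)[OF assms(1,3)] assms(4,2)]
  by (simp add: time_deriv_def)

text \<open>Each term of \<open>ext_d\<close> is a space derivative, and those commute with the time derivative.\<close>

lemma time_deriv_ext_d:
  fixes X :: "('m, 'e::euclidean_space, 'i) mfd"
  assumes "smooth_coeffs X T \<xi>" "t \<in> T"
  shows "time_deriv (\<lambda>s. ext_d k (\<xi> s)) t \<doteq>\<^bsub>X\<^esub> ext_d k (time_deriv \<xi> t)"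
proof (rule form_eqI)
  fix i x v assume i: "i \<in> idx X" and x: "x \<in> chart_img X i"
  note a = smooth_coeffsD[OF assms(1) i]
  have "((\<lambda>s. frechet_derivative (\<lambda>y. \<xi> s i y u) (at x) w) has_real_derivative
      frechet_derivative (\<lambda>y. time_deriv \<xi> t i y u) (at x) w) (at t)" for u w
    using time_slice_has_derivative[OF smooth_on_deriv_space[OF a(2,1,3)] x assms(2)]
      deriv_time_slice[OF smooth_on_deriv_space[OF a(2,1,3)] x assms(2)]
      deriv_frechet_derivative_commute[OF a(2,1,3) x assms(2)]
    by (simp add: time_deriv_def)
  then have "((\<lambda>s. ext_d k (\<xi> s) i x v) has_real_derivative ext_d k (time_deriv \<xi> t) i x v) (at t)"
    unfolding ext_d_def by (intro DERIV_sum DERIV_cmult)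
  then show "time_deriv (\<lambda>s. ext_d k (\<xi> s)) t i x v = ext_d k (time_deriv \<xi> t) i x v"
    unfolding time_deriv_def by (rule DERIV_imp_deriv)
qed

lemma time_deriv_wedge:
  fixes X :: "('m, 'e::euclidean_space, 'i) mfd"
  assumes "smooth_coeffs X T \<xi>" "smooth_coeffs X T \<zeta>" "t \<in> T"
  shows "time_deriv (\<lambda>s. wedge k l (\<xi> s) (\<zeta> s)) t
    \<doteq>\<^bsub>X\<^esub> wedge k l (time_deriv \<xi> t) (\<zeta> t) + wedge k l (\<xi> t) (time_deriv \<zeta> t)"
proof (rule form_eqI)
  fix i x and v :: "nat \<Rightarrow> 'e" assume i: "i \<in> idx X" and x: "x \<in> chart_img X i"
  define c where "c = (fact k * fact l :: real)"
  let ?a = "\<lambda>\<sigma> \<xi>. \<xi> i x (\<lambda>n. v (\<sigma> n)) :: real" and ?b = "\<lambda>\<sigma> \<zeta>. \<zeta> i x (\<lambda>n. v (\<sigma> (k + n))) :: real"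
  have "((\<lambda>s. wedge k l (\<xi> s) (\<zeta> s) i x v) has_real_derivative
      (\<Sum>\<sigma> | \<sigma> permutes {..<k + l}. of_int (sign \<sigma>) * ?a \<sigma> (time_deriv \<xi> t) * ?b \<sigma> (\<zeta> t)
        + ?b \<sigma> (time_deriv \<zeta> t) * (of_int (sign \<sigma>) * ?a \<sigma> (\<xi> t))) / c) (at t)"
    unfolding wedge_def c_def
    by (intro DERIV_cdivide DERIV_sum DERIV_mult DERIV_cmult
        time_deriv_has_derivative[OF _ assms(3) i x] assms)
  also have "(\<Sum>\<sigma> | \<sigma> permutes {..<k + l}. of_int (sign \<sigma>) * ?a \<sigma> (time_deriv \<xi> t) * ?b \<sigma> (\<zeta> t)
        + ?b \<sigma> (time_deriv \<zeta> t) * (of_int (sign \<sigma>) * ?a \<sigma> (\<xi> t))) / c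
      = (wedge k l (time_deriv \<xi> t) (\<zeta> t) + wedge k l (\<xi> t) (time_deriv \<zeta> t)) i x v"
    by (simp add: wedge_def c_def sum.distrib add_divide_distrib mult_ac)
  finally show "time_deriv (\<lambda>s. wedge k l (\<xi> s) (\<zeta> s)) t i x v
      = (wedge k l (time_deriv \<xi> t) (\<zeta> t) + wedge k l (\<xi> t) (time_deriv \<zeta> t)) i x v"
    unfolding time_deriv_def[of "\<lambda>s. wedge k l (\<xi> s) (\<zeta> s)"] by (rule DERIV_imp_deriv)
qed

lemma time_deriv_scale:
  fixes X :: "('m, 'e::euclidean_space, 'i) mfd"
  assumes "smooth_coeffs X T \<xi>" "t \<in> T"
  shows "time_deriv (\<lambda>s. c *\<^sub>F \<xi> s) t \<doteq>\<^bsub>X\<^esub> c *\<^sub>F time_deriv \<xi> t"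
proof (rule form_eqI)
  fix i x v assume i: "i \<in> idx X" and x: "x \<in> chart_img X i"
  have "((\<lambda>s. (c *\<^sub>F \<xi> s) i x v) has_real_derivative (c *\<^sub>F time_deriv \<xi> t) i x v) (at t)"
    unfolding scale_form_def by (intro DERIV_cmult time_deriv_has_derivative[OF assms i x])
  then show "time_deriv (\<lambda>s. c *\<^sub>F \<xi> s) t i x v = (c *\<^sub>F time_deriv \<xi> t) i x v"
    unfolding time_deriv_def[of "\<lambda>s. c *\<^sub>F \<xi> s"] by (rule DERIV_imp_deriv)
qed

lemma time_deriv_cong:
  assumes "open T" "t \<in> T" "\<And>s. s \<in> T \<Longrightarrow> \<xi> s \<doteq>\<^bsub>X\<^esub> \<zeta> s"
  shows "time_deriv \<xi> t \<doteq>\<^bsub>X\<^esub> time_deriv \<zeta> t"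
proof (rule form_eqI)
  fix i x v assume i: "i \<in> idx X" and x: "x \<in> chart_img X i"
  have "\<forall>\<^sub>F s in nhds t. \<xi> s i x v = \<zeta> s i x v"
    using eventually_nhds_in_open[OF assms(1,2)]
    by (rule eventually_mono) (rule form_eqD[OF assms(3) i x])
  then show "time_deriv \<xi> t i x v = time_deriv \<zeta> t i x v"
    unfolding time_deriv_def by (intro deriv_cong_ev refl)
qed

text \<open>The principle that carries the structure equations from one time to all others.\<close>

lemma form_eq_if_time_deriv_eq:
  fixes X :: "('m, 'e::euclidean_space, 'i) mfd"
  assumes "smooth_coeffs X T \<xi>" "smooth_coeffs X T \<zeta>" "convex T" "t\<^sub>0 \<in> T" "t \<in> T"
    and "\<xi> t\<^sub>0 \<doteq>\<^bsub>X\<^esub> \<zeta> t\<^sub>0" "\<And>s. s \<in> T \<Longrightarrow> time_deriv \<xi> s \<doteq>\<^bsub>X\<^esub> time_deriv \<zeta> s"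
  shows "\<xi> t \<doteq>\<^bsub>X\<^esub> \<zeta> t"
proof (rule form_eqI)
  fix i x v assume i: "i \<in> idx X" and x: "x \<in> chart_img X i"
  have "((\<lambda>s. \<xi> s i x v - \<zeta> s i x v) has_real_derivative 0) (at s within T)" if "s \<in> T" for s
  proof -
    have "((\<lambda>s. \<xi> s i x v - \<zeta> s i x v) has_real_derivative
        time_deriv \<xi> s i x v - time_deriv \<zeta> s i x v) (at s)"
      by (intro DERIV_diff time_deriv_has_derivative[OF _ that i x] assms)
    then show ?thesis
      using form_eqD[OF assms(7)[OF that] i x] by (simp add: has_field_derivative_at_within)
  qed
  then obtain c where c: "\<And>s. s \<in> T \<Longrightarrow> \<xi> s i x v - \<zeta> s i x v = c"
    using has_field_derivative_zero_constant[OF assms(3), of "\<lambda>s. \<xi> s i x v - \<zeta> s i x v"] by blast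
  have "c = 0"
    using c[OF assms(4)] form_eqD[OF assms(6) i x, of v] by simp
  then show "\<xi> t i x v = \<zeta> t i x v"
    using c[OF assms(5)] by simp
qed

section \<open>The cylinder as a manifold\<close>

lemma second_countable_prod_topology:
  assumes "second_countable X" "second_countable Y"
  shows "second_countable (prod_topology X Y)"
proof -
  from assms(1)[unfolded second_countable_def] obtain B where B: "countable B" "\<forall>V\<in>B. openin X V"
    "\<forall>U x. openin X U \<and> x \<in> U \<longrightarrow> (\<exists>V\<in>B. x \<in> V \<and> V \<subseteq> U)"
    by (elim exE conjE)
  from assms(2)[unfolded second_countable_def] obtain C where C: "countable C" "\<forall>V\<in>C. openin Y V"
    "\<forall>U x. openin Y U \<and> x \<in> U \<longrightarrow> (\<exists>V\<in>C. x \<in> V \<and> V \<subseteq> U)"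
    by (elim exE conjE)
  show ?thesis
    unfolding second_countable_def
  proof (intro exI[of _ "(\<lambda>(U, V). U \<times> V) ` (B \<times> C)"] conjI ballI allI impI)
    show "countable ((\<lambda>(U, V). U \<times> V) ` (B \<times> C))"
      using B(1) C(1) by simp
    show "openin (prod_topology X Y) W" if "W \<in> (\<lambda>(U, V). U \<times> V) ` (B \<times> C)" for W
      using that B(2) C(2) by (auto simp: openin_prod_Times_iff)
    fix U p assume U: "openin (prod_topology X Y) U \<and> p \<in> U"
    obtain x y where p: "p = (x, y)" by (cases p)
    obtain V W where VW: "openin X V" "openin Y W" "x \<in> V" "y \<in> W" "V \<times> W \<subseteq> U"
      using U unfolding openin_prod_topology_alt p by blast
    obtain V' where V': "V' \<in> B" "x \<in> V'" "V' \<subseteq> V" using B(3) VW(1,3) by blast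
    obtain W' where W': "W' \<in> C" "y \<in> W'" "W' \<subseteq> W" using C(3) VW(2,4) by blast
    have "p \<in> V' \<times> W' \<and> V' \<times> W' \<subseteq> U"
      using V' W' VW(5) p by blast
    moreover have "V' \<times> W' \<in> (\<lambda>(U, V). U \<times> V) ` (B \<times> C)"
      using V'(1) W'(1) by blast
    ultimately show "\<exists>V\<in>(\<lambda>(U, V). U \<times> V) ` (B \<times> C). p \<in> V \<and> V \<subseteq> U"
      by (rule bexI)
  qed
qed

lemma second_countable_euclidean: "second_countable (euclidean :: 'a::second_countable_topology topology)"
proof -
  obtain B :: "'a set set" where B: "countable B" "topological_basis B"
    using ex_countable_basis by blast
  show ?thesis
    unfolding second_countable_def
  proof (intro exI[of _ B] conjI ballI allI impI)
    show "countable B" by (rule B(1))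
    show "openin euclidean V" if "V \<in> B" for V
      using topological_basis_open[OF B(2) that] by simp
    fix U :: "'a set" and x assume "openin euclidean U \<and> x \<in> U"
    then have "open U" "x \<in> U" by simp_all
    then obtain V where "V \<in> B" "x \<in> V" "V \<subseteq> U"
      using topological_basisE[OF B(2)] by metis
    then show "\<exists>V\<in>B. x \<in> V \<and> V \<subseteq> U" by blast
  qed
qed

lemma chart_img_cylinder: "chart_img (cylinder X T) i = chart_img X i \<times> T"
  by (simp add: chart_img_def cylinder_def map_prod_def image_paired_Times)

lemma idx_cylinder: "idx (cylinder X T) = idx X"
  by (simp add: cylinder_def)

lemma smooth_manifold_chart:
  assumes "smooth_manifold X" "i \<in> idx X"
  shows "openin (pts X) (chart_dom X i)" "open (chart_img X i)" "inj_on (chart_map X i) (chart_dom X i)"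
    "homeomorphic_map (subtopology (pts X) (chart_dom X i)) (top_of_set (chart_img X i)) (chart_map X i)"
    "j \<in> idx X \<Longrightarrow> smooth_on (chart_map X i ` (chart_dom X i \<inter> chart_dom X j)) (transition X i j)"
    "j \<in> idx X \<Longrightarrow> open (chart_map X i ` (chart_dom X i \<inter> chart_dom X j))"
proof -
  show o: "openin (pts X) (chart_dom X i)" "open (chart_img X i)"
    and h: "homeomorphic_map (subtopology (pts X) (chart_dom X i)) (top_of_set (chart_img X i)) (chart_map X i)"
    using assms by (simp_all add: smooth_manifold_def)
  have ts: "topspace (subtopology (pts X) (chart_dom X i)) = chart_dom X i"
    using openin_subset[OF o(1)] by auto
  show "inj_on (chart_map X i) (chart_dom X i)"
    using homeomorphic_imp_injective_map[OF h] unfolding ts .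
  show "smooth_on (chart_map X i ` (chart_dom X i \<inter> chart_dom X j)) (transition X i j)" if "j \<in> idx X"
    using assms that by (simp add: smooth_manifold_def)
  show "open (chart_map X i ` (chart_dom X i \<inter> chart_dom X j))" if "j \<in> idx X"
  proof -
    have "openin (pts X) (chart_dom X j)"
      using assms(1) that by (simp add: smooth_manifold_def)
    then have "openin (subtopology (pts X) (chart_dom X i)) (chart_dom X i \<inter> chart_dom X j)"
      by (rule openin_subtopology_Int2)
    then have "openin (top_of_set (chart_img X i)) (chart_map X i ` (chart_dom X i \<inter> chart_dom X j))"
      using homeomorphic_imp_open_map[OF h] unfolding open_map_def by blast
    then show ?thesis
      using o(2) openin_open_trans by blast
  qed
qed

lemma transition_chart_map:
  assumes "smooth_manifold X" "i \<in> idx X" "p \<in> chart_dom X i"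
  shows "transition X i j (chart_map X i p) = chart_map X j p"
  using inv_into_f_f[OF smooth_manifold_chart(3)[OF assms(1,2)] assms(3)] by (simp add: transition_def)

lemma transition_cylinder:
  assumes X: "smooth_manifold X" and i: "i \<in> idx X" and z: "z \<in> chart_img X i \<times> T"
  shows "transition (cylinder X T) i j z = (transition X i j (fst z), snd z)"
proof -
  obtain p t where p: "p \<in> chart_dom X i" "t \<in> T" "z = (chart_map X i p, t)"
    using z by (auto simp: chart_img_def)
  have "inj_on (map_prod (chart_map X i) id) (chart_dom X i \<times> T)"
    using smooth_manifold_chart(3)[OF X i] by (intro map_prod_inj_on) auto
  then have "inv_into (chart_dom X i \<times> T) (map_prod (chart_map X i) id) (map_prod (chart_map X i) id (p, t)) = (p, t)"
    by (rule inv_into_f_f) (use p in simp)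
  then show ?thesis
    using transition_chart_map[OF X i p(1)] by (simp add: transition_def cylinder_def p(3))
qed

lemma overlap_cylinder:
  "chart_map (cylinder X T) i ` (chart_dom (cylinder X T) i \<inter> chart_dom (cylinder X T) j)
    = chart_map X i ` (chart_dom X i \<inter> chart_dom X j) \<times> T"
  by (simp add: cylinder_def map_prod_def Times_Int_distrib1[symmetric] image_paired_Times)

lemma overlap_subset: "chart_map X i ` (chart_dom X i \<inter> chart_dom X j) \<subseteq> chart_img X i"
  by (auto simp: chart_img_def)

text \<open>The transition maps of the cylinder act as the identity on the time coordinate.\<close>

lemma frechet_derivative_transition_cylinder:
  fixes X :: "('m, 'e::euclidean_space, 'i) mfd"
  assumes X: "smooth_manifold X" and ij: "i \<in> idx X" "j \<in> idx X" and T: "open T" "t \<in> T"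
    and x: "x \<in> chart_map X i ` (chart_dom X i \<inter> chart_dom X j)"
  shows "frechet_derivative (transition (cylinder X T) i j) (at (x, t)) w
    = (frechet_derivative (transition X i j) (at x) (fst w), snd w)"
proof -
  let ?O = "chart_map X i ` (chart_dom X i \<inter> chart_dom X j)"
  note O = smooth_manifold_chart(5,6)[OF X ij]
  have "frechet_derivative (transition (cylinder X T) i j) (at (x, t))
      = frechet_derivative (\<lambda>z. (transition X i j (fst z), snd z)) (at (x, t))"
  proof (rule frechet_derivative_cong_open[OF open_Times[OF O(2) T(1)]])
    show "(x, t) \<in> ?O \<times> T" using x T(2) by simp
    show "transition (cylinder X T) i j z = (transition X i j (fst z), snd z)" if "z \<in> ?O \<times> T" for z
      using that overlap_subset[of X i j] by (intro transition_cylinder[OF X ij(1)]) auto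
  qed
  also have "\<dots> = (\<lambda>w. (frechet_derivative (transition X i j) (at x) (fst w), snd w))"
  proof (rule frechet_derivative_at[symmetric], intro has_derivative_Pair)
    have "((\<lambda>z. fst z) has_derivative (\<lambda>w. fst w)) (at (x, t))"
      by (intro has_derivative_fst has_derivative_ident)
    moreover have "(transition X i j has_derivative frechet_derivative (transition X i j) (at x)) (at (fst (x, t)))"
      using smooth_on_has_derivative[OF O(1) x] by simp
    ultimately show "((\<lambda>z. transition X i j (fst z)) has_derivative
        (\<lambda>w. frechet_derivative (transition X i j) (at x) (fst w))) (at (x, t))"
      by (rule has_derivative_compose)
    show "((\<lambda>z. snd z) has_derivative (\<lambda>w. snd w)) (at (x, t))"
      by (intro has_derivative_snd has_derivative_ident)
  qed
  finally show ?thesis by (rule fun_cong)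
qed

lemma smooth_manifold_cylinder:
  fixes X :: "('m, 'e::euclidean_space, 'i) mfd"
  assumes X: "smooth_manifold X" and T: "open T"
  shows "smooth_manifold (cylinder X T)"
  unfolding smooth_manifold_def idx_cylinder chart_img_cylinder
proof (intro conjI ballI)
  have X': "Hausdorff_space (pts X)" "second_countable (pts X)" "topspace (pts X) = (\<Union>i\<in>idx X. chart_dom X i)"
    using X by (simp_all add: smooth_manifold_def)
  show "Hausdorff_space (pts (cylinder X T))"
    using X'(1) by (simp add: cylinder_def Hausdorff_space_prod_topology Hausdorff_space_subtopology)
  show "second_countable (pts (cylinder X T))"
    using X'(2) by (simp add: cylinder_def second_countable_prod_topology second_countable_subtopology
        second_countable_euclidean)
  show "topspace (pts (cylinder X T)) = (\<Union>i\<in>idx X. chart_dom (cylinder X T) i)"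
    by (auto simp: cylinder_def X'(3))
next
  fix i assume i: "i \<in> idx X"
  note c = smooth_manifold_chart[OF X i]
  show "openin (pts (cylinder X T)) (chart_dom (cylinder X T) i)"
    using c(1) by (simp add: cylinder_def openin_prod_Times_iff)
  show "open (chart_img X i \<times> T)"
    using c(2) T by (rule open_Times)
  obtain g where g: "homeomorphic_maps (subtopology (pts X) (chart_dom X i)) (top_of_set (chart_img X i)) (chart_map X i) g"
    using c(4) homeomorphic_map_maps by blast
  have "homeomorphic_maps (top_of_set T) (top_of_set T) id id"
    by (simp add: homeomorphic_maps_id)
  with g have "homeomorphic_maps (prod_topology (subtopology (pts X) (chart_dom X i)) (top_of_set T))
      (prod_topology (top_of_set (chart_img X i)) (top_of_set T)) (\<lambda>(x, y). (chart_map X i x, id y)) (\<lambda>(x, y). (g x, id y))"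
    by (intro homeomorphic_maps_prod[THEN iffD2] disjI2 conjI)
  then have hom: "homeomorphic_map (prod_topology (subtopology (pts X) (chart_dom X i)) (top_of_set T))
      (prod_topology (top_of_set (chart_img X i)) (top_of_set T)) (\<lambda>(x, y). (chart_map X i x, id y))"
    unfolding homeomorphic_map_maps by blast
  have dom: "prod_topology (subtopology (pts X) (chart_dom X i)) (top_of_set T)
      = subtopology (pts (cylinder X T)) (chart_dom (cylinder X T) i)"
    by (simp add: cylinder_def subtopology_Times subtopology_subtopology)
  have img: "prod_topology (top_of_set (chart_img X i)) (top_of_set T) = top_of_set (chart_img X i \<times> T)"
    by simp
  have map: "(\<lambda>(x, y). (chart_map X i x, id y)) = chart_map (cylinder X T) i"
    by (simp add: cylinder_def map_prod_def)
  show "homeomorphic_map (subtopology (pts (cylinder X T)) (chart_dom (cylinder X T) i))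
      (top_of_set (chart_img X i \<times> T)) (chart_map (cylinder X T) i)"
    using hom unfolding dom img map .
next
  fix i j assume ij: "i \<in> idx X" "j \<in> idx X"
  let ?O = "chart_map X i ` (chart_dom X i \<inter> chart_dom X j)"
  note O = smooth_manifold_chart(5,6)[OF X ij]
  note op = open_Times[OF O(2) T]
  have "smooth_on (?O \<times> T) (\<lambda>z. (transition X i j (fst z), snd z))"
    by (intro smooth_on_Pair op smooth_on_fst[OF O(2) T] O(1) smooth_on_bounded_linear bounded_linear_snd)
  then show "smooth_on (chart_map (cylinder X T) i ` (chart_dom (cylinder X T) i \<inter> chart_dom (cylinder X T) j))
      (transition (cylinder X T) i j)"
    unfolding overlap_cylinder
  proof (rule smooth_on_cong[OF op, rotated])
    show "(transition X i j (fst z), snd z) = transition (cylinder X T) i j z" if "z \<in> ?O \<times> T" for z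
      using that overlap_subset[of X i j] by (intro transition_cylinder[OF X ij(1), symmetric]) auto
  qed
qed

section \<open>Global forms on the manifold and on the cylinder\<close>

lemma kform_smooth_form: "smooth_manifold X \<Longrightarrow> kform X k \<omega> \<Longrightarrow> smooth_form X k \<omega>"
  by (simp add: smooth_form_def kform_def smooth_manifold_chart(2))

lemma kformI:
  assumes "smooth_form X k \<omega>"
    "\<And>i j p v. i \<in> idx X \<Longrightarrow> j \<in> idx X \<Longrightarrow> p \<in> chart_dom X i \<inter> chart_dom X j \<Longrightarrow>
      \<omega> i (chart_map X i p) v
        = \<omega> j (chart_map X j p) (\<lambda>n. frechet_derivative (transition X i j) (at (chart_map X i p)) (v n))"
  shows "kform X k \<omega>"
  unfolding kform_def
proof (intro conjI ballI allI)
  fix i v assume i: "i \<in> idx X"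
  show "alternating k (\<omega> i x)" if "x \<in> chart_img X i" for x
    by (rule smooth_formD(2)[OF assms(1) i that])
  show "smooth_on (chart_img X i) (\<lambda>x. \<omega> i x v)"
    by (rule smooth_formD(3)[OF assms(1) i])
qed (rule assms(2))

lemma kform_pullback:
  "kform X k \<omega> \<Longrightarrow> i \<in> idx X \<Longrightarrow> j \<in> idx X \<Longrightarrow> p \<in> chart_dom X i \<inter> chart_dom X j \<Longrightarrow>
    \<omega> i (chart_map X i p) v
      = \<omega> j (chart_map X j p) (\<lambda>n. frechet_derivative (transition X i j) (at (chart_map X i p)) (v n))"
  unfolding kform_def by blast

lemma kform_wedge_1_1:
  assumes "smooth_manifold X" "kform X 1 \<alpha>" "kform X 1 \<beta>"
  shows "kform X 2 (wedge 1 1 \<alpha> \<beta>)"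
proof (rule kformI)
  show "smooth_form X 2 (wedge 1 1 \<alpha> \<beta>)"
    by (intro smooth_form_wedge_1_1 kform_smooth_form assms)
  show "wedge 1 1 \<alpha> \<beta> i (chart_map X i p) v
      = wedge 1 1 \<alpha> \<beta> j (chart_map X j p) (\<lambda>n. frechet_derivative (transition X i j) (at (chart_map X i p)) (v n))"
    if "i \<in> idx X" "j \<in> idx X" "p \<in> chart_dom X i \<inter> chart_dom X j" for i j p v
    unfolding wedge_def kform_pullback[OF assms(2) that] kform_pullback[OF assms(3) that] ..
qed

lemma kform_add:
  assumes "smooth_manifold X" "kform X k \<alpha>" "kform X k \<beta>"
  shows "kform X k (\<alpha> + \<beta>)"
proof (rule kformI)
  show "smooth_form X k (\<alpha> + \<beta>)"
    by (intro smooth_form_add kform_smooth_form assms)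
  show "(\<alpha> + \<beta>) i (chart_map X i p) v
      = (\<alpha> + \<beta>) j (chart_map X j p) (\<lambda>n. frechet_derivative (transition X i j) (at (chart_map X i p)) (v n))"
    if "i \<in> idx X" "j \<in> idx X" "p \<in> chart_dom X i \<inter> chart_dom X j" for i j p v
    unfolding plus_fun_apply kform_pullback[OF assms(2) that] kform_pullback[OF assms(3) that] ..
qed

lemma kform_scale:
  assumes "smooth_manifold X" "kform X k \<alpha>"
  shows "kform X k (c *\<^sub>F \<alpha>)"
proof (rule kformI)
  show "smooth_form X k (c *\<^sub>F \<alpha>)"
    by (intro smooth_form_scale kform_smooth_form assms)
  show "(c *\<^sub>F \<alpha>) i (chart_map X i p) v
      = (c *\<^sub>F \<alpha>) j (chart_map X j p) (\<lambda>n. frechet_derivative (transition X i j) (at (chart_map X i p)) (v n))"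
    if "i \<in> idx X" "j \<in> idx X" "p \<in> chart_dom X i \<inter> chart_dom X j" for i j p v
    unfolding scale_form_def kform_pullback[OF assms(2) that] ..
qed

lemma alternating_fst:
  assumes "alternating k f"
  shows "alternating k (\<lambda>v. f (\<lambda>n. fst (v n)))"
  unfolding alternating_def
proof (intro conjI allI impI)
  show "f (\<lambda>n. fst (v n)) = f (\<lambda>n. fst (w n))" if "\<forall>i<k. v i = w i" for v w :: "nat \<Rightarrow> 'a \<times> 'b"
    using that by (intro alternating_agree[OF assms]) simp
  show "linear (\<lambda>u. f (\<lambda>n. fst ((v(i := u)) n)))" if "i < k" for v :: "nat \<Rightarrow> 'a \<times> 'b" and i
  proof -
    have "(\<lambda>n. fst ((v(i := u)) n)) = (\<lambda>n. fst (v n))(i := fst u)" for u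
      by auto
    then show ?thesis
      using linear_compose[OF linear_fst alternatingD(1)[OF assms that, of "\<lambda>n. fst (v n)"]]
      by (simp add: o_def)
  qed
  show "f (\<lambda>n. fst (v n)) = 0" if "i < k" "j < k" "i \<noteq> j \<and> v i = v j" for v :: "nat \<Rightarrow> 'a \<times> 'b" and i j
    using that by (intro alternatingD(2)[OF assms, of i j]) simp_all
qed

lemma smooth_form_cyl_form:
  assumes "smooth_family X k T \<xi>"
  shows "smooth_form (cylinder X T) k (cyl_form \<xi>)"
  unfolding smooth_form_def idx_cylinder chart_img_cylinder
proof (intro ballI conjI allI)
  fix i v assume i: "i \<in> idx X"
  note a = smooth_coeffsD[OF smooth_familyD(1)[OF assms] i]
  show "open (chart_img X i \<times> T)" using a by (intro open_Times)
  show "alternating k (cyl_form \<xi> i z)" if "z \<in> chart_img X i \<times> T" for z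
    using alternating_fst[OF smooth_familyD(2)[OF assms _ i]] that by (auto simp: cyl_form_def)
  show "smooth_on (chart_img X i \<times> T) (\<lambda>z. cyl_form \<xi> i z v)"
    using a(3)[of "\<lambda>n. fst (v n)"] by (simp add: cyl_form_def case_prod_unfold)
qed

lemma smooth_form_cyl_dt:
  fixes X :: "('m, 'e::euclidean_space, 'i) mfd"
  assumes "smooth_manifold X" "open T"
  shows "smooth_form (cylinder X T) 1 cyl_dt"
  unfolding smooth_form_def idx_cylinder chart_img_cylinder
  using assms by (auto simp: cyl_dt_def smooth_on_const open_Times smooth_manifold_chart(2)
      intro: alternating_1I[where g = snd] linear_snd)

lemma chart_map_cylinder: "chart_map (cylinder X T) i (p, t) = (chart_map X i p, t)"
  by (simp add: cylinder_def)

lemma chart_dom_cylinder: "chart_dom (cylinder X T) i = chart_dom X i \<times> T"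
  by (simp add: cylinder_def)

lemma kform_cyl_form:
  fixes X :: "('m, 'e::euclidean_space, 'i) mfd"
  assumes X: "smooth_manifold X" and \<xi>: "smooth_family X k T \<xi>" and k: "\<And>t. t \<in> T \<Longrightarrow> kform X k (\<xi> t)"
  shows "kform (cylinder X T) k (cyl_form \<xi>)"
proof (rule kformI[OF smooth_form_cyl_form[OF \<xi>]], unfold idx_cylinder)
  fix i j p v assume ij: "i \<in> idx X" "j \<in> idx X"
    and p: "p \<in> chart_dom (cylinder X T) i \<inter> chart_dom (cylinder X T) j"
  obtain q t where q: "p = (q, t)" "t \<in> T" "q \<in> chart_dom X i \<inter> chart_dom X j"
    using p by (auto simp: chart_dom_cylinder)
  have "open T" using \<xi> by (simp add: smooth_family_def smooth_coeffs_def)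
  then show "cyl_form \<xi> i (chart_map (cylinder X T) i p) v
      = cyl_form \<xi> j (chart_map (cylinder X T) j p)
        (\<lambda>n. frechet_derivative (transition (cylinder X T) i j) (at (chart_map (cylinder X T) i p)) (v n))"
    using kform_pullback[OF k[OF q(2)] ij q(3)] q
    by (simp add: chart_map_cylinder cyl_form_def frechet_derivative_transition_cylinder[OF X ij])
qed

lemma kform_cyl_dt:
  fixes X :: "('m, 'e::euclidean_space, 'i) mfd"
  assumes X: "smooth_manifold X" and T: "open T"
  shows "kform (cylinder X T) 1 cyl_dt"
proof (rule kformI[OF smooth_form_cyl_dt[OF assms]], unfold idx_cylinder)
  fix i j p v assume ij: "i \<in> idx X" "j \<in> idx X"
    and p: "p \<in> chart_dom (cylinder X T) i \<inter> chart_dom (cylinder X T) j"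
  obtain q t where q: "p = (q, t)" "t \<in> T" "q \<in> chart_dom X i \<inter> chart_dom X j"
    using p by (auto simp: chart_dom_cylinder)
  then show "cyl_dt i (chart_map (cylinder X T) i p) v
      = cyl_dt j (chart_map (cylinder X T) j p)
        (\<lambda>n. frechet_derivative (transition (cylinder X T) i j) (at (chart_map (cylinder X T) i p)) (v n))"
    by (simp add: chart_map_cylinder cyl_dt_def frechet_derivative_transition_cylinder[OF X ij T])
qed

text \<open>Lets the local coframe required of an \<open>SU(2)\<close>-structure be a global one.\<close>

lemma restrict_topspace:
  assumes "smooth_manifold X"
  shows "coframe (restrict_mfd X (topspace (pts X))) A e \<longleftrightarrow> coframe X A e"
    and "form_eq \<alpha> (restrict_mfd X (topspace (pts X))) \<beta> \<longleftrightarrow> form_eq \<alpha> X \<beta>"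
proof -
  let ?R = "restrict_mfd X (topspace (pts X))"
  have "chart_dom X i \<subseteq> topspace (pts X)" if "i \<in> idx X" for i
    using openin_subset[OF smooth_manifold_chart(1)[OF assms that]] .
  then have d: "chart_dom ?R i = chart_dom X i" if "i \<in> idx X" for i
    using that by (auto simp: restrict_mfd_def)
  have ix: "idx ?R = idx X" "chart_map ?R = chart_map X"
    by (simp_all add: restrict_mfd_def)
  have im: "chart_img ?R i = chart_img X i" if "i \<in> idx X" for i
    using d[OF that] by (simp add: chart_img_def ix)
  have tr: "transition ?R i j = transition X i j" if "i \<in> idx X" for i j
    using d[OF that] by (simp add: transition_def ix)
  have "kform ?R k \<omega> \<longleftrightarrow> kform X k \<omega>" for k \<omega>
    unfolding kform_def ix by (simp add: d im tr cong: ball_cong)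
  then show "coframe ?R A e \<longleftrightarrow> coframe X A e"
    unfolding coframe_def ix by (simp add: im cong: ball_cong)
  show "form_eq \<alpha> ?R \<beta> \<longleftrightarrow> form_eq \<alpha> X \<beta>"
    unfolding form_eq_def ix by (simp add: im cong: ball_cong)
qed

section \<open>Wedge identities\<close>

lemma form_eq_refl: "\<alpha> \<doteq>\<^bsub>X\<^esub> \<alpha>"
  by (simp add: form_eq_def)

lemma form_eq_sym: "\<alpha> \<doteq>\<^bsub>X\<^esub> \<beta> \<Longrightarrow> \<beta> \<doteq>\<^bsub>X\<^esub> \<alpha>"
  by (simp add: form_eq_def)

lemma form_eq_trans: "\<alpha> \<doteq>\<^bsub>X\<^esub> \<beta> \<Longrightarrow> \<beta> \<doteq>\<^bsub>X\<^esub> \<gamma> \<Longrightarrow> \<alpha> \<doteq>\<^bsub>X\<^esub> \<gamma>"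
  by (simp add: form_eq_def)

lemma form_eq_cong: "\<alpha> \<doteq>\<^bsub>X\<^esub> \<alpha>' \<Longrightarrow> \<beta> \<doteq>\<^bsub>X\<^esub> \<beta>' \<Longrightarrow> \<alpha> \<doteq>\<^bsub>X\<^esub> \<beta> \<longleftrightarrow> \<alpha>' \<doteq>\<^bsub>X\<^esub> \<beta>'"
  by (simp add: form_eq_def)

lemma wedge_cong:
  assumes "\<And>u. \<alpha> i x u = \<alpha>' i x u" "\<And>u. \<beta> i x u = \<beta>' i x u"
  shows "wedge k l \<alpha> \<beta> i x v = wedge k l \<alpha>' \<beta>' i x v"
  by (simp only: wedge_def assms)

lemma wedge_scale_right: "wedge k l \<alpha> (c *\<^sub>F \<beta>) = c *\<^sub>F wedge k l \<alpha> \<beta>"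
  by (simp add: wedge_def scale_form_def sum_distrib_left mult_ac)

lemma wedge_1_1_swap:
  assumes "alternating 1 (\<alpha> i x)" "alternating 1 (\<beta> i x)"
  shows "wedge 1 1 \<alpha> \<beta> i x v = - wedge 1 1 \<beta> \<alpha> i x v"
  unfolding wedge_1_1[of \<alpha> i x \<beta>, OF assms] wedge_1_1[of \<beta> i x \<alpha>, OF assms(2,1)] by simp

lemma wedge_repeated:
  assumes "alternating 1 (\<alpha> i x)" "alternating 1 (\<beta> i x)"
  shows "wedge 1 2 \<alpha> (wedge 1 1 \<alpha> \<beta>) i x v = 0" "wedge 1 2 \<alpha> (wedge 1 1 \<beta> \<alpha>) i x v = 0"
    "wedge 2 1 (wedge 1 1 \<alpha> \<beta>) \<alpha> i x v = 0" "wedge 2 1 (wedge 1 1 \<beta> \<alpha>) \<alpha> i x v = 0"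
proof -
  note w = wedge_1_1[of \<alpha> i x \<beta>, OF assms] wedge_1_1[of \<beta> i x \<alpha>, OF assms(2,1)]
  note a = alternating_wedge_1_1[of \<alpha> i x \<beta>, OF assms] alternating_wedge_1_1[of \<beta> i x \<alpha>, OF assms(2,1)]
  show "wedge 1 2 \<alpha> (wedge 1 1 \<alpha> \<beta>) i x v = 0"
    unfolding wedge_1_2[of \<alpha> i x "wedge 1 1 \<alpha> \<beta>", OF assms(1) a(1)] w vec2_simps by (simp add: algebra_simps)
  show "wedge 1 2 \<alpha> (wedge 1 1 \<beta> \<alpha>) i x v = 0"
    unfolding wedge_1_2[of \<alpha> i x "wedge 1 1 \<beta> \<alpha>", OF assms(1) a(2)] w vec2_simps by (simp add: algebra_simps)
  show "wedge 2 1 (wedge 1 1 \<alpha> \<beta>) \<alpha> i x v = 0"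
    unfolding wedge_2_1[of "wedge 1 1 \<alpha> \<beta>" i x \<alpha>, OF a(1) assms(1)] w vec2_simps by (simp add: algebra_simps)
  show "wedge 2 1 (wedge 1 1 \<beta> \<alpha>) \<alpha> i x v = 0"
    unfolding wedge_2_1[of "wedge 1 1 \<beta> \<alpha>" i x \<alpha>, OF a(2) assms(1)] w vec2_simps by (simp add: algebra_simps)
qed

section \<open>Exterior derivatives on the cylinder\<close>

lemma cyl_form_apply: "cyl_form \<xi> i (x, t) v = \<xi> t i x (\<lambda>n. fst (v n))"
  by (simp add: cyl_form_def)

lemma cyl_dt_apply: "cyl_dt i z v = snd (v 0)"
  by (simp add: cyl_dt_def)

lemma cyl_form_wedge: "cyl_form (\<lambda>t. wedge k l (\<xi> t) (\<zeta> t)) = wedge k l (cyl_form \<xi>) (cyl_form \<zeta>)"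
  by (simp add: fun_eq_iff cyl_form_def wedge_def)

lemma cyl_form_scale: "cyl_form (\<lambda>t. c *\<^sub>F \<xi> t) = c *\<^sub>F cyl_form \<xi>"
  by (simp add: fun_eq_iff cyl_form_def scale_form_def)

lemma cyl_form_add: "cyl_form (\<lambda>t. \<xi> t + \<zeta> t) = cyl_form \<xi> + cyl_form \<zeta>"
  by (simp add: fun_eq_iff cyl_form_def)

lemma scale_form_add: "c *\<^sub>F (\<alpha> + \<beta>) = c *\<^sub>F \<alpha> + c *\<^sub>F \<beta>"
  by (simp add: fun_eq_iff scale_form_def distrib_left)

lemma alternating_1_cyl_dt: "alternating 1 (cyl_dt i z)"
  by (rule alternating_1I[where g = snd]) (simp_all add: cyl_dt_def linear_snd)

lemma alternating_cyl_form:
  assumes "smooth_family X k T \<xi>" "t \<in> T" "i \<in> idx X" "x \<in> chart_img X i"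
  shows "alternating k (cyl_form \<xi> i (x, t))"
  using alternating_fst[OF smooth_familyD(2)[OF assms]] by (simp add: cyl_form_def)

lemma cyl_form_eqI:
  assumes "\<And>i x t v. i \<in> idx X \<Longrightarrow> x \<in> chart_img X i \<Longrightarrow> t \<in> T \<Longrightarrow> \<alpha> i (x, t) v = \<beta> i (x, t) v"
  shows "\<alpha> \<doteq>\<^bsub>cylinder X T\<^esub> \<beta>"
  using assms unfolding form_eq_def idx_cylinder chart_img_cylinder by blast

lemma cyl_form_eqD:
  assumes "\<alpha> \<doteq>\<^bsub>cylinder X T\<^esub> \<beta>" "i \<in> idx X" "x \<in> chart_img X i" "t \<in> T"
  shows "\<alpha> i (x, t) v = \<beta> i (x, t) v"
  by (rule form_eqD[OF assms(1)]) (use assms in \<open>simp_all add: idx_cylinder chart_img_cylinder\<close>)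

text \<open>A vector on the cylinder has a space and a time part, and the derivative is the sum of the
  contributions of both. The time parts give the \<open>dt\<close> terms in the next two lemmas.\<close>

lemma frechet_derivative_cyl_form:
  fixes X :: "('m, 'e::euclidean_space, 'i) mfd"
  assumes "smooth_family X k T \<xi>" "i \<in> idx X" "x \<in> chart_img X i" "t \<in> T"
  shows "frechet_derivative (\<lambda>z. cyl_form \<xi> i z v) (at (x, t)) w
    = frechet_derivative (\<lambda>y. \<xi> t i y (\<lambda>n. fst (v n))) (at x) (fst w)
      + snd w * time_deriv \<xi> t i x (\<lambda>n. fst (v n))"
  using frechet_derivative_split[OF smooth_coeffsD(3)[OF smooth_familyD(1)[OF assms(1)] assms(2)] assms(3,4),
      of "\<lambda>n. fst (v n)" w]
  by (simp add: cyl_form_def time_deriv_def case_prod_unfold)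

text \<open>The sign of the time derivative comes from moving \<open>dt\<close> behind a 1-form: \<open>dt \<and> \<beta> = - \<beta> \<and> dt\<close>.\<close>

lemma ext_d_cyl_form_1:
  fixes X :: "('m, 'e::euclidean_space, 'i) mfd"
  assumes \<xi>: "smooth_family X 1 T \<xi>"
  shows "ext_d 1 (cyl_form \<xi>) \<doteq>\<^bsub>cylinder X T\<^esub>
    cyl_form (\<lambda>t. ext_d 1 (\<xi> t)) + wedge 1 1 (cyl_form (\<lambda>t. (-1) *\<^sub>F time_deriv \<xi> t)) cyl_dt"
proof (rule cyl_form_eqI)
  fix i x t v assume i: "i \<in> idx X" and x: "x \<in> chart_img X i" and t: "t \<in> T"
  have z: "i \<in> idx (cylinder X T)" "(x, t) \<in> chart_img (cylinder X T) i"
    using i x t by (simp_all add: idx_cylinder chart_img_cylinder)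
  have alt: "alternating 1 (cyl_form (\<lambda>t. (-1) *\<^sub>F time_deriv \<xi> t) i (x, t))"
    by (rule alternating_cyl_form[OF smooth_family_scale[OF smooth_family_time_deriv[OF \<xi>]] t i x])
  show "ext_d 1 (cyl_form \<xi>) i (x, t) v = (cyl_form (\<lambda>t. ext_d 1 (\<xi> t))
      + wedge 1 1 (cyl_form (\<lambda>t. (-1) *\<^sub>F time_deriv \<xi> t)) cyl_dt) i (x, t) v"
    unfolding plus_fun_apply ext_d_1[OF z smooth_form_cyl_form[OF \<xi>]]
      frechet_derivative_cyl_form[OF \<xi> i x t] cyl_form_apply ext_d_1[OF i x smooth_family_at[OF \<xi> t]]
      wedge_1_1[of "cyl_form (\<lambda>t. (-1) *\<^sub>F time_deriv \<xi> t)" i "(x, t)" cyl_dt, OF alt alternating_1_cyl_dt]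
      cyl_dt_apply
    by (simp add: scale_form_def algebra_simps)
qed

lemma ext_d_cyl_form_2:
  fixes X :: "('m, 'e::euclidean_space, 'i) mfd"
  assumes \<xi>: "smooth_family X 2 T \<xi>"
  shows "ext_d 2 (cyl_form \<xi>) \<doteq>\<^bsub>cylinder X T\<^esub>
    cyl_form (\<lambda>t. ext_d 2 (\<xi> t)) + wedge 2 1 (cyl_form (time_deriv \<xi>)) cyl_dt"
proof (rule cyl_form_eqI)
  fix i x t v assume i: "i \<in> idx X" and x: "x \<in> chart_img X i" and t: "t \<in> T"
  have z: "i \<in> idx (cylinder X T)" "(x, t) \<in> chart_img (cylinder X T) i"
    using i x t by (simp_all add: idx_cylinder chart_img_cylinder)
  have alt: "alternating 2 (cyl_form (time_deriv \<xi>) i (x, t))"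
    by (rule alternating_cyl_form[OF smooth_family_time_deriv[OF \<xi>] t i x])
  have vec2_fst: "(\<lambda>n. fst (vec2 p q n)) = vec2 (fst p) (fst q)" for p q :: "'e \<times> real"
    by (auto simp: vec2_def)
  show "ext_d 2 (cyl_form \<xi>) i (x, t) v = (cyl_form (\<lambda>t. ext_d 2 (\<xi> t))
      + wedge 2 1 (cyl_form (time_deriv \<xi>)) cyl_dt) i (x, t) v"
    unfolding plus_fun_apply ext_d_2[OF z smooth_form_cyl_form[OF \<xi>]]
      frechet_derivative_cyl_form[OF \<xi> i x t] cyl_form_apply ext_d_2[OF i x smooth_family_at[OF \<xi> t]]
      wedge_2_1[of "cyl_form (time_deriv \<xi>)" i "(x, t)" cyl_dt, OF alt alternating_1_cyl_dt]
      cyl_dt_apply vec2_fst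
    by (simp add: algebra_simps)
qed

text \<open>The Leibniz rule with \<open>dt\<close> closed; the time derivative of \<open>\<xi>\<close> drops out since \<open>dt \<and> dt = 0\<close>.\<close>

lemma ext_d_wedge_cyl_dt:
  fixes X :: "('m, 'e::euclidean_space, 'i) mfd"
  assumes X: "smooth_manifold X" and T: "open T" and \<xi>: "smooth_family X 1 T \<xi>"
  shows "ext_d 2 (wedge 1 1 (cyl_form \<xi>) cyl_dt) \<doteq>\<^bsub>cylinder X T\<^esub>
    wedge 2 1 (cyl_form (\<lambda>t. ext_d 1 (\<xi> t))) cyl_dt"
proof (rule cyl_form_eqI)
  fix i x t v assume i: "i \<in> idx X" and x: "x \<in> chart_img X i" and t: "t \<in> T"
  let ?\<beta> = "cyl_form (\<lambda>t. (-1) *\<^sub>F time_deriv \<xi> t)"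
  have alt: "alternating 1 (?\<beta> i (x, t))"
    by (rule alternating_cyl_form[OF smooth_family_scale[OF smooth_family_time_deriv[OF \<xi>]] t i x])
  have "ext_d 1 cyl_dt i (x, t) u = 0" for u :: "nat \<Rightarrow> 'e \<times> real"
    by (simp add: ext_d_def cyl_dt_def)
  then have "wedge 1 2 (cyl_form \<xi>) (ext_d 1 cyl_dt) i (x, t) v = 0"
    by (simp add: wedge_def)
  then have "ext_d 2 (wedge 1 1 (cyl_form \<xi>) cyl_dt) i (x, t) v
      = wedge 2 1 (ext_d 1 (cyl_form \<xi>)) cyl_dt i (x, t) v"
    using cyl_form_eqD[OF ext_d_wedge_1_1[OF smooth_form_cyl_form[OF \<xi>] smooth_form_cyl_dt[OF X T]] i x t, of v]
    by simp
  also have "\<dots> = wedge 2 1 (cyl_form (\<lambda>t. ext_d 1 (\<xi> t)) + wedge 1 1 ?\<beta> cyl_dt) cyl_dt i (x, t) v"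
    by (rule wedge_cong) (rule cyl_form_eqD[OF ext_d_cyl_form_1[OF \<xi>] i x t] refl)+
  also have "\<dots> = wedge 2 1 (cyl_form (\<lambda>t. ext_d 1 (\<xi> t))) cyl_dt i (x, t) v"
    using wedge_repeated(4)[of cyl_dt i "(x, t)" ?\<beta> v, OF alternating_1_cyl_dt alt] by (simp add: wedge_add_left)
  finally show "ext_d 2 (wedge 1 1 (cyl_form \<xi>) cyl_dt) i (x, t) v
      = wedge 2 1 (cyl_form (\<lambda>t. ext_d 1 (\<xi> t))) cyl_dt i (x, t) v" .
qed

text \<open>Vectors without time part see only \<open>A\<close>; inserting the unit time vector as the last argument
  then isolates \<open>B\<close>.\<close>

lemma cyl_form_decomposition_unique:
  fixes X :: "('m, 'e::euclidean_space, 'i) mfd"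
  assumes k: "k = 1 \<or> k = 2"
    and B: "\<And>t i x. t \<in> T \<Longrightarrow> i \<in> idx X \<Longrightarrow> x \<in> chart_img X i \<Longrightarrow> alternating k (B t i x)"
    and B': "\<And>t i x. t \<in> T \<Longrightarrow> i \<in> idx X \<Longrightarrow> x \<in> chart_img X i \<Longrightarrow> alternating k (B' t i x)"
  shows "cyl_form A + wedge k 1 (cyl_form B) cyl_dt \<doteq>\<^bsub>cylinder X T\<^esub>
      cyl_form A' + wedge k 1 (cyl_form B') cyl_dt
    \<longleftrightarrow> (\<forall>t\<in>T. A t \<doteq>\<^bsub>X\<^esub> A' t \<and> B t \<doteq>\<^bsub>X\<^esub> B' t)" (is "?L \<longleftrightarrow> ?R")
proof
  assume R: ?R
  show ?L
  proof (rule cyl_form_eqI)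
    fix i x t v assume i: "i \<in> idx X" and x: "x \<in> chart_img X i" and t: "t \<in> T"
    have A: "A t i x u = A' t i x u" and B: "B t i x u = B' t i x u" for u
      using form_eqD[OF conjunct1[OF bspec[OF R t]] i x] form_eqD[OF conjunct2[OF bspec[OF R t]] i x] by simp_all
    have "wedge k 1 (cyl_form B) cyl_dt i (x, t) v = wedge k 1 (cyl_form B') cyl_dt i (x, t) v"
      by (rule wedge_cong) (simp_all only: cyl_form_apply B)
    then show "(cyl_form A + wedge k 1 (cyl_form B) cyl_dt) i (x, t) v
        = (cyl_form A' + wedge k 1 (cyl_form B') cyl_dt) i (x, t) v"
      by (simp only: plus_fun_apply cyl_form_apply A)
  qed
next
  assume L: ?L
  show ?R
  proof (rule ballI, rule conjI)
    fix t assume t: "t \<in> T"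
    have eq: "A t i x (\<lambda>n. fst (v n)) + wedge k 1 (cyl_form B) cyl_dt i (x, t) v
        = A' t i x (\<lambda>n. fst (v n)) + wedge k 1 (cyl_form B') cyl_dt i (x, t) v"
      if "i \<in> idx X" "x \<in> chart_img X i" for i x v
      using cyl_form_eqD[OF L that t] by (simp only: plus_fun_apply cyl_form_apply)
    show AA: "A t \<doteq>\<^bsub>X\<^esub> A' t"
    proof (rule form_eqI)
      fix i x and v :: "nat \<Rightarrow> 'e" assume i: "i \<in> idx X" and x: "x \<in> chart_img X i"
      have "wedge k 1 \<beta> cyl_dt i (x, t) (\<lambda>n. (v n, 0)) = 0" for \<beta>
        by (simp add: wedge_def cyl_dt_def)
      then show "A t i x v = A' t i x v"
        using eq[OF i x, of "\<lambda>n. (v n, 0)"] by simp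
    qed
    show "B t \<doteq>\<^bsub>X\<^esub> B' t"
    proof (rule form_eqI)
      fix i x and v :: "nat \<Rightarrow> 'e" assume i: "i \<in> idx X" and x: "x \<in> chart_img X i"
      define w where "w = (\<lambda>n. if n < k then (v n, 0) else (0, 1 :: real))"
      have ev: "wedge k 1 (cyl_form C) cyl_dt i (x, t) w = C t i x v" if C: "alternating k (C t i x)" for C
      proof -
        have Cc: "alternating k (cyl_form C i (x, t))"
          using alternating_fst[OF C] by (simp add: cyl_form_def)
        from k show ?thesis
        proof
          assume k1: "k = 1"
          have "C t i x v = C t i x (\<lambda>_. v 0)"
            by (rule alternating_1[OF C[unfolded k1]])
          then show ?thesis
            unfolding k1 wedge_1_1[of "cyl_form C" i "(x, t)" cyl_dt, OF Cc[unfolded k1] alternating_1_cyl_dt]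
            by (simp add: cyl_form_apply cyl_dt_apply w_def k1)
        next
          assume k2: "k = 2"
          have "C t i x v = C t i x (vec2 (v 0) (v 1))"
            by (rule alternating_2[OF C[unfolded k2]])
          moreover have "(\<lambda>n. fst (vec2 (v 0, 0::real) (v 1, 0) n)) = vec2 (v 0) (v 1)"
            by (auto simp: vec2_def)
          ultimately show ?thesis
            unfolding k2 wedge_2_1[of "cyl_form C" i "(x, t)" cyl_dt, OF Cc[unfolded k2] alternating_1_cyl_dt]
            by (simp add: cyl_form_apply cyl_dt_apply w_def k2)
        qed
      qed
      show "B t i x v = B' t i x v"
        using eq[OF i x, of w] form_eqD[OF AA i x, of "\<lambda>n. fst (w n)"]
        by (simp only: ev[of B, OF B[OF t i x]] ev[of B', OF B'[OF t i x]] add_left_cancel)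
    qed
  qed
qed

lemma ext_d_1_cyl_eq_iff:
  fixes X :: "('m, 'e::euclidean_space, 'i) mfd"
  assumes \<xi>: "smooth_family X 1 T \<xi>" and \<beta>: "smooth_family X 1 T \<beta>"
  shows "ext_d 1 (cyl_form \<xi>) \<doteq>\<^bsub>cylinder X T\<^esub> c *\<^sub>F (cyl_form A + wedge 1 1 (cyl_form \<beta>) cyl_dt)
    \<longleftrightarrow> (\<forall>t\<in>T. ext_d 1 (\<xi> t) \<doteq>\<^bsub>X\<^esub> c *\<^sub>F A t \<and> (-1) *\<^sub>F time_deriv \<xi> t \<doteq>\<^bsub>X\<^esub> c *\<^sub>F \<beta> t)"
proof -
  have "c *\<^sub>F (cyl_form A + wedge 1 1 (cyl_form \<beta>) cyl_dt)
      = cyl_form (\<lambda>t. c *\<^sub>F A t) + wedge 1 1 (cyl_form (\<lambda>t. c *\<^sub>F \<beta> t)) cyl_dt"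
    by (simp only: scale_form_add cyl_form_scale wedge_scale_left)
  then show ?thesis
    unfolding form_eq_cong[OF ext_d_cyl_form_1[OF \<xi>] form_eq_refl]
    using cyl_form_decomposition_unique[of 1 T X "\<lambda>t. (-1) *\<^sub>F time_deriv \<xi> t" "\<lambda>t. c *\<^sub>F \<beta> t"
        "\<lambda>t. ext_d 1 (\<xi> t)" "\<lambda>t. c *\<^sub>F A t",
        OF _ smooth_familyD(2)[OF smooth_family_scale[OF smooth_family_time_deriv[OF \<xi>]]]
         smooth_familyD(2)[OF smooth_family_scale[OF \<beta>]]] by simp
qed

lemma ext_d_2_cyl_eq_iff:
  fixes X :: "('m, 'e::euclidean_space, 'i) mfd"
  assumes X: "smooth_manifold X" and T: "open T" and A: "smooth_family X 2 T A"
    and f: "smooth_family X 1 T \<alpha>" "smooth_family X 1 T \<beta>" "smooth_family X 1 T \<epsilon>"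
  shows "ext_d 2 (cyl_form A + wedge 1 1 (cyl_form \<beta>) cyl_dt) \<doteq>\<^bsub>cylinder X T\<^esub>
      c *\<^sub>F wedge 1 2 (cyl_form \<alpha>) (cyl_form B + wedge 1 1 (cyl_form \<epsilon>) cyl_dt)
    \<longleftrightarrow> (\<forall>t\<in>T. ext_d 2 (A t) \<doteq>\<^bsub>X\<^esub> c *\<^sub>F wedge 1 2 (\<alpha> t) (B t)
        \<and> time_deriv A t + ext_d 1 (\<beta> t) \<doteq>\<^bsub>X\<^esub> c *\<^sub>F wedge 1 1 (\<alpha> t) (\<epsilon> t))"
proof -
  have s: "smooth_form (cylinder X T) 2 (wedge 1 1 (cyl_form \<beta>) cyl_dt)"
    by (intro smooth_form_wedge_1_1 smooth_form_cyl_form smooth_form_cyl_dt f X T)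
  have "ext_d 2 (cyl_form A + wedge 1 1 (cyl_form \<beta>) cyl_dt) \<doteq>\<^bsub>cylinder X T\<^esub>
      ext_d 2 (cyl_form A) + ext_d 2 (wedge 1 1 (cyl_form \<beta>) cyl_dt)"
    by (rule ext_d_add[OF smooth_form_cyl_form[OF A] s])
  then have L: "ext_d 2 (cyl_form A + wedge 1 1 (cyl_form \<beta>) cyl_dt) \<doteq>\<^bsub>cylinder X T\<^esub>
      cyl_form (\<lambda>t. ext_d 2 (A t)) + wedge 2 1 (cyl_form (\<lambda>t. time_deriv A t + ext_d 1 (\<beta> t))) cyl_dt"
    using ext_d_cyl_form_2[OF A] ext_d_wedge_cyl_dt[OF X T f(2)]
    by (simp add: form_eq_def cyl_form_add wedge_add_left)
  have R: "c *\<^sub>F wedge 1 2 (cyl_form \<alpha>) (cyl_form B + wedge 1 1 (cyl_form \<epsilon>) cyl_dt) \<doteq>\<^bsub>cylinder X T\<^esub>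
      cyl_form (\<lambda>t. c *\<^sub>F wedge 1 2 (\<alpha> t) (B t)) + wedge 2 1 (cyl_form (\<lambda>t. c *\<^sub>F wedge 1 1 (\<alpha> t) (\<epsilon> t))) cyl_dt"
  proof (rule cyl_form_eqI)
    fix i x t v assume i: "i \<in> idx X" and x: "x \<in> chart_img X i" and t: "t \<in> T"
    have "wedge 1 2 (cyl_form \<alpha>) (wedge 1 1 (cyl_form \<epsilon>) cyl_dt) i (x, t) v
        = wedge 2 1 (wedge 1 1 (cyl_form \<alpha>) (cyl_form \<epsilon>)) cyl_dt i (x, t) v"
      by (rule wedge_assoc[of "cyl_form \<alpha>" i "(x, t)" "cyl_form \<epsilon>" cyl_dt,
            OF alternating_cyl_form[OF f(1) t i x] alternating_cyl_form[OF f(3) t i x] alternating_1_cyl_dt])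
    then show "(c *\<^sub>F wedge 1 2 (cyl_form \<alpha>) (cyl_form B + wedge 1 1 (cyl_form \<epsilon>) cyl_dt)) i (x, t) v
      = (cyl_form (\<lambda>t. c *\<^sub>F wedge 1 2 (\<alpha> t) (B t))
        + wedge 2 1 (cyl_form (\<lambda>t. c *\<^sub>F wedge 1 1 (\<alpha> t) (\<epsilon> t))) cyl_dt) i (x, t) v"
      unfolding cyl_form_scale cyl_form_wedge wedge_scale_left wedge_add_right scale_form_add
      by (simp add: scale_form_def)
  qed
  have alt: "alternating 2 ((time_deriv A t + ext_d 1 (\<beta> t)) i x)"
    if "t \<in> T" "i \<in> idx X" "x \<in> chart_img X i" for t i x
    by (rule smooth_form_alternating[OF that(2,3)])
      (intro smooth_form_add smooth_form_ext_d_1 smooth_family_at[OF _ that(1)] smooth_family_time_deriv A f)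
  show ?thesis
    unfolding form_eq_cong[OF L R]
    by (rule cyl_form_decomposition_unique[OF _ alt
        smooth_familyD(2)[OF smooth_family_scale[OF smooth_family_wedge_1_1[OF f(1,3)]]]]) simp
qed

section \<open>The Einstein-Sasaki equations of the cylinder\<close>

lemma id_structure_family_smooth:
  fixes X :: "('m, 'e::euclidean_space, 'i) mfd"
  assumes X: "smooth_manifold X" and T: "open T" and \<eta>: "id_structure_family X T \<eta>" and a: "a \<in> {0..3}"
  shows "smooth_family X 1 T (\<lambda>t. \<eta> t a)" "t \<in> T \<Longrightarrow> kform X 1 (\<eta> t a)"
proof -
  show k: "kform X 1 (\<eta> t a)" if "t \<in> T" for t
    using \<eta> a that by (simp add: id_structure_family_def coframe_def)
  show "smooth_family X 1 T (\<lambda>t. \<eta> t a)"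
    unfolding smooth_family_def smooth_coeffs_def
    using T \<eta> a smooth_manifold_chart(2)[OF X] smooth_formD(2)[OF kform_smooth_form[OF X k]]
    by (simp add: id_structure_family_def)
qed

text \<open>Setting \<open>e\<^sup>2 = dt\<close>, the terms of \<open>\<omega>\<^sub>1\<close>, \<open>\<omega>\<^sub>2\<close>, \<open>\<omega>\<^sub>3\<close> that contain \<open>dt\<close> have to be \<open>e\<^sup>1\<^sup>2\<close>, \<open>e\<^sup>4\<^sup>2\<close>
  and \<open>e\<^sup>2\<^sup>3\<close>, from which the other members and the sign are read off.\<close>

definition cyl_coframe :: "(real \<Rightarrow> nat \<Rightarrow> ('i, 'e) form) \<Rightarrow> nat \<Rightarrow> ('i, 'e \<times> real) form" where
  "cyl_coframe \<eta> a = (if a = 1 then cyl_form (\<lambda>t. \<eta> t 1) else if a = 2 then cyl_dt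
     else if a = 3 then (-1) *\<^sub>F cyl_form (\<lambda>t. \<eta> t 3) else if a = 4 then cyl_form (\<lambda>t. \<eta> t 2)
     else cyl_form (\<lambda>t. \<eta> t 0))"

lemma coframe_cyl_coframe:
  fixes X :: "('m, 'e::euclidean_space, 'i) mfd"
  assumes X: "smooth_manifold X" and T: "open T" and \<eta>: "id_structure_family X T \<eta>"
  shows "coframe (cylinder X T) {1..5} (cyl_coframe \<eta>)"
  unfolding coframe_def
proof (intro conjI ballI)
  note fam = id_structure_family_smooth[OF X T \<eta>]
  have "kform (cylinder X T) 1 (cyl_form (\<lambda>t. \<eta> t a))" if "a \<in> {0..3}" for a
    by (intro kform_cyl_form[OF X fam(1)[OF that] fam(2)[OF that]])
  then show "kform (cylinder X T) 1 (cyl_coframe \<eta> a)" for a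
    unfolding cyl_coframe_def
    by (auto intro: kform_scale smooth_manifold_cylinder[OF X T] kform_cyl_dt[OF X T])
next
  fix i z assume "i \<in> idx (cylinder X T)" "z \<in> chart_img (cylinder X T) i"
  then obtain x t where i: "i \<in> idx X" and x: "x \<in> chart_img X i" and t: "t \<in> T" and z: "z = (x, t)"
    by (auto simp: idx_cylinder chart_img_cylinder)
  have "coframe X {0..3} (\<eta> t)"
    using \<eta> t by (simp add: id_structure_family_def)
  then have co: "\<And>c. (\<forall>v. (\<Sum>a\<in>{0..3}. c a * \<eta> t a i x v) = 0) \<Longrightarrow> \<forall>a\<in>{0..3}. c a = 0"
    "\<And>f. alternating 1 f \<Longrightarrow> \<exists>c. \<forall>v. f v = (\<Sum>a\<in>{0..3}. c a * \<eta> t a i x v)"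
    using i x unfolding coframe_def by blast+
  have s4: "(\<Sum>a\<in>{0..3}. f a) = f 0 + f 1 + f 2 + f 3" for f :: "nat \<Rightarrow> real"
    by (simp add: numeral_eq_Suc One_nat_def)
  have s5: "(\<Sum>a\<in>{1..5}. c a * cyl_coframe \<eta> a i z v)
      = c 1 * \<eta> t 1 i x (\<lambda>n. fst (v n)) + c 2 * snd (v 0) - c 3 * \<eta> t 3 i x (\<lambda>n. fst (v n))
        + c 4 * \<eta> t 2 i x (\<lambda>n. fst (v n)) + c 5 * \<eta> t 0 i x (\<lambda>n. fst (v n))" for c v
  proof -
    have "{1..5::nat} = {1, 2, 3, 4, 5}" by auto
    then show ?thesis
      by (simp add: cyl_coframe_def z cyl_form_apply cyl_dt_apply scale_form_def)
  qed
  show "\<forall>c. (\<forall>v. (\<Sum>a\<in>{1..5}. c a * cyl_coframe \<eta> a i z v) = 0) \<longrightarrow> (\<forall>a\<in>{1..5}. c a = 0)"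
  proof (intro allI impI)
    fix c :: "nat \<Rightarrow> real" assume c: "\<forall>v. (\<Sum>a\<in>{1..5}. c a * cyl_coframe \<eta> a i z v) = 0"
    define c' where "c' = (\<lambda>a::nat. if a = 0 then c 5 else if a = 1 then c 1 else if a = 2 then c 4 else - c 3)"
    have c': "(\<Sum>a\<in>{0..3}. c' a * \<eta> t a i x v) = 0" for v
      using c[rule_format, of "\<lambda>n. (v n, 0)"] unfolding s4 s5 by (simp add: c'_def)
    then have "\<forall>a\<in>{0..3}. c' a = 0"
      by (intro co(1)) simp
    then have "c' 0 = 0" "c' 1 = 0" "c' 2 = 0" "c' 3 = 0" by simp_all
    then have 0: "c 5 = 0" "c 1 = 0" "c 4 = 0" "c 3 = 0" by (simp_all add: c'_def)
    have "c 2 = 0"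
      using c[rule_format, of "\<lambda>n. (0, 1)"] unfolding s5 by (simp add: 0)
    moreover have "{1..5::nat} = {1, 2, 3, 4, 5}" by auto
    ultimately show "\<forall>a\<in>{1..5}. c a = 0" using 0 by simp
  qed
  show "\<forall>f. alternating 1 f \<longrightarrow> (\<exists>c. \<forall>v. f v = (\<Sum>a\<in>{1..5}. c a * cyl_coframe \<eta> a i z v))"
  proof (intro allI impI)
    fix f :: "(nat \<Rightarrow> 'e \<times> real) \<Rightarrow> real" assume f: "alternating 1 f"
    note lin = alternating_1_linear[OF f]
    have "linear (\<lambda>u::'e. (u, 0::real))"
      by (rule linearI) simp_all
    then have "alternating 1 (\<lambda>v. f (\<lambda>_. (v 0, 0)))"
      using linear_compose[OF _ lin] by (intro alternating_1I[where g = "\<lambda>u. f (\<lambda>_. (u, 0))"]) (simp_all add: o_def)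
    then obtain c where c: "\<And>v. f (\<lambda>_. (v 0, 0)) = (\<Sum>a\<in>{0..3}. c a * \<eta> t a i x v)"
      using co(2) by blast
    define c' where "c' = (\<lambda>a::nat. if a = 1 then c 1 else if a = 2 then f (\<lambda>_. (0, 1))
      else if a = 3 then - c 3 else if a = 4 then c 2 else c 0)"
    have "f v = (\<Sum>a\<in>{1..5}. c' a * cyl_coframe \<eta> a i z v)" for v
    proof -
      have "v 0 = (fst (v 0), 0) + snd (v 0) *\<^sub>R (0, 1)" by (simp add: prod_eq_iff)
      then have "f v = f (\<lambda>_. (fst (v 0), 0) + snd (v 0) *\<^sub>R (0, 1))"
        using alternating_1[OF f, of v] by metis
      also have "\<dots> = f (\<lambda>_. (fst (v 0), 0)) + snd (v 0) * f (\<lambda>_. (0, 1))"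
        unfolding linear_add[OF lin] linear_scale[OF lin] by simp
      finally show ?thesis
        using c[of "\<lambda>n. fst (v n)"] unfolding s5 s4 by (simp add: c'_def)
    qed
    then show "\<exists>c. \<forall>v. f v = (\<Sum>a\<in>{1..5}. c a * cyl_coframe \<eta> a i z v)"
      by blast
  qed
qed

lemma su2_structure_cylinder:
  fixes X :: "('m, real ^ 4, 'i) mfd"
  assumes X: "smooth_manifold X" and T: "open T" and \<eta>: "id_structure_family X T \<eta>"
  shows "su2_structure (cylinder X T) (cyl_form (\<lambda>t. \<eta> t 0))
            (cyl_form (\<lambda>t. wedge2 (\<eta> t) 2 3) + wedge 1 1 (cyl_form (\<lambda>t. \<eta> t 1)) cyl_dt)
            (cyl_form (\<lambda>t. wedge2 (\<eta> t) 3 1) + wedge 1 1 (cyl_form (\<lambda>t. \<eta> t 2)) cyl_dt)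
            (cyl_form (\<lambda>t. wedge2 (\<eta> t) 1 2) + wedge 1 1 (cyl_form (\<lambda>t. \<eta> t 3)) cyl_dt)"
proof -
  let ?C = "cylinder X T" and ?e = "cyl_coframe \<eta>"
  let ?h = "\<lambda>a. cyl_form (\<lambda>t. \<eta> t a)"
  note C = smooth_manifold_cylinder[OF X T]
  note fam = id_structure_family_smooth[OF X T \<eta>]
  have k: "kform ?C 1 (?h a)" if "a \<in> {0..3}" for a
    by (intro kform_cyl_form[OF X fam(1)[OF that] fam(2)[OF that]])
  have alt: "alternating 1 (?h a i (x, t))" if "a \<in> {0..3}" "i \<in> idx X" "x \<in> chart_img X i" "t \<in> T" for a i x t
    by (rule alternating_cyl_form[OF fam(1)[OF that(1)] that(4,2,3)])
  have kw: "kform ?C 2 (cyl_form (\<lambda>t. wedge2 (\<eta> t) a b) + wedge 1 1 (?h c) cyl_dt)"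
    if "a \<in> {0..3}" "b \<in> {0..3}" "c \<in> {0..3}" for a b c
    unfolding cyl_form_wedge by (intro kform_add kform_wedge_1_1 C k that kform_cyl_dt X T)
  have e: "?e 1 = ?h 1" "?e 2 = cyl_dt" "?e 3 = (-1) *\<^sub>F ?h 3" "?e 4 = ?h 2" "?e 5 = ?h 0"
    by (simp_all add: cyl_coframe_def)
  have "?h 0 \<doteq>\<^bsub>?C\<^esub> ?e 5"
    by (simp add: e form_eq_refl)
  moreover have "cyl_form (\<lambda>t. wedge2 (\<eta> t) 2 3) + wedge 1 1 (?h 1) cyl_dt \<doteq>\<^bsub>?C\<^esub> wedge2 ?e 1 2 + wedge2 ?e 3 4"
    unfolding cyl_form_wedge e wedge_scale_left
    by (rule cyl_form_eqI) (simp add: scale_form_def wedge_1_1_swap[of "?h 2" _ _ "?h 3"] alt)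
  moreover have "cyl_form (\<lambda>t. wedge2 (\<eta> t) 3 1) + wedge 1 1 (?h 2) cyl_dt \<doteq>\<^bsub>?C\<^esub> wedge2 ?e 1 3 + wedge2 ?e 4 2"
    unfolding cyl_form_wedge e wedge_scale_right
    by (rule cyl_form_eqI) (simp add: scale_form_def wedge_1_1_swap[of "?h 3" _ _ "?h 1"] alt)
  moreover have "cyl_form (\<lambda>t. wedge2 (\<eta> t) 1 2) + wedge 1 1 (?h 3) cyl_dt \<doteq>\<^bsub>?C\<^esub> wedge2 ?e 1 4 + wedge2 ?e 2 3"
    unfolding cyl_form_wedge e wedge_scale_right
    by (rule cyl_form_eqI)
      (simp add: scale_form_def wedge_1_1_swap[of "?h 3" _ _ cyl_dt] alt alternating_1_cyl_dt)
  ultimately show ?thesis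
    unfolding su2_structure_def
    using C coframe_cyl_coframe[OF X T \<eta>] k[of 0] kw[of 2 3 1] kw[of 3 1 2] kw[of 1 2 3]
    by (intro conjI ballI exI[of _ "topspace (pts ?C)"] exI[of _ ?e])
      (simp_all add: restrict_topspace[OF C])
qed

lemma einstein_sasaki_cylinder_iff:
  fixes X :: "('m, real ^ 4, 'i) mfd"
  assumes X: "smooth_manifold X" and T: "open T" and \<eta>: "id_structure_family X T \<eta>"
  shows "einstein_sasaki (cylinder X T) (cyl_form (\<lambda>t. \<eta> t 0))
            (cyl_form (\<lambda>t. wedge2 (\<eta> t) 2 3) + wedge 1 1 (cyl_form (\<lambda>t. \<eta> t 1)) cyl_dt)
            (cyl_form (\<lambda>t. wedge2 (\<eta> t) 3 1) + wedge 1 1 (cyl_form (\<lambda>t. \<eta> t 2)) cyl_dt)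
            (cyl_form (\<lambda>t. wedge2 (\<eta> t) 1 2) + wedge 1 1 (cyl_form (\<lambda>t. \<eta> t 3)) cyl_dt)
    \<longleftrightarrow> (\<forall>t\<in>T. hypo_star X (\<eta> t)
        \<and> time_deriv (\<lambda>s. \<eta> s 0) t \<doteq>\<^bsub>X\<^esub> 2 *\<^sub>F \<eta> t 1
        \<and> time_deriv (\<lambda>s. wedge2 (\<eta> s) 3 1) t \<doteq>\<^bsub>X\<^esub> 3 *\<^sub>F wedge2 (\<eta> t) 0 3 - ext_d 1 (\<eta> t 2)
        \<and> time_deriv (\<lambda>s. wedge2 (\<eta> s) 1 2) t \<doteq>\<^bsub>X\<^esub> (-3) *\<^sub>F wedge2 (\<eta> t) 0 2 - ext_d 1 (\<eta> t 3))"
proof -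
  have fam: "smooth_family X 1 T (\<lambda>t. \<eta> t a)" if "a \<in> {0..3}" for a
    by (rule id_structure_family_smooth[OF X T \<eta> that])
  have fam2: "smooth_family X 2 T (\<lambda>t. wedge2 (\<eta> t) a b)" if "a \<in> {0..3}" "b \<in> {0..3}" for a b
    by (intro smooth_family_wedge_1_1 fam that)
  have assoc: "wedge 1 2 (\<eta> t a) (wedge2 (\<eta> t) b c) \<doteq>\<^bsub>X\<^esub> wedge3 (\<eta> t) a b c"
    if "t \<in> T" "a \<in> {0..3}" "b \<in> {0..3}" "c \<in> {0..3}" for t a b c
    by (rule form_eqI, rule wedge_assoc)
      (rule smooth_familyD(2)[OF fam[OF that(2)] that(1)] smooth_familyD(2)[OF fam[OF that(3)] that(1)]
        smooth_familyD(2)[OF fam[OF that(4)] that(1)]; assumption)+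
  have E1: "(-1) *\<^sub>F \<alpha> \<doteq>\<^bsub>X\<^esub> (-2) *\<^sub>F \<beta> \<longleftrightarrow> \<alpha> \<doteq>\<^bsub>X\<^esub> 2 *\<^sub>F \<beta>" for \<alpha> \<beta> :: "('i, real ^ 4) form"
    by (simp add: form_eq_def scale_form_def)
  have E2: "\<alpha> + \<beta> \<doteq>\<^bsub>X\<^esub> \<gamma> \<longleftrightarrow> \<alpha> \<doteq>\<^bsub>X\<^esub> \<gamma> - \<beta>" for \<alpha> \<beta> \<gamma> :: "('i, real ^ 4) form"
    by (simp add: form_eq_def eq_diff_eq)
  have E3: "\<alpha> \<doteq>\<^bsub>X\<^esub> c *\<^sub>F wedge 1 2 (\<eta> t a) (wedge2 (\<eta> t) b d) \<longleftrightarrow> \<alpha> \<doteq>\<^bsub>X\<^esub> c *\<^sub>F wedge3 (\<eta> t) a b d"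
    if "t \<in> T" "a \<in> {0..3}" "b \<in> {0..3}" "d \<in> {0..3}" for \<alpha> c t a b d
    using assoc[OF that] by (simp add: form_eq_def scale_form_def)
  have "einstein_sasaki (cylinder X T) (cyl_form (\<lambda>t. \<eta> t 0))
            (cyl_form (\<lambda>t. wedge2 (\<eta> t) 2 3) + wedge 1 1 (cyl_form (\<lambda>t. \<eta> t 1)) cyl_dt)
            (cyl_form (\<lambda>t. wedge2 (\<eta> t) 3 1) + wedge 1 1 (cyl_form (\<lambda>t. \<eta> t 2)) cyl_dt)
            (cyl_form (\<lambda>t. wedge2 (\<eta> t) 1 2) + wedge 1 1 (cyl_form (\<lambda>t. \<eta> t 3)) cyl_dt)
    \<longleftrightarrow> (\<forall>t\<in>T. ext_d 1 (\<eta> t 0) \<doteq>\<^bsub>X\<^esub> (-2) *\<^sub>F wedge2 (\<eta> t) 2 3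
          \<and> (-1) *\<^sub>F time_deriv (\<lambda>s. \<eta> s 0) t \<doteq>\<^bsub>X\<^esub> (-2) *\<^sub>F \<eta> t 1)
      \<and> (\<forall>t\<in>T. ext_d 2 (wedge2 (\<eta> t) 3 1) \<doteq>\<^bsub>X\<^esub> 3 *\<^sub>F wedge 1 2 (\<eta> t 0) (wedge2 (\<eta> t) 1 2)
          \<and> time_deriv (\<lambda>s. wedge2 (\<eta> s) 3 1) t + ext_d 1 (\<eta> t 2) \<doteq>\<^bsub>X\<^esub> 3 *\<^sub>F wedge2 (\<eta> t) 0 3)
      \<and> (\<forall>t\<in>T. ext_d 2 (wedge2 (\<eta> t) 1 2) \<doteq>\<^bsub>X\<^esub> (-3) *\<^sub>F wedge 1 2 (\<eta> t 0) (wedge2 (\<eta> t) 3 1)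
          \<and> time_deriv (\<lambda>s. wedge2 (\<eta> s) 1 2) t + ext_d 1 (\<eta> t 3) \<doteq>\<^bsub>X\<^esub> (-3) *\<^sub>F wedge2 (\<eta> t) 0 2)"
    unfolding einstein_sasaki_def
      ext_d_1_cyl_eq_iff[OF fam[of 0, simplified] fam[of 1, simplified]]
      ext_d_2_cyl_eq_iff[OF X T fam2[of 3 1, simplified] fam[of 0, simplified] fam[of 2, simplified] fam[of 3, simplified]]
      ext_d_2_cyl_eq_iff[OF X T fam2[of 1 2, simplified] fam[of 0, simplified] fam[of 3, simplified] fam[of 2, simplified]]
    using su2_structure_cylinder[OF X T \<eta>] by simp
  then show ?thesis
    unfolding hypo_star_def E1 E2 by (auto simp: E3)
qed

section \<open>Propagation of the structure equations\<close>

text \<open>The computation behind the propagation of the equation \<open>d A = c \<alpha> \<and> B\<close>. Both time derivatives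
  are \<open>- c \<alpha> \<and> d p\<close>: on the left \<open>d d q\<close> and \<open>d \<alpha> \<and> p\<close> vanish, on the right the derivative of \<open>\<alpha>\<close>
  does not contribute and \<open>\<alpha> \<and> \<alpha> \<and> q = 0\<close>. It is used with \<open>(A, B) = (\<eta>\<^sup>3\<^sup>1, \<eta>\<^sup>1\<^sup>2)\<close>, \<open>c = 3\<close>
  and with \<open>(A, B) = (\<eta>\<^sup>1\<^sup>2, \<eta>\<^sup>3\<^sup>1)\<close>, \<open>c = - 3\<close>.\<close>

lemma structure_equation_propagates:
  fixes X :: "('m, 'e::euclidean_space, 'i) mfd"
  assumes fam: "smooth_family X 1 T \<alpha>" "smooth_family X 1 T p" "smooth_family X 1 T q"
      "smooth_family X 2 T A" "smooth_family X 2 T B"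
    and t: "t \<in> T"
    and A: "time_deriv A t \<doteq>\<^bsub>X\<^esub> c *\<^sub>F wedge 1 1 (\<alpha> t) (p t) - ext_d 1 (q t)"
    and B: "time_deriv B t \<doteq>\<^bsub>X\<^esub> (-c) *\<^sub>F wedge 1 1 (\<alpha> t) (q t) - ext_d 1 (p t)"
    and d\<alpha>: "wedge 2 1 (ext_d 1 (\<alpha> t)) (p t) \<doteq>\<^bsub>X\<^esub> 0"
    and \<alpha>': "wedge 1 2 (time_deriv \<alpha> t) (B t) \<doteq>\<^bsub>X\<^esub> 0"
  shows "time_deriv (\<lambda>s. ext_d 2 (A s)) t \<doteq>\<^bsub>X\<^esub> time_deriv (\<lambda>s. c *\<^sub>F wedge 1 2 (\<alpha> s) (B s)) t"
proof (rule form_eqI)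
  fix i x v assume i: "i \<in> idx X" and x: "x \<in> chart_img X i"
  note sm = smooth_family_at[OF fam(1) t] smooth_family_at[OF fam(2) t] smooth_family_at[OF fam(3) t]
  have diff: "\<beta> - \<gamma> = \<beta> + (-1) *\<^sub>F \<gamma>" for \<beta> \<gamma> :: "('i, 'e) form"
    by (simp add: fun_eq_iff scale_form_def)
  note s1 = smooth_form_scale[OF smooth_form_wedge_1_1[OF sm(1,2)], of c]
    and s2 = smooth_form_scale[OF smooth_form_ext_d_1[OF sm(3)], of "-1"]
  have "time_deriv (\<lambda>s. ext_d 2 (A s)) t i x v = ext_d 2 (time_deriv A t) i x v"
    by (rule form_eqD[OF time_deriv_ext_d[OF smooth_familyD(1)[OF fam(4)] t] i x])
  also have "\<dots> = ext_d 2 (c *\<^sub>F wedge 1 1 (\<alpha> t) (p t) + (-1) *\<^sub>F ext_d 1 (q t)) i x v"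
    by (rule form_eqD[OF ext_d_cong[OF smooth_family_at[OF smooth_family_time_deriv[OF fam(4)] t] A[unfolded diff]] i x])
  also have "\<dots> = c * ext_d 2 (wedge 1 1 (\<alpha> t) (p t)) i x v - ext_d 2 (ext_d 1 (q t)) i x v"
    using form_eqD[OF ext_d_add[OF s1 s2] i x, of 2 v]
      form_eqD[OF ext_d_scale[OF smooth_form_wedge_1_1[OF sm(1,2)]] i x, of 2 c v]
      form_eqD[OF ext_d_scale[OF smooth_form_ext_d_1[OF sm(3)]] i x, of 2 "-1" v]
    by (simp add: scale_form_def)
  also have "\<dots> = - c * wedge 1 2 (\<alpha> t) (ext_d 1 (p t)) i x v"
    using ext_d_ext_d[OF sm(3) i x, of v] form_eqD[OF ext_d_wedge_1_1[OF sm(1,2)] i x, of v]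
      form_eqD[OF d\<alpha> i x, of v] by simp
  finally have L: "time_deriv (\<lambda>s. ext_d 2 (A s)) t i x v = - c * wedge 1 2 (\<alpha> t) (ext_d 1 (p t)) i x v" .
  note sc = smooth_familyD(1)[OF fam(1)] smooth_familyD(1)[OF fam(5)]
  have "wedge 1 2 (\<alpha> t) (time_deriv B t) i x v
      = wedge 1 2 (\<alpha> t) ((-c) *\<^sub>F wedge 1 1 (\<alpha> t) (q t) + (-1) *\<^sub>F ext_d 1 (p t)) i x v"
    by (rule wedge_cong) (rule refl form_eqD[OF B[unfolded diff] i x])+
  also have "\<dots> = - wedge 1 2 (\<alpha> t) (ext_d 1 (p t)) i x v"
    using wedge_repeated(1)[of "\<alpha> t" i x "q t" v, OF smooth_familyD(2)[OF fam(1) t i x] smooth_familyD(2)[OF fam(3) t i x]]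
    by (simp add: wedge_add_right wedge_scale_right) (simp add: scale_form_def)
  finally have "time_deriv (\<lambda>s. c *\<^sub>F wedge 1 2 (\<alpha> s) (B s)) t i x v = - c * wedge 1 2 (\<alpha> t) (ext_d 1 (p t)) i x v"
    using form_eqD[OF time_deriv_scale[OF smooth_coeffs_wedge[OF sc] t] i x, of c 1 2 v]
      form_eqD[OF time_deriv_wedge[OF sc t] i x, of 1 2 v] form_eqD[OF \<alpha>' i x, of v]
    by (simp add: scale_form_def)
  with L show "time_deriv (\<lambda>s. ext_d 2 (A s)) t i x v = time_deriv (\<lambda>s. c *\<^sub>F wedge 1 2 (\<alpha> s) (B s)) t i x v"
    by simp
qed

lemma time_deriv_ext_d_1_scaled:
  fixes X :: "('m, 'e::euclidean_space, 'i) mfd"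
  assumes \<alpha>: "smooth_family X 1 T \<alpha>" and \<beta>: "smooth_form X 1 \<beta>" and t: "t \<in> T"
    and ev: "time_deriv \<alpha> t \<doteq>\<^bsub>X\<^esub> c *\<^sub>F \<beta>"
  shows "time_deriv (\<lambda>s. ext_d 1 (\<alpha> s)) t \<doteq>\<^bsub>X\<^esub> c *\<^sub>F ext_d 1 \<beta>"
proof -
  have "time_deriv (\<lambda>s. ext_d 1 (\<alpha> s)) t \<doteq>\<^bsub>X\<^esub> ext_d 1 (time_deriv \<alpha> t)"
    by (rule time_deriv_ext_d[OF smooth_familyD(1)[OF \<alpha>] t])
  moreover have "ext_d 1 (time_deriv \<alpha> t) \<doteq>\<^bsub>X\<^esub> ext_d 1 (c *\<^sub>F \<beta>)"
    by (rule ext_d_cong[OF smooth_family_at[OF smooth_family_time_deriv[OF \<alpha>] t] ev])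
  moreover have "ext_d 1 (c *\<^sub>F \<beta>) \<doteq>\<^bsub>X\<^esub> c *\<^sub>F ext_d 1 \<beta>"
    by (rule ext_d_scale[OF \<beta>])
  ultimately show ?thesis
    by (blast intro: form_eq_trans)
qed

text \<open>The evolution equation that is a consequence of the others: differentiate
  \<open>d \<eta>\<^sup>0 = - 2 \<eta>\<^sup>2\<^sup>3\<close> in time.\<close>

lemma evolution_23:
  fixes X :: "('m, 'e::euclidean_space, 'i) mfd"
  assumes X: "smooth_manifold X" and T: "open T" and \<eta>: "id_structure_family X T \<eta>" and t: "t \<in> T"
    and star: "\<And>s. s \<in> T \<Longrightarrow> ext_d 1 (\<eta> s 0) \<doteq>\<^bsub>X\<^esub> (-2) *\<^sub>F wedge2 (\<eta> s) 2 3"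
    and ev: "time_deriv (\<lambda>s. \<eta> s 0) t \<doteq>\<^bsub>X\<^esub> 2 *\<^sub>F \<eta> t 1"
  shows "time_deriv (\<lambda>s. wedge2 (\<eta> s) 2 3) t \<doteq>\<^bsub>X\<^esub> - ext_d 1 (\<eta> t 1)"
proof (rule form_eqI)
  fix i x v assume i: "i \<in> idx X" and x: "x \<in> chart_img X i"
  have fam: "smooth_family X 1 T (\<lambda>t. \<eta> t a)" if "a \<in> {0..3}" for a
    by (rule id_structure_family_smooth[OF X T \<eta> that])
  have f23: "smooth_family X 2 T (\<lambda>t. wedge2 (\<eta> t) 2 3)"
    by (intro smooth_family_wedge_1_1 fam) simp_all
  have "time_deriv (\<lambda>s. ext_d 1 (\<eta> s 0)) t i x v = (2 *\<^sub>F ext_d 1 (\<eta> t 1)) i x v"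
    by (rule form_eqD[OF time_deriv_ext_d_1_scaled[OF fam smooth_family_at[OF fam t] t ev] i x]) simp_all
  moreover have "time_deriv (\<lambda>s. ext_d 1 (\<eta> s 0)) t i x v = time_deriv (\<lambda>s. (-2) *\<^sub>F wedge2 (\<eta> s) 2 3) t i x v"
    by (rule form_eqD[OF time_deriv_cong[OF T t star] i x])
  moreover have "\<dots> = ((-2) *\<^sub>F time_deriv (\<lambda>s. wedge2 (\<eta> s) 2 3) t) i x v"
    by (rule form_eqD[OF time_deriv_scale[OF smooth_familyD(1)[OF f23] t] i x])
  ultimately show "time_deriv (\<lambda>s. wedge2 (\<eta> s) 2 3) t i x v = (- ext_d 1 (\<eta> t 1)) i x v"
    by (simp add: scale_form_def)
qed

text \<open>The equation for \<open>d \<eta>\<^sup>0\<close> has to come first, at all times, since the other two rely on it.\<close>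

lemma hypo_star_preserved:
  fixes X :: "('m, 'e::euclidean_space, 'i) mfd"
  assumes X: "smooth_manifold X" and T: "open T" "convex T" and \<eta>: "id_structure_family X T \<eta>"
    and t0: "t\<^sub>0 \<in> T" "hypo_star X (\<eta> t\<^sub>0)" and ev: "\<And>t. t \<in> T \<Longrightarrow> evolution_eqs X \<eta> t" and t: "t \<in> T"
  shows "hypo_star X (\<eta> t)"
proof -
  have fam: "smooth_family X 1 T (\<lambda>t. \<eta> t a)" if "a \<in> {0..3}" for a
    by (rule id_structure_family_smooth[OF X T(1) \<eta> that])
  have fam2: "smooth_family X 2 T (\<lambda>t. wedge2 (\<eta> t) a b)" if "a \<in> {0..3}" "b \<in> {0..3}" for a b
    by (intro smooth_family_wedge_1_1 fam that)
  have alt: "alternating 1 (\<eta> s a i x)" if "s \<in> T" "a \<in> {0..3}" "i \<in> idx X" "x \<in> chart_img X i" for s a i x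
    by (rule smooth_familyD(2)[OF fam[OF that(2)] that(1,3,4)])
  have assoc: "c *\<^sub>F wedge3 (\<eta> s) 0 a b \<doteq>\<^bsub>X\<^esub> c *\<^sub>F wedge 1 2 (\<eta> s 0) (wedge2 (\<eta> s) a b)"
    if "s \<in> T" "a \<in> {0..3}" "b \<in> {0..3}" for s a b c
    using that by (intro form_eqI) (simp add: scale_form_def wedge_assoc alt)
  note ev' = ev[unfolded evolution_eqs_def]
  note sc = smooth_familyD(1)
  have d0: "ext_d 1 (\<eta> s 0) \<doteq>\<^bsub>X\<^esub> (-2) *\<^sub>F wedge2 (\<eta> s) 2 3" if s: "s \<in> T" for s
  proof (rule form_eq_if_time_deriv_eq[where \<xi> = "\<lambda>s. ext_d 1 (\<eta> s 0)" and \<zeta> = "\<lambda>s. (-2) *\<^sub>F wedge2 (\<eta> s) 2 3",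
        OF _ _ T(2) t0(1) s])
    show "smooth_coeffs X T (\<lambda>s. ext_d 1 (\<eta> s 0))"
      by (intro smooth_coeffs_ext_d sc[OF fam]) simp
    show "smooth_coeffs X T (\<lambda>s. (-2) *\<^sub>F wedge2 (\<eta> s) 2 3)"
      by (intro smooth_coeffs_scale sc[OF fam2]) simp_all
    show "ext_d 1 (\<eta> t\<^sub>0 0) \<doteq>\<^bsub>X\<^esub> (-2) *\<^sub>F wedge2 (\<eta> t\<^sub>0) 2 3"
      using t0(2) by (simp add: hypo_star_def)
    fix r assume r: "r \<in> T"
    have "time_deriv (\<lambda>s. ext_d 1 (\<eta> s 0)) r \<doteq>\<^bsub>X\<^esub> 2 *\<^sub>F ext_d 1 (\<eta> r 1)"
      using ev'[OF r] by (intro time_deriv_ext_d_1_scaled[OF fam smooth_family_at[OF fam r] r]) simp_all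
    moreover have "time_deriv (\<lambda>s. (-2) *\<^sub>F wedge2 (\<eta> s) 2 3) r
        \<doteq>\<^bsub>X\<^esub> (-2) *\<^sub>F time_deriv (\<lambda>s. wedge2 (\<eta> s) 2 3) r"
      by (rule time_deriv_scale[OF sc[OF fam2] r]) simp_all
    moreover have "time_deriv (\<lambda>s. wedge2 (\<eta> s) 2 3) r \<doteq>\<^bsub>X\<^esub> - ext_d 1 (\<eta> r 1)"
      using ev'[OF r] by simp
    ultimately show "time_deriv (\<lambda>s. ext_d 1 (\<eta> s 0)) r \<doteq>\<^bsub>X\<^esub> time_deriv (\<lambda>s. (-2) *\<^sub>F wedge2 (\<eta> s) 2 3) r"
      by (simp add: form_eq_def scale_form_def)
  qed
  \<comment> \<open>One argument for the two remaining equations; \<open>p\<close> and \<open>q\<close> are \<open>2\<close> and \<open>3\<close> in either order. That \<open>1\<close> is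
    among \<open>a'\<close>, \<open>b'\<close> removes the term with the time derivative \<open>2 \<eta>\<^sup>1\<close> of \<open>\<eta>\<^sup>0\<close>, and \<open>p \<in> {2, 3}\<close> the
    one with \<open>d \<eta>\<^sup>0 = - 2 \<eta>\<^sup>2\<^sup>3\<close>.\<close>
  have transport: "ext_d 2 (wedge2 (\<eta> s) a b) \<doteq>\<^bsub>X\<^esub> c *\<^sub>F wedge3 (\<eta> s) 0 a' b'"
    if s: "s \<in> T"
      and ab: "a \<in> {0..3}" "b \<in> {0..3}" "a' \<in> {0..3}" "b' \<in> {0..3}" "p \<in> {2, 3}" "q \<in> {2, 3}"
      and 1: "a' = 1 \<or> b' = 1"
      and init: "ext_d 2 (wedge2 (\<eta> t\<^sub>0) a b) \<doteq>\<^bsub>X\<^esub> c *\<^sub>F wedge3 (\<eta> t\<^sub>0) 0 a' b'"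
      and A: "\<And>r. r \<in> T \<Longrightarrow> time_deriv (\<lambda>s. wedge2 (\<eta> s) a b) r \<doteq>\<^bsub>X\<^esub> c *\<^sub>F wedge2 (\<eta> r) 0 p - ext_d 1 (\<eta> r q)"
      and B: "\<And>r. r \<in> T \<Longrightarrow> time_deriv (\<lambda>s. wedge2 (\<eta> s) a' b') r \<doteq>\<^bsub>X\<^esub> (-c) *\<^sub>F wedge2 (\<eta> r) 0 q - ext_d 1 (\<eta> r p)"
    for s a b a' b' p q c
  proof -
    have pq: "p \<in> {0..3}" "q \<in> {0..3}" using ab by auto
    have "ext_d 2 (wedge2 (\<eta> s) a b) \<doteq>\<^bsub>X\<^esub> c *\<^sub>F wedge 1 2 (\<eta> s 0) (wedge2 (\<eta> s) a' b')"
    proof (rule form_eq_if_time_deriv_eq[where \<xi> = "\<lambda>s. ext_d 2 (wedge2 (\<eta> s) a b)"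
          and \<zeta> = "\<lambda>s. c *\<^sub>F wedge 1 2 (\<eta> s 0) (wedge2 (\<eta> s) a' b')", OF _ _ T(2) t0(1) s])
      show "smooth_coeffs X T (\<lambda>s. ext_d 2 (wedge2 (\<eta> s) a b))"
        by (intro smooth_coeffs_ext_d sc[OF fam2] ab)
      show "smooth_coeffs X T (\<lambda>s. c *\<^sub>F wedge 1 2 (\<eta> s 0) (wedge2 (\<eta> s) a' b'))"
        by (intro smooth_coeffs_scale smooth_coeffs_wedge sc[OF fam2] sc[OF fam] ab) simp
      show "ext_d 2 (wedge2 (\<eta> t\<^sub>0) a b) \<doteq>\<^bsub>X\<^esub> c *\<^sub>F wedge 1 2 (\<eta> t\<^sub>0 0) (wedge2 (\<eta> t\<^sub>0) a' b')"
        by (rule form_eq_trans[OF init assoc[OF t0(1) ab(3,4)]])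
      fix r assume r: "r \<in> T"
      have "wedge 2 1 (ext_d 1 (\<eta> r 0)) (\<eta> r p) \<doteq>\<^bsub>X\<^esub> 0"
      proof (rule form_eqI)
        fix i x v assume i: "i \<in> idx X" and x: "x \<in> chart_img X i"
        have "wedge 2 1 (ext_d 1 (\<eta> r 0)) (\<eta> r p) i x v = wedge 2 1 ((-2) *\<^sub>F wedge2 (\<eta> r) 2 3) (\<eta> r p) i x v"
          by (rule wedge_cong) (rule refl form_eqD[OF d0[OF r] i x])+
        also have "\<dots> = -2 * wedge 2 1 (wedge2 (\<eta> r) 2 3) (\<eta> r p) i x v"
          by (simp only: wedge_scale_left) (simp add: scale_form_def)
        also have "wedge 2 1 (wedge2 (\<eta> r) 2 3) (\<eta> r p) i x v = 0"
          using ab(5) wedge_repeated(3)[of "\<eta> r 2" i x "\<eta> r 3" v] wedge_repeated(4)[of "\<eta> r 3" i x "\<eta> r 2" v]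
            alt[OF r _ i x, of 2] alt[OF r _ i x, of 3] by auto
        finally show "wedge 2 1 (ext_d 1 (\<eta> r 0)) (\<eta> r p) i x v = 0 i x v" by simp
      qed
      moreover have "wedge 1 2 (time_deriv (\<lambda>s. \<eta> s 0) r) (wedge2 (\<eta> r) a' b') \<doteq>\<^bsub>X\<^esub> 0"
      proof (rule form_eqI)
        fix i x v assume i: "i \<in> idx X" and x: "x \<in> chart_img X i"
        have "wedge 1 2 (time_deriv (\<lambda>s. \<eta> s 0) r) (wedge2 (\<eta> r) a' b') i x v
            = wedge 1 2 (2 *\<^sub>F \<eta> r 1) (wedge2 (\<eta> r) a' b') i x v"
          by (rule wedge_cong) (rule refl form_eqD[OF conjunct1[OF ev'[OF r]] i x])+
        also have "\<dots> = 2 * wedge 1 2 (\<eta> r 1) (wedge2 (\<eta> r) a' b') i x v"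
          by (simp only: wedge_scale_left) (simp add: scale_form_def)
        also have "wedge 1 2 (\<eta> r 1) (wedge2 (\<eta> r) a' b') i x v = 0"
          using 1 wedge_repeated(1)[of "\<eta> r 1" i x "\<eta> r b'" v] wedge_repeated(2)[of "\<eta> r 1" i x "\<eta> r a'" v]
            alt[OF r _ i x, of 1] alt[OF r ab(3) i x] alt[OF r ab(4) i x] by auto
        finally show "wedge 1 2 (time_deriv (\<lambda>s. \<eta> s 0) r) (wedge2 (\<eta> r) a' b') i x v = 0 i x v" by simp
      qed
      ultimately show "time_deriv (\<lambda>s. ext_d 2 (wedge2 (\<eta> s) a b)) r
          \<doteq>\<^bsub>X\<^esub> time_deriv (\<lambda>s. c *\<^sub>F wedge 1 2 (\<eta> s 0) (wedge2 (\<eta> s) a' b')) r"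
        by (intro structure_equation_propagates[OF fam fam[OF pq(1)] fam[OF pq(2)] fam2[OF ab(1,2)] fam2[OF ab(3,4)] r A[OF r] B[OF r]])
          simp_all
    qed
    then show ?thesis
      by (rule form_eq_trans) (rule form_eq_sym[OF assoc[OF s ab(3,4)]])
  qed
  have "ext_d 2 (wedge2 (\<eta> t) 3 1) \<doteq>\<^bsub>X\<^esub> 3 *\<^sub>F wedge3 (\<eta> t) 0 1 2"
    by (rule transport[where p = 3 and q = 2, OF t]) (use t0(2) ev' in \<open>simp_all add: hypo_star_def\<close>)
  moreover have "ext_d 2 (wedge2 (\<eta> t) 1 2) \<doteq>\<^bsub>X\<^esub> (-3) *\<^sub>F wedge3 (\<eta> t) 0 3 1"
    by (rule transport[where p = 2 and q = 3, OF t]) (use t0(2) ev' in \<open>simp_all add: hypo_star_def\<close>)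
  ultimately show ?thesis
    using d0[OF t] by (simp add: hypo_star_def)
qed

theorem proposition6:
  fixes M :: "('m, real ^ 4, 'i) mfd"
    and tm tp :: ereal and t0 :: real
    and \<eta> :: "real \<Rightarrow> nat \<Rightarrow> ('i, real ^ 4) form"
  assumes "smooth_manifold M"
    and "id_structure_family M (einterval tm tp) \<eta>"
    and "t0 \<in> einterval tm tp"
    and "hypo_star M (\<eta> t0)"
  shows "(einstein_sasaki (cylinder M (einterval tm tp))
            (cyl_form (\<lambda>t. \<eta> t 0))
            (cyl_form (\<lambda>t. wedge2 (\<eta> t) 2 3) + wedge 1 1 (cyl_form (\<lambda>t. \<eta> t 1)) cyl_dt)
            (cyl_form (\<lambda>t. wedge2 (\<eta> t) 3 1) + wedge 1 1 (cyl_form (\<lambda>t. \<eta> t 2)) cyl_dt)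
            (cyl_form (\<lambda>t. wedge2 (\<eta> t) 1 2) + wedge 1 1 (cyl_form (\<lambda>t. \<eta> t 3)) cyl_dt)
          \<longleftrightarrow>
          (\<forall>t\<in>einterval tm tp. evolution_eqs M \<eta> t))
       \<and> ((\<forall>t\<in>einterval tm tp. evolution_eqs M \<eta> t)
          \<longrightarrow> (\<forall>t\<in>einterval tm tp. hypo_star M (\<eta> t)))"
proof -
  let ?T = "einterval tm tp"
  have "is_interval ?T"
    unfolding is_interval_1
  proof (intro ballI allI impI)
    fix a b x assume a: "a \<in> ?T" and b: "b \<in> ?T" and x: "a \<le> x \<and> x \<le> b"
    have "tm < ereal a" "ereal a \<le> ereal x" "ereal x \<le> ereal b" "ereal b < tp"
      using a b x by (simp_all add: einterval_iff)
    then show "x \<in> ?T"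
      unfolding einterval_iff by (blast intro: less_le_trans le_less_trans)
  qed
  then have T: "open ?T" "convex ?T"
    by (simp_all add: is_interval_convex)
  have preserved: "hypo_star M (\<eta> t)" if "\<forall>t\<in>?T. evolution_eqs M \<eta> t" "t \<in> ?T" for t
    using that by (intro hypo_star_preserved[OF assms(1) T assms(2,3,4)]) simp_all
  show ?thesis
    unfolding einstein_sasaki_cylinder_iff[OF assms(1) T(1) assms(2)]
  proof (intro conjI iffI ballI impI)
    fix t assume *: "\<forall>t\<in>?T. hypo_star M (\<eta> t)
        \<and> time_deriv (\<lambda>s. \<eta> s 0) t \<doteq>\<^bsub>M\<^esub> 2 *\<^sub>F \<eta> t 1
        \<and> time_deriv (\<lambda>s. wedge2 (\<eta> s) 3 1) t \<doteq>\<^bsub>M\<^esub> 3 *\<^sub>F wedge2 (\<eta> t) 0 3 - ext_d 1 (\<eta> t 2)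
        \<and> time_deriv (\<lambda>s. wedge2 (\<eta> s) 1 2) t \<doteq>\<^bsub>M\<^esub> (-3) *\<^sub>F wedge2 (\<eta> t) 0 2 - ext_d 1 (\<eta> t 3)"
      and t: "t \<in> ?T"
    have "time_deriv (\<lambda>s. wedge2 (\<eta> s) 2 3) t \<doteq>\<^bsub>M\<^esub> - ext_d 1 (\<eta> t 1)"
      by (rule evolution_23[OF assms(1) T(1) assms(2) t]) (use * t in \<open>simp_all add: hypo_star_def\<close>)
    then show "evolution_eqs M \<eta> t"
      using * t by (simp add: evolution_eqs_def)
  qed (simp_all add: preserved evolution_eqs_def)
qed

end
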